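(* Fix $\alpha\in(0,1)$. For every $\ell\in\mathbb{N}=\{1,2,\dots\}$, $(0,\ell)\in h^{4+\alpha}_{0,\mathrm{even}}(\mathbb{T})\times(0,\infty)$ is a bifurcation point for the equation $\bar{\mathcal{G}}(\tilde\rho,\lambda)=0$. In particular, there exists a positive constant $\delta_\ell>0$ and a nontrivial analytic curve $$\Big\{(\tilde\rho_\ell(s),\lambda_\ell(s))\in h^{4+\alpha}_{0,\mathrm{even}}(\mathbb{T})\times\mathbb{R}:s\in(-\delta_\ell,\delta_\ell),\ (\tilde\rho_\ell(0),\lambda_\ell(0))=(0,\ell)\Big\}$$ such that $\bar{\mathcal{G}}(\tilde\rho_\ell(s),\lambda_\ell(s))=0$ for all $s\in(-\delta_\ell,\delta_\ell)$, and all solutions of $\bar{\mathcal{G}}(\tilde\rho,\lambda)=0$ in a neighborhood of $(0,\ell)$ (in $h^{4+\alpha}_{0,\mathrm{even}}(\mathbb{T})\times(0,\infty)$) are either a trivial solution $(0,\lambda)$ or an element of this nontrivial curve. Moreover, if $\lambda\in(0,\infty)\setminus\mathbb{N}$, then $(0,\lambda)$ is not a bifurcation point for $\bar{\mathcal{G}}(\tilde\rho,\lambda)=0$.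
   Context: $\mathbb{T}=[-\pi,\pi]$ with endpoints identified. $h^{k+\alpha}(\mathbb{T})$ is the little-Hölder space of real $f\in C^{k+\alpha}(\mathbb{T})$ with $\lim_{\delta\to0}\sup_{0<d(x,y)<\delta}|f^{(k)}(x)-f^{(k)}(y)|/d(x,y)^\alpha=0$ ($d$ the metric of the circle of length $2\pi$), with the $C^{k+\alpha}$ norm. $P_0\rho=\rho-\frac1{2\pi}\int_{\mathbb{T}}\rho\,dx$, $h^\sigma_0(\mathbb{T})=P_0h^\sigma(\mathbb{T})$ (mean-zero functions), and $h^{4+\alpha}_{0,\mathrm{even}}(\mathbb{T})$ is the subspace of even functions in $h^{4+\alpha}_0(\mathbb{T})$. For positive $r\in h^{4+\alpha}(\mathbb{T})$, $$G(r)=\frac1r\,\partial_x\Big[\frac{r}{\sqrt{1+r_x^2}}\,\partial_x\mathcal{H}(r)\Big],\qquad \mathcal{H}(r)=\frac{1}{r\sqrt{1+r_x^2}}-\frac{r_{xx}}{(1+r_x^2)^{3/2}}.$$ Lifting map: for $\lambda>0$ put $r_\star=1/\lambda$ and $F_\star(\rho)=\int_{\mathbb{T}}(\rho+r_\star)^2dx$. By the implicit function theorem, for $\tilde\rho$ in a neighborhood of $0$ in $h^{\alpha}_0(\mathbb{T})$ there is a unique $\psi(\tilde\rho)$ in a neighborhood of $0$ in $h^{\alpha}(\mathbb{T})$ with $P_0\psi(\tilde\rho)=\tilde\rho$ and $F_\star(\psi(\tilde\rho))=F_\star(0)$; $\psi$ is real analytic with $\psi(0)=0$, depends on $\lambda$,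 preserves the regularity of $\tilde\rho$, and the neighborhood is taken small enough that $\psi(\tilde\rho)>-r_\star$ on $\mathbb{T}$. The bifurcation function is $\bar{\mathcal{G}}(\tilde\rho,\lambda):=P_0\,G(\psi(\tilde\rho)+1/\lambda)$, for $\lambda\in(0,\infty)$ and $\tilde\rho$ near $0$ in $h^{4+\alpha}_{0,\mathrm{even}}(\mathbb{T})$; $(0,\lambda)$ is a (trivial) solution of $\bar{\mathcal{G}}=0$ for every $\lambda>0$. A point $(0,\lambda_0)$ is a bifurcation point if every neighborhood of it contains solutions $(\tilde\rho,\lambda)$ with $\tilde\rho\ne0$. *)

theory Defs
  imports "HOL-Analysis.Analysis"
begin

text \<open>Functions on the circle of length \<open>2\<pi>\<close> are rendered as \<open>2\<pi>\<close>-periodic functions on the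
  real line.\<close>

definition circle_dist :: "real \<Rightarrow> real \<Rightarrow> real" where
  "circle_dist x y = (INF k::int. \<bar>x - y + 2 * pi * of_int k\<bar>)"

definition circle_fun :: "(real \<Rightarrow> real) \<Rightarrow> bool" where
  "circle_fun f \<longleftrightarrow> (\<forall>x. f (x + 2 * pi) = f x)"

definition hoelder_quot :: "real \<Rightarrow> (real \<Rightarrow> real) \<Rightarrow> real \<Rightarrow> real \<Rightarrow> real" where
  "hoelder_quot \<alpha> g x y = \<bar>g x - g y\<bar> / circle_dist x y powr \<alpha>"

definition hoelder_space :: "nat \<Rightarrow> real \<Rightarrow> (real \<Rightarrow> real) set" where
  "hoelder_space k \<alpha> = {f. circle_fun f \<and>
     (\<forall>j<k. \<forall>x. (deriv ^^ j) f differentiable (at x)) \<and>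
     continuous_on UNIV ((deriv ^^ k) f) \<and>
     bdd_above {hoelder_quot \<alpha> ((deriv ^^ k) f) x y | x y. 0 < circle_dist x y}}"

definition hoelder_norm :: "nat \<Rightarrow> real \<Rightarrow> (real \<Rightarrow> real) \<Rightarrow> real" where
  "hoelder_norm k \<alpha> f =
     (\<Sum>j\<le>k. SUP x. \<bar>(deriv ^^ j) f x\<bar>) +
     Sup {hoelder_quot \<alpha> ((deriv ^^ k) f) x y | x y. 0 < circle_dist x y}"

definition little_hoelder :: "nat \<Rightarrow> real \<Rightarrow> (real \<Rightarrow> real) set" where
  "little_hoelder k \<alpha> = {f \<in> hoelder_space k \<alpha>.
     ((\<lambda>\<delta>. Sup {hoelder_quot \<alpha> ((deriv ^^ k) f) x y | x y.
                  0 < circle_dist x y \<and> circle_dist x y < \<delta>}) \<longlongrightarrow> 0) (at_right 0)}"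

definition P0 :: "(real \<Rightarrow> real) \<Rightarrow> real \<Rightarrow> real" where
  "P0 \<rho> = (\<lambda>x. \<rho> x - 1 / (2 * pi) * integral {-pi..pi} \<rho>)"

definition little_hoelder0 :: "nat \<Rightarrow> real \<Rightarrow> (real \<Rightarrow> real) set" where
  "little_hoelder0 k \<alpha> = P0 ` little_hoelder k \<alpha>"

definition little_hoelder0_even :: "nat \<Rightarrow> real \<Rightarrow> (real \<Rightarrow> real) set" where
  "little_hoelder0_even k \<alpha> = {f \<in> little_hoelder0 k \<alpha>. \<forall>x. f (- x) = f x}"

definition curvature :: "(real \<Rightarrow> real) \<Rightarrow> real \<Rightarrow> real" where
  "curvature r = (\<lambda>x. 1 / (r x * sqrt (1 + (deriv r x)\<^sup>2))
                     - deriv (deriv r) x / (1 + (deriv r x)\<^sup>2) powr (3 / 2))"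

definition G :: "(real \<Rightarrow> real) \<Rightarrow> real \<Rightarrow> real" where
  "G r = (\<lambda>x. 1 / r x *
     deriv (\<lambda>y. r y / sqrt (1 + (deriv r y)\<^sup>2) * deriv (curvature r) y) x)"

definition F_star :: "real \<Rightarrow> (real \<Rightarrow> real) \<Rightarrow> real" where
  "F_star lam \<rho> = integral {-pi..pi} (\<lambda>x. (\<rho> x + 1 / lam)\<^sup>2)"

text \<open>\<open>\<psi> lam\<close> is a lifting map, defined on the neighbourhood \<open>U lam\<close> of \<open>0\<close> and taking values in the
  neighbourhood \<open>V lam\<close> of \<open>0\<close> in which the solution of the two lifting equations is unique.
  The size of \<open>U lam\<close> is locally uniform in \<open>lam\<close>, so that the bifurcation function is defined on a
  neighbourhood of each \<open>(0, lam)\<close> in the product space. Analyticity of \<open>\<psi> lam\<close>, \<open>\<psi> lam 0 = 0\<close> and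
  preservation of regularity follow from these conditions and are not required.\<close>

definition is_lifting ::
  "real \<Rightarrow> (real \<Rightarrow> (real \<Rightarrow> real) set) \<Rightarrow> (real \<Rightarrow> (real \<Rightarrow> real) set) \<Rightarrow>
   (real \<Rightarrow> (real \<Rightarrow> real) \<Rightarrow> real \<Rightarrow> real) \<Rightarrow> bool" where
  "is_lifting \<alpha> U V \<psi> \<longleftrightarrow>
     (\<forall>lam>0. U lam \<subseteq> little_hoelder0 0 \<alpha> \<and> V lam \<subseteq> little_hoelder 0 \<alpha>) \<and>
     (\<forall>lam>0. \<exists>\<epsilon>>0. \<forall>\<mu>>0. \<bar>\<mu> - lam\<bar> < \<epsilon> \<longrightarrow>
        {\<rho> \<in> little_hoelder0 0 \<alpha>. hoelder_norm 0 \<alpha> \<rho> < \<epsilon>} \<subseteq> U \<mu>) \<and>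
     (\<forall>lam>0. \<exists>\<epsilon>>0. {u \<in> little_hoelder 0 \<alpha>. hoelder_norm 0 \<alpha> u < \<epsilon>} \<subseteq> V lam) \<and>
     (\<forall>lam>0. \<forall>\<rho>\<in>U lam.
        \<psi> lam \<rho> \<in> V lam \<and> P0 (\<psi> lam \<rho>) = \<rho> \<and> F_star lam (\<psi> lam \<rho>) = F_star lam (\<lambda>_. 0) \<and>
        (\<forall>u\<in>V lam. P0 u = \<rho> \<and> F_star lam u = F_star lam (\<lambda>_. 0) \<longrightarrow> u = \<psi> lam \<rho>) \<and>
        (\<forall>x. \<psi> lam \<rho> x > - (1 / lam)))"

definition G_bar ::
  "(real \<Rightarrow> (real \<Rightarrow> real) \<Rightarrow> real \<Rightarrow> real) \<Rightarrow> (real \<Rightarrow> real) \<Rightarrow> real \<Rightarrow> real \<Rightarrow> real" where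
  "G_bar \<psi> \<rho> lam = P0 (G (\<lambda>x. \<psi> lam \<rho> x + 1 / lam))"

definition solutions ::
  "real \<Rightarrow> (real \<Rightarrow> (real \<Rightarrow> real) set) \<Rightarrow> (real \<Rightarrow> (real \<Rightarrow> real) \<Rightarrow> real \<Rightarrow> real) \<Rightarrow>
   ((real \<Rightarrow> real) \<times> real) set" where
  "solutions \<alpha> U \<psi> = {(\<rho>, lam). lam > 0 \<and> \<rho> \<in> little_hoelder0_even 4 \<alpha> \<and> \<rho> \<in> U lam \<and>
     G_bar \<psi> \<rho> lam = (\<lambda>_. 0)}"

definition bifurcation_point ::
  "real \<Rightarrow> (real \<Rightarrow> (real \<Rightarrow> real) set) \<Rightarrow> (real \<Rightarrow> (real \<Rightarrow> real) \<Rightarrow> real \<Rightarrow> real) \<Rightarrow>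
   real \<Rightarrow> bool" where
  "bifurcation_point \<alpha> U \<psi> lam\<^sub>0 \<longleftrightarrow>
     (\<forall>\<epsilon>>0. \<exists>(\<rho>, lam)\<in>solutions \<alpha> U \<psi>.
        hoelder_norm 4 \<alpha> \<rho> < \<epsilon> \<and> \<bar>lam - lam\<^sub>0\<bar> < \<epsilon> \<and> \<rho> \<noteq> (\<lambda>_. 0))"

text \<open>Analyticity of a curve in \<open>X \<times> \<real>\<close>, where \<open>X\<close> is a space of functions normed by \<open>N\<close>: near every
  parameter value the curve is the sum of a power series with coefficients in \<open>X \<times> \<real>\<close>,
  convergent in norm.\<close>

definition analytic_curve_on ::
  "(real \<Rightarrow> real) set \<Rightarrow> ((real \<Rightarrow> real) \<Rightarrow> real) \<Rightarrow> real set \<Rightarrow>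
   (real \<Rightarrow> (real \<Rightarrow> real) \<times> real) \<Rightarrow> bool" where
  "analytic_curve_on X N S \<gamma> \<longleftrightarrow>
     (\<forall>t\<in>S. fst (\<gamma> t) \<in> X) \<and>
     (\<forall>t\<in>S. \<exists>\<epsilon>>0. \<exists>a b. (\<forall>n. a n \<in> X) \<and>
        (\<forall>s\<in>S. \<bar>s - t\<bar> < \<epsilon> \<longrightarrow>
           (\<lambda>n. N (\<lambda>x. fst (\<gamma> s) x - (\<Sum>k<n. (s - t) ^ k * a k x))) \<longlonglongrightarrow> 0 \<and>
           (\<lambda>k. (s - t) ^ k * b k) sums snd (\<gamma> s)))"

subsection \<open>Liftings exist\<close>

lemma hoelder_space_0_continuous:
  "f \<in> hoelder_space 0 \<alpha> \<Longrightarrow> continuous_on S f"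
  by (auto simp: hoelder_space_def intro: continuous_on_subset)

lemma little_hoelder_continuous:
  "f \<in> little_hoelder 0 \<alpha> \<Longrightarrow> continuous_on S f"
  unfolding little_hoelder_def using hoelder_space_0_continuous by blast

lemma circle_fun_int:
  assumes "circle_fun f"
  shows "f (x + 2 * pi * of_int k) = f x"
proof -
  have nat: "f (y + 2 * pi * real n) = f y" for y n
  proof (induction n)
    case (Suc n)
    have "f (y + 2 * pi * real (Suc n)) = f ((y + 2 * pi * real n) + 2 * pi)"
      by (simp add: algebra_simps)
    then show ?case
      using assms Suc unfolding circle_fun_def by simp
  qed simp
  show ?thesis
  proof (cases "k \<ge> 0")
    case True
    then show ?thesis using nat[of x "nat k"] by simp
  next
    case False
    then show ?thesis using nat[of "x + 2 * pi * of_int k" "nat (-k)"] by simp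
  qed
qed

lemma abs_le_hoelder_norm:
  assumes "f \<in> hoelder_space 0 \<alpha>"
  shows "\<bar>f x\<bar> \<le> hoelder_norm 0 \<alpha> f"
proof -
  have "circle_fun f" using assms by (simp add: hoelder_space_def)
  have "compact (f ` {0..2 * pi})"
    using hoelder_space_0_continuous[OF assms] by (intro compact_continuous_image) auto
  then have "bounded (f ` {0..2 * pi})" by (rule compact_imp_bounded)
  then obtain B where B: "\<And>y. y \<in> {0..2 * pi} \<Longrightarrow> \<bar>f y\<bar> \<le> B"
    unfolding bounded_iff by (metis imageI real_norm_def)
  have B': "\<bar>f y\<bar> \<le> B" for y
  proof -
    define k where "k = \<lfloor>y / (2 * pi)\<rfloor>"
    have "of_int k \<le> y / (2 * pi)" "y / (2 * pi) < of_int k + 1"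
      unfolding k_def by linarith+
    then have "of_int k * (2 * pi) \<le> y" "y < (of_int k + 1) * (2 * pi)"
      by (simp_all add: pos_le_divide_eq pos_divide_less_eq)
    then have "y + 2 * pi * of_int (-k) \<in> {0..2 * pi}"
      by (simp add: algebra_simps)
    then show ?thesis
      using B circle_fun_int[OF \<open>circle_fun f\<close>, of y "-k"] by metis
  qed
  have 1: "\<bar>f x\<bar> \<le> (SUP x. \<bar>f x\<bar>)"
    using B' by (intro cSUP_upper) (auto simp: bdd_above_def)
  let ?Q = "{hoelder_quot \<alpha> f x y | x y. 0 < circle_dist x y}"
  have bdd: "bdd_above ?Q" using assms by (simp add: hoelder_space_def)
  have nonneg: "0 \<le> q" if "q \<in> ?Q" for q
    using that by (auto simp: hoelder_quot_def)
  have "circle_dist pi 0 > 0"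
  proof -
    have "pi \<le> \<bar>pi - 0 + 2 * pi * of_int k\<bar>" for k :: int
    proof (cases "k \<ge> 0")
      case False
      then have "real_of_int k \<le> -1" by linarith
      then have "2 * pi * of_int k \<le> 2 * pi * (-1)" by (intro mult_left_mono) auto
      then show ?thesis by linarith
    qed simp
    then have "pi \<le> circle_dist pi 0"
      unfolding circle_dist_def by (intro cINF_greatest) auto
    then show ?thesis using pi_gt_zero by linarith
  qed
  then have "hoelder_quot \<alpha> f pi 0 \<in> ?Q" by blast
  then have "0 \<le> Sup ?Q" using nonneg bdd by (meson cSup_upper order_trans)
  then show ?thesis using 1 by (simp add: hoelder_norm_def)
qed

lemma little_hoelder_add_const:
  assumes "f \<in> little_hoelder 0 \<alpha>"
  shows "(\<lambda>x. f x + c) \<in> little_hoelder 0 \<alpha>"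
proof -
  have "hoelder_quot \<alpha> (\<lambda>x. f x + c) = hoelder_quot \<alpha> f"
    by (simp add: hoelder_quot_def fun_eq_iff)
  then show ?thesis
    using assms by (auto simp: little_hoelder_def hoelder_space_def circle_fun_def
        intro: continuous_intros)
qed

lemma integral_add_circle_const:
  fixes f :: "real \<Rightarrow> real"
  assumes "f integrable_on {-pi..pi}"
  shows "integral {-pi..pi} (\<lambda>x. f x + c) = integral {-pi..pi} f + 2 * pi * c"
  using integral_add[OF assms integrable_const_ivl[of c "-pi" pi]] by simp

lemma P0_add_const:
  assumes "f \<in> little_hoelder 0 \<alpha>"
  shows "P0 (\<lambda>x. f x + c) = P0 f"
proof -
  have "f integrable_on {-pi..pi}"
    by (intro integrable_continuous_real little_hoelder_continuous[OF assms])
  then have "integral {-pi..pi} (\<lambda>x. f x + c) = integral {-pi..pi} f + 2 * pi * c"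
    by (rule integral_add_circle_const)
  then show ?thesis by (simp add: P0_def fun_eq_iff field_simps)
qed

lemma little_hoelder0D:
  assumes "\<rho> \<in> little_hoelder0 0 \<alpha>"
  shows "\<rho> \<in> little_hoelder 0 \<alpha>" "integral {-pi..pi} \<rho> = 0"
proof -
  obtain f where f: "f \<in> little_hoelder 0 \<alpha>" "\<rho> = P0 f"
    using assms by (auto simp: little_hoelder0_def)
  show "\<rho> \<in> little_hoelder 0 \<alpha>"
    using little_hoelder_add_const[OF f(1), of "- (1 / (2 * pi) * integral {-pi..pi} f)"]
    by (simp add: f(2) P0_def)
  have "f integrable_on {-pi..pi}"
    by (intro integrable_continuous_real little_hoelder_continuous[OF f(1)])
  then show "integral {-pi..pi} \<rho> = 0"
    using integral_add_circle_const[of f "- (1 / (2 * pi) * integral {-pi..pi} f)"]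
    by (simp add: f(2) P0_def)
qed

lemma F_star_add_const:
  assumes "f \<in> little_hoelder 0 \<alpha>"
  shows "F_star lam (\<lambda>x. f x + c) =
    integral {-pi..pi} (\<lambda>x. (f x)\<^sup>2) + 2 * (c + 1 / lam) * integral {-pi..pi} f
      + 2 * pi * (c + 1 / lam)\<^sup>2"
proof -
  have cont: "continuous_on {-pi..pi} f"
    by (rule little_hoelder_continuous[OF assms])
  have "F_star lam (\<lambda>x. f x + c) = integral {-pi..pi}
     (\<lambda>x. ((f x)\<^sup>2 + 2 * (c + 1 / lam) * f x) + (c + 1 / lam)\<^sup>2)"
    unfolding F_star_def by (simp add: power2_eq_square algebra_simps)
  also have "\<dots> = integral {-pi..pi} (\<lambda>x. (f x)\<^sup>2 + 2 * (c + 1 / lam) * f x)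
      + integral {-pi..pi} (\<lambda>x. (c + 1 / lam)\<^sup>2)"
    by (intro integral_add integrable_continuous_real continuous_intros cont)
  also have "integral {-pi..pi} (\<lambda>x. (f x)\<^sup>2 + 2 * (c + 1 / lam) * f x) =
     integral {-pi..pi} (\<lambda>x. (f x)\<^sup>2) + integral {-pi..pi} (\<lambda>x. 2 * (c + 1 / lam) * f x)"
    by (intro integral_add integrable_continuous_real continuous_intros cont)
  finally show ?thesis by simp
qed

lemma F_star_0: "F_star lam (\<lambda>_. 0) = 2 * pi * (1 / lam)\<^sup>2"
  by (simp add: F_star_def)

lemma lifting_unique:
  assumes u: "u \<in> little_hoelder 0 \<alpha>" and v: "v \<in> little_hoelder 0 \<alpha>"
    and P: "P0 u = P0 v" and F: "F_star lam u = F_star lam v"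
    and pos: "\<And>x. u x > - (1 / lam)" "\<And>x. v x > - (1 / lam)"
  shows "u = v"
proof -
  define c where "c = 1 / (2 * pi) * integral {-pi..pi} u - 1 / (2 * pi) * integral {-pi..pi} v"
  have uv: "u = (\<lambda>x. v x + c)"
  proof
    fix x show "u x = v x + c" using fun_cong[OF P, of x] by (simp add: P0_def c_def)
  qed
  have mean: "integral {-pi..pi} w \<ge> - (2 * pi / lam)"
    if "w \<in> little_hoelder 0 \<alpha>" "\<And>x. w x > - (1 / lam)" for w
  proof -
    have "integral {-pi..pi} (\<lambda>x. - (1 / lam)) \<le> integral {-pi..pi} w"
      using that(2) by (intro integral_le integrable_continuous_real continuous_on_const
          little_hoelder_continuous[OF that(1)]) (auto simp: less_imp_le)
    then show ?thesis by simp
  qed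
  have int_u: "integral {-pi..pi} u = integral {-pi..pi} v + 2 * pi * c"
    by (simp add: c_def field_simps)
  have eq: "c * ((integral {-pi..pi} u + 2 * pi / lam) + (integral {-pi..pi} v + 2 * pi / lam)) = 0"
  proof -
    have "F_star lam v + 2 * c * integral {-pi..pi} v + 2 * pi * c\<^sup>2 + 4 * pi * c / lam
        = F_star lam u"
      using F_star_add_const[OF v, of lam c] F_star_add_const[OF v, of lam 0]
      unfolding uv by (simp add: power2_eq_square algebra_simps)
    then show ?thesis
      using F unfolding int_u by (simp add: power2_eq_square algebra_simps)
  qed
  have "c = 0"
  proof (rule ccontr)
    assume "c \<noteq> 0"
    with eq have "(integral {-pi..pi} u + 2 * pi / lam) + (integral {-pi..pi} v + 2 * pi / lam) = 0"
      by simp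
    with mean[OF u pos(1)] mean[OF v pos(2)]
    have "integral {-pi..pi} u = integral {-pi..pi} v" by linarith
    with int_u \<open>c \<noteq> 0\<close> show False by simp
  qed
  then show ?thesis using uv by simp
qed

lemma lifting_point_exists:
  assumes \<rho>: "\<rho> \<in> little_hoelder0 0 \<alpha>" and small: "hoelder_norm 0 \<alpha> \<rho> < \<epsilon>"
    and \<epsilon>: "2 * \<epsilon>\<^sup>2 \<le> (1 / lam)\<^sup>2" "\<epsilon> > 0" and "lam > 0"
  shows "\<exists>u\<in>little_hoelder 0 \<alpha>. (\<forall>x. u x > - (1 / lam)) \<and> P0 u = \<rho> \<and>
           F_star lam u = F_star lam (\<lambda>_. 0)"
proof -
  note \<rho>D = little_hoelder0D[OF \<rho>]
  have \<rho>': "\<rho> \<in> hoelder_space 0 \<alpha>" using \<rho>D by (simp add: little_hoelder_def)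
  have cont: "continuous_on {-pi..pi} \<rho>" by (rule hoelder_space_0_continuous[OF \<rho>'])
  have bound: "\<bar>\<rho> x\<bar> < \<epsilon>" for x using abs_le_hoelder_norm[OF \<rho>', of x] small by linarith
  define m where "m = integral {-pi..pi} (\<lambda>x. (\<rho> x)\<^sup>2) / (2 * pi)"
  have "integral {-pi..pi} (\<lambda>x. (\<rho> x)\<^sup>2) \<le> integral {-pi..pi} (\<lambda>x. \<epsilon>\<^sup>2)"
    using bound \<epsilon>(2) by (intro integral_le integrable_continuous_real continuous_intros cont)
      (auto simp: abs_le_square_iff[symmetric] less_imp_le)
  then have m: "m \<le> \<epsilon>\<^sup>2" by (simp add: m_def field_simps)
  define q where "q = sqrt ((1 / lam)\<^sup>2 - m)"
  have ge: "\<epsilon>\<^sup>2 \<le> (1 / lam)\<^sup>2 - m" using m \<epsilon> by linarith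
  then have "\<epsilon> \<le> q" using \<epsilon>(2) real_le_rsqrt unfolding q_def by blast
  have "0 \<le> (1 / lam)\<^sup>2 - m" using ge zero_le_power2[of \<epsilon>] by linarith
  then have q2: "q\<^sup>2 = (1 / lam)\<^sup>2 - m" unfolding q_def by simp
  define u where "u = (\<lambda>x. \<rho> x + (q - 1 / lam))"
  have "u \<in> little_hoelder 0 \<alpha>" unfolding u_def by (rule little_hoelder_add_const[OF \<rho>D(1)])
  moreover have "u x > - (1 / lam)" for x
    using bound[of x] \<open>\<epsilon> \<le> q\<close> by (simp add: u_def)
  moreover have "P0 u = \<rho>"
    unfolding u_def P0_add_const[OF \<rho>D(1)] by (simp add: P0_def \<rho>D(2))
  moreover have "F_star lam u = F_star lam (\<lambda>_. 0)"
  proof -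
    have "integral {-pi..pi} (\<lambda>x. (\<rho> x)\<^sup>2) = 2 * pi * m" by (simp add: m_def)
    then show ?thesis
      unfolding u_def F_star_add_const[OF \<rho>D(1)] F_star_0 by (simp add: \<rho>D(2) q2 algebra_simps)
  qed
  ultimately show ?thesis by blast
qed

lemma is_lifting_exists:
  "\<exists>U V \<psi>. is_lifting \<alpha> U V \<psi>"
proof -
  define V where "V = (\<lambda>lam. {u \<in> little_hoelder 0 \<alpha>. \<forall>x. u x > - (1 / lam)})"
  define L where "L = (\<lambda>lam \<rho> u. u \<in> V lam \<and> P0 u = \<rho> \<and> F_star lam u = F_star lam (\<lambda>_. 0))"
  define U where "U = (\<lambda>lam. {\<rho> \<in> little_hoelder0 0 \<alpha>. \<exists>u. L lam \<rho> u})"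
  define \<psi> where "\<psi> = (\<lambda>lam \<rho>. SOME u. L lam \<rho> u)"
  have \<psi>: "L lam \<rho> (\<psi> lam \<rho>)" if "\<rho> \<in> U lam" for lam \<rho>
    using that someI_ex[of "L lam \<rho>"] unfolding U_def \<psi>_def by blast
  have uniq: "u = v" if "L lam \<rho> u" "L lam \<rho> v" for lam \<rho> u v
    using that lifting_unique[of u \<alpha> v lam] unfolding L_def V_def by auto
  have nbhd_U: "\<exists>\<epsilon>>0. \<forall>\<mu>>0. \<bar>\<mu> - lam\<bar> < \<epsilon> \<longrightarrow>
        {\<rho> \<in> little_hoelder0 0 \<alpha>. hoelder_norm 0 \<alpha> \<rho> < \<epsilon>} \<subseteq> U \<mu>" if "lam > 0" for lam
  proof (intro exI[of _ "min lam (1 / (4 * lam))"] conjI allI impI subsetI)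
    have four: "(2 * e)\<^sup>2 = 4 * e\<^sup>2" for e :: real by (simp add: power2_eq_square)
    let ?e = "min lam (1 / (4 * lam))"
    show e: "?e > 0" using that by simp
    fix \<mu> \<rho> assume \<mu>: "\<mu> > 0" "\<bar>\<mu> - lam\<bar> < ?e"
      and \<rho>: "\<rho> \<in> {\<rho> \<in> little_hoelder0 0 \<alpha>. hoelder_norm 0 \<alpha> \<rho> < ?e}"
    have "\<mu> < 2 * lam" using \<mu> by linarith
    then have "1 / (2 * lam) \<le> 1 / \<mu>" using \<mu> that by (intro divide_left_mono) auto
    then have "2 * ?e \<le> 1 / \<mu>" by (simp add: min_def)
    then have "(2 * ?e)\<^sup>2 \<le> (1 / \<mu>)\<^sup>2" using e by (intro power_mono) linarith+
    then have "2 * ?e\<^sup>2 \<le> (1 / \<mu>)\<^sup>2"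
      using zero_le_power2[of ?e] four[of ?e] by linarith
    then show "\<rho> \<in> U \<mu>"
      using \<rho> lifting_point_exists[of \<rho> \<alpha> ?e \<mu>] e \<mu>(1)
      unfolding U_def L_def V_def by blast
  qed
  have nbhd_V: "\<exists>\<epsilon>>0. {u \<in> little_hoelder 0 \<alpha>. hoelder_norm 0 \<alpha> u < \<epsilon>} \<subseteq> V lam"
    if "lam > 0" for lam
  proof (intro exI[of _ "1 / lam"] conjI subsetI)
    fix u assume u: "u \<in> {u \<in> little_hoelder 0 \<alpha>. hoelder_norm 0 \<alpha> u < 1 / lam}"
    have "- (1 / lam) < u x" for x
      using u abs_le_hoelder_norm[of u \<alpha> x] by (auto simp: little_hoelder_def)
    then show "u \<in> V lam" using u by (simp add: V_def)
  qed (use that in simp)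
  have "is_lifting \<alpha> U V \<psi>"
    unfolding is_lifting_def
  proof (intro conjI allI impI ballI)
    fix lam :: real and \<rho> u
    assume "lam > 0" "\<rho> \<in> U lam"
    note * = \<psi>[OF this(2)]
    show "\<psi> lam \<rho> \<in> V lam" "P0 (\<psi> lam \<rho>) = \<rho>" "F_star lam (\<psi> lam \<rho>) = F_star lam (\<lambda>_. 0)"
      using * by (auto simp: L_def)
    show "- (1 / lam) < \<psi> lam \<rho> x" for x using * by (auto simp: L_def V_def)
    show "u = \<psi> lam \<rho>" if "u \<in> V lam" "P0 u = \<rho> \<and> F_star lam u = F_star lam (\<lambda>_. 0)"
      using that uniq[OF _ *] by (simp add: L_def)
  qed (use nbhd_U nbhd_V in \<open>auto simp: U_def V_def\<close>)
  then show ?thesis by blast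
qed

end

theory Submission
  imports Defs "HOL-Complex_Analysis.Complex_Analysis"
begin

text \<open>If \<open>P\<^sub>0 G(r) = 0\<close> with \<open>r > 0\<close> periodic, then integrating twice shows that the mean curvature
  of the surface of revolution with profile \<open>r\<close> is a constant \<open>h\<close>. For even \<open>r\<close>, the equation of
  constant mean curvature becomes linear in the arc length, so \<open>r\<close> is explicitly a Delaunay unduloid with
  parameter \<open>s = h r(0) - 1\<close>; for \<open>s \<noteq> 0\<close>, periodicity forces \<open>h = l A(s)\<close> with a positive integer \<open>l\<close>
  and \<open>A(s) \<rightarrow> 1\<close> as \<open>s \<rightarrow> 0\<close>, and the volume constraint determines \<open>\<lambda>\<close>. Hence nontrivial
  solutions only accumulate at \<open>\<lambda> = l\<close>, where they form a curve parametrized by \<open>s\<close>. The radius of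
  the unduloid extends to a bounded function of complex \<open>(s, x)\<close>, \<open>s\<close> in a disc and \<open>x\<close> in a strip,
  holomorphic in each variable; Cauchy estimates turn this into analyticity of the curve in every
  little Hoelder space.\<close>

subsection \<open>Functions on the circle with bounded derivatives\<close>

text \<open>The usual route, bifurcation from a simple eigenvalue, needs analyticity of
  \<open>G\<close> between little Hoelder spaces and a study of its linearization. An exact
  classification replaces both: the number \<open>h * r 0 - 1\<close> is read off from a given
  solution and is also the parameter of the explicit family, so it decides which unduloid the
  solution is, and no implicit function theorem is needed to exhaust the solutions near (0, l).
  Evenness enters through r'(0) = 0, which fixes the phase; without it all translates would be
  solutions too. The price is that unduloids are given by their phase, while the circle carries the
  axial position, so the latter has to be inverted. A contraction on a complex strip does this, so
  that holomorphy passes to the uniform limit of the iterates. The constants 1/1000, 1/60 and 1/20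
  come from crude estimates that make the contraction and the invariance of the strip evident; none
  is sharp. The function A of the overview is \<open>mean_slope\<close>. Separate holomorphy
  together with one common bound is all that is used of the two complex variables.\<close>

lemma circle_dist_le: "circle_dist x y \<le> \<bar>x - y + 2 * pi * of_int k\<bar>"
  unfolding circle_dist_def by (rule cINF_lower) (auto intro!: bdd_belowI[of _ 0])

lemma circle_dist_le_2pi: "circle_dist x y \<le> 2 * pi"
proof -
  define k where "k = \<lfloor>(x - y) / (2 * pi)\<rfloor>"
  have "of_int k \<le> (x - y) / (2 * pi)" "(x - y) / (2 * pi) < of_int k + 1"
    unfolding k_def by linarith+
  then have "of_int k * (2 * pi) \<le> x - y" "x - y < (of_int k + 1) * (2 * pi)"
    by (simp_all add: pos_le_divide_eq pos_divide_less_eq)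
  then show ?thesis
    using circle_dist_le[of x y "-k"] by (simp add: algebra_simps)
qed

lemma circle_dist_0_right:
  assumes "0 \<le> d" "d \<le> pi"
  shows "circle_dist d 0 = d"
proof (rule antisym)
  show "circle_dist d 0 \<le> d" using circle_dist_le[of d 0 0] assms by simp
  have "d \<le> \<bar>d - 0 + 2 * pi * of_int k\<bar>" for k :: int
  proof (cases "k \<ge> 0")
    case False
    then have "real_of_int k \<le> -1" by linarith
    then have "2 * pi * of_int k \<le> 2 * pi * (-1)" by (intro mult_left_mono) auto
    then show ?thesis using assms by linarith
  qed (use assms in simp)
  then show "d \<le> circle_dist d 0" unfolding circle_dist_def by (intro cINF_greatest) auto
qed

text \<open>Periodicity allows x to be replaced by every translate x + 2 pi k, so the Lipschitz
  bound on the line holds against each term of the infimum that defines the circle distance.\<close>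

lemma lipschitz_circle_dist:
  assumes "circle_fun g" and "\<And>x y. \<bar>g x - g y\<bar> \<le> C * \<bar>x - y\<bar>" and "0 \<le> C"
  shows "\<bar>g x - g y\<bar> \<le> C * circle_dist x y"
proof (cases "C = 0")
  case True
  then show ?thesis using assms(2)[of x y] by simp
next
  case False
  have "\<bar>g x - g y\<bar> / C \<le> \<bar>x - y + 2 * pi * of_int k\<bar>" for k :: int
    using assms(2)[of "x + 2 * pi * of_int k" y] circle_fun_int[OF assms(1), of x k] False assms(3)
    by (simp add: field_simps algebra_simps)
  then have "\<bar>g x - g y\<bar> / C \<le> circle_dist x y"
    unfolding circle_dist_def by (intro cINF_greatest) auto
  then show ?thesis using False assms(3) by (simp add: field_simps)
qed

lemma circle_fun_deriv:
  assumes "circle_fun f"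
  shows "circle_fun (deriv f)"
  unfolding circle_fun_def
proof
  fix x
  have "(\<lambda>y. f (y + 2 * pi)) = f" using assms by (auto simp: circle_fun_def)
  then show "deriv f (x + 2 * pi) = deriv f x"
    by (simp add: deriv_def DERIV_shift)
qed

lemma circle_fun_higher_deriv:
  "circle_fun f \<Longrightarrow> circle_fun ((deriv ^^ j) f)"
  by (induction j) (auto intro: circle_fun_deriv)

lemma even_deriv_0:
  fixes f :: "real \<Rightarrow> real"
  assumes "\<And>x. f (- x) = f x" and "f differentiable (at 0)"
  shows "deriv f 0 = 0"
proof -
  have 1: "(f has_real_derivative deriv f 0) (at 0)"
    using assms(2) by (simp add: DERIV_deriv_iff_real_differentiable)
  have "((\<lambda>x. f (- x)) has_real_derivative deriv f 0 * (-1)) (at 0)"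
    using 1 by (intro DERIV_chain2[where f = f]) (auto intro!: derivative_eq_intros)
  then have "(f has_real_derivative - deriv f 0) (at 0)" using assms(1) by simp
  with 1 have "deriv f 0 = - deriv f 0" by (rule DERIV_unique)
  then show ?thesis by simp
qed

lemma continuous_circle_fun_bounded:
  assumes "circle_fun f" "continuous_on UNIV f"
  shows "\<exists>C. \<forall>x. \<bar>f x\<bar> \<le> C"
proof -
  have "compact (f ` {0..2 * pi})"
    using assms(2) by (intro compact_continuous_image) (auto intro: continuous_on_subset)
  then have "bounded (f ` {0..2 * pi})" by (rule compact_imp_bounded)
  then obtain C where C: "\<And>y. y \<in> {0..2 * pi} \<Longrightarrow> \<bar>f y\<bar> \<le> C"
    unfolding bounded_iff by (metis imageI real_norm_def)
  have "\<bar>f y\<bar> \<le> C" for y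
  proof -
    define k where "k = \<lfloor>y / (2 * pi)\<rfloor>"
    have "of_int k \<le> y / (2 * pi)" "y / (2 * pi) < of_int k + 1"
      unfolding k_def by linarith+
    then have "of_int k * (2 * pi) \<le> y" "y < (of_int k + 1) * (2 * pi)"
      by (simp_all add: pos_le_divide_eq pos_divide_less_eq)
    then have "y + 2 * pi * of_int (-k) \<in> {0..2 * pi}" by (simp add: algebra_simps)
    then show ?thesis using C circle_fun_int[OF assms(1), of y "-k"] by metis
  qed
  then show ?thesis by blast
qed

lemma hoelder_quot_nonneg: "0 \<le> hoelder_quot \<alpha> f x y"
  by (simp add: hoelder_quot_def)

lemma higher_deriv_le_hoelder_norm:
  assumes f: "f \<in> hoelder_space k \<alpha>" and "j \<le> k"
  shows "\<bar>(deriv ^^ j) f x\<bar> \<le> hoelder_norm k \<alpha> f"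
proof -
  have circ: "circle_fun ((deriv ^^ i) f)" for i
    using f by (intro circle_fun_higher_deriv) (simp add: hoelder_space_def)
  have cont: "continuous_on UNIV ((deriv ^^ i) f)" if "i \<le> k" for i
  proof (cases "i = k")
    case False
    then have "\<forall>x. (deriv ^^ i) f differentiable (at x)"
      using f that by (auto simp: hoelder_space_def)
    then show ?thesis
      by (simp add: continuous_at_imp_continuous_on differentiable_imp_continuous_within)
  qed (use f in \<open>simp add: hoelder_space_def\<close>)
  have upper: "\<bar>(deriv ^^ i) f x\<bar> \<le> (SUP x. \<bar>(deriv ^^ i) f x\<bar>)" if i: "i \<le> k" for i x
  proof -
    obtain C where "\<And>x. \<bar>(deriv ^^ i) f x\<bar> \<le> C"
      using continuous_circle_fun_bounded[OF circ cont[OF i]] by metis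
    then show ?thesis by (intro cSUP_upper) (auto simp: bdd_above_def)
  qed
  have "\<bar>(deriv ^^ j) f x\<bar> \<le> (\<Sum>j\<le>k. SUP x. \<bar>(deriv ^^ j) f x\<bar>)"
  proof (rule order_trans[OF upper[OF \<open>j \<le> k\<close>]])
    show "(SUP x. \<bar>(deriv ^^ j) f x\<bar>) \<le> (\<Sum>j\<le>k. SUP x. \<bar>(deriv ^^ j) f x\<bar>)"
    proof (rule member_le_sum)
      show "0 \<le> (SUP x. \<bar>(deriv ^^ i) f x\<bar>)" if "i \<in> {..k} - {j}" for i
        by (rule order_trans[OF abs_ge_zero upper]) (use that in simp)
    qed (use \<open>j \<le> k\<close> in auto)
  qed
  moreover have "0 \<le> Sup {hoelder_quot \<alpha> ((deriv ^^ k) f) x y | x y. 0 < circle_dist x y}"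
  proof -
    \<comment> \<open>The pair (pi, 0) makes the set of quotients nonempty; the supremum of an empty
      set of reals could not be bounded below.\<close>
    have "0 < circle_dist pi 0" by (simp add: circle_dist_0_right)
    then show ?thesis using f
      by (intro cSup_upper2[of "hoelder_quot \<alpha> ((deriv ^^ k) f) pi 0"])
        (auto simp: hoelder_space_def hoelder_quot_nonneg)
  qed
  ultimately show ?thesis by (simp add: hoelder_norm_def)
qed

lemma hoelder_quot_lipschitz_le:
  assumes "circle_fun g" "\<And>x y. \<bar>g x - g y\<bar> \<le> C * \<bar>x - y\<bar>" "0 \<le> C"
    and "0 < circle_dist x y"
  shows "hoelder_quot \<alpha> g x y \<le> C * circle_dist x y powr (1 - \<alpha>)"
proof -
  have "\<bar>g x - g y\<bar> \<le> C * (circle_dist x y powr (1 - \<alpha>) * circle_dist x y powr \<alpha>)"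
    using lipschitz_circle_dist[OF assms(1-3), of x y] assms(4)
    by (simp flip: powr_add)
  then show ?thesis
    using assms(4) by (simp add: hoelder_quot_def field_simps)
qed

text \<open>A bound on the derivative of order k + 1 makes the derivative of order k Lipschitz, so
  its Hoelder quotient at distance d is at most C d^(1 - \<alpha>), which vanishes with d. The
  factor k + 8 counts the k + 1 suprema in the norm and the bound 7 > 2 pi for the power of the
  distance.\<close>

lemma smooth_little_hoelder:
  assumes "circle_fun f" and \<alpha>: "0 < \<alpha>" "\<alpha> < 1" and "0 \<le> C"
    and der: "\<And>j x. j \<le> k \<Longrightarrow> ((deriv ^^ j) f has_real_derivative (deriv ^^ Suc j) f x) (at x)"
    and bound: "\<And>j x. j \<le> Suc k \<Longrightarrow> \<bar>(deriv ^^ j) f x\<bar> \<le> C"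
  shows "f \<in> little_hoelder k \<alpha>" "hoelder_norm k \<alpha> f \<le> (real k + 8) * C"
proof -
  let ?g = "(deriv ^^ k) f"
  have circ: "circle_fun ?g" using assms(1) by (rule circle_fun_higher_deriv)
  have lip: "\<bar>?g x - ?g y\<bar> \<le> C * \<bar>x - y\<bar>" for x y
    using field_differentiable_bound[of UNIV ?g "(deriv ^^ Suc k) f" C x y]
      der[of k] bound[of "Suc k"] by auto
  note quot = hoelder_quot_lipschitz_le[OF circ lip \<open>0 \<le> C\<close>]
  have quot_C: "hoelder_quot \<alpha> ?g x y \<le> C * 7" if "0 < circle_dist x y" for x y
  proof -
    have "circle_dist x y \<le> 7" using circle_dist_le_2pi[of x y] pi_less_4 pi_approx by simp
    then have "circle_dist x y powr (1 - \<alpha>) \<le> 7 powr (1 - \<alpha>)"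
      using that \<alpha> by (intro powr_mono2) auto
    also have "\<dots> \<le> 7 powr 1" using \<alpha> by (intro powr_mono) auto
    finally show ?thesis
      using quot[OF that, of \<alpha>] mult_left_mono[of _ 7 C] \<open>0 \<le> C\<close> by fastforce
  qed
  have dpi: "0 < circle_dist pi 0" by (simp add: circle_dist_0_right)
  have space: "f \<in> hoelder_space k \<alpha>"
    unfolding hoelder_space_def
  proof (intro CollectI conjI allI impI)
    show "(deriv ^^ j) f differentiable (at x)" if "j < k" for j x
      using der[of j x] that by (auto simp: real_differentiable_def)
    show "continuous_on UNIV ?g"
      using der[of k] by (auto intro: DERIV_continuous_on[of UNIV])
    show "bdd_above {hoelder_quot \<alpha> ?g x y | x y. 0 < circle_dist x y}"
      using quot_C by (auto simp: bdd_above_def)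
  qed (rule assms(1))
  have "((\<lambda>\<delta>. Sup {hoelder_quot \<alpha> ?g x y | x y. 0 < circle_dist x y \<and> circle_dist x y < \<delta>})
     \<longlongrightarrow> 0) (at_right 0)"
  proof (rule tendsto_sandwich)
    have ev: "eventually (\<lambda>\<delta>::real. 0 < \<delta> \<and> \<delta> < pi) (at_right 0)"
      by (intro eventually_at_rightI[of 0 pi]) auto
    \<comment> \<open>For \<delta> < pi the points \<delta>/2 and 0 are at distance exactly
      \<delta>/2, so the set under the supremum is nonempty, as both sides of the squeeze
      require.\<close>
    have ne: "hoelder_quot \<alpha> ?g (\<delta> / 2) 0 \<in>
        {hoelder_quot \<alpha> ?g x y | x y. 0 < circle_dist x y \<and> circle_dist x y < \<delta>}"
      if "0 < \<delta>" "\<delta> < pi" for \<delta>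
      using that circle_dist_0_right[of "\<delta> / 2"] by (intro CollectI exI conjI) auto
    show "\<forall>\<^sub>F \<delta> in at_right 0.
        0 \<le> Sup {hoelder_quot \<alpha> ?g x y | x y. 0 < circle_dist x y \<and> circle_dist x y < \<delta>}"
      using ev
    proof eventually_elim
      case (elim \<delta>)
      have "bdd_above {hoelder_quot \<alpha> ?g x y | x y. 0 < circle_dist x y \<and> circle_dist x y < \<delta>}"
        using quot_C by (intro bdd_aboveI[of _ "C * 7"]) blast
      then show ?case
        using cSup_upper2[OF ne[of \<delta>] hoelder_quot_nonneg] elim by blast
    qed
    show "\<forall>\<^sub>F \<delta> in at_right 0.
        Sup {hoelder_quot \<alpha> ?g x y | x y. 0 < circle_dist x y \<and> circle_dist x y < \<delta>}
          \<le> C * \<delta> powr (1 - \<alpha>)"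
      using ev
    proof eventually_elim
      case (elim \<delta>)
      show ?case
      proof (rule cSup_least)
        fix q assume "q \<in> {hoelder_quot \<alpha> ?g x y | x y. 0 < circle_dist x y \<and> circle_dist x y < \<delta>}"
        then obtain x y where q: "q = hoelder_quot \<alpha> ?g x y"
          and d: "0 < circle_dist x y" "circle_dist x y < \<delta>" by blast
        have "circle_dist x y powr (1 - \<alpha>) \<le> \<delta> powr (1 - \<alpha>)"
          using d \<alpha> by (intro powr_mono2) auto
        then show "q \<le> C * \<delta> powr (1 - \<alpha>)"
          unfolding q using quot[OF d(1), of \<alpha>] mult_left_mono[OF _ \<open>0 \<le> C\<close>] by fastforce
      qed (use ne[of \<delta>] elim in blast)
    qed
    have "((\<lambda>\<delta>::real. \<delta> powr (1 - \<alpha>)) \<longlongrightarrow> 0) (at_right 0)"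
      using \<alpha> by (auto intro!: tendsto_eq_intros simp: eventually_at_filter)
    then show "((\<lambda>\<delta>. C * \<delta> powr (1 - \<alpha>)) \<longlongrightarrow> 0) (at_right 0)"
      by (rule tendsto_mult_right_zero)
  qed auto
  then show "f \<in> little_hoelder k \<alpha>" using space by (simp add: little_hoelder_def)
  have "(\<Sum>j\<le>k. SUP x. \<bar>(deriv ^^ j) f x\<bar>) \<le> (\<Sum>j\<le>k. C)"
    using bound by (intro sum_mono cSUP_least) auto
  moreover have "Sup {hoelder_quot \<alpha> ?g x y | x y. 0 < circle_dist x y} \<le> C * 7"
    using quot_C dpi by (intro cSup_least) auto
  ultimately show "hoelder_norm k \<alpha> f \<le> (real k + 8) * C"
    by (simp add: hoelder_norm_def algebra_simps)
qed

subsection \<open>Taylor coefficients of holomorphic families\<close>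

text \<open>Cauchy's inequality bounds the k-th Taylor term by M q^k with q = |z - t| / R, and the
  remainder is dominated by the tail of this geometric series. The bound depends on f through M
  alone, which makes it uniform over families.\<close>

lemma taylor_remainder_bound:
  assumes f: "f holomorphic_on S" and R: "cball t R \<subseteq> S" "0 < R"
    and M: "\<And>z. z \<in> S \<Longrightarrow> norm (f z) \<le> M" and z: "norm (z - t) < R"
  shows "norm (f z - (\<Sum>k<n. (deriv ^^ k) f t / fact k * (z - t) ^ k))
           \<le> M * (norm (z - t) / R) ^ n / (1 - norm (z - t) / R)"
proof -
  define q where "q = norm (z - t) / R"
  have q: "0 \<le> q" "q < 1" using R z by (simp_all add: q_def)
  have holo: "f holomorphic_on ball t R" "continuous_on (cball t R) f"
    using f R by (auto intro: holomorphic_on_subset holomorphic_on_imp_continuous_on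
        dest: ball_subset_cball[THEN subsetD])
  let ?c = "\<lambda>k. (deriv ^^ k) f t / fact k * (z - t) ^ k"
  have c_le: "norm (?c k) \<le> M * q ^ k" for k
  proof -
    have "norm ((deriv ^^ k) f t) \<le> fact k * M / R ^ k"
      using R M by (intro Cauchy_inequality[OF holo]) (auto simp: dist_norm)
    then have "norm ((deriv ^^ k) f t) / fact k * norm (z - t) ^ k
        \<le> (fact k * M / R ^ k) / fact k * norm (z - t) ^ k"
      by (intro mult_right_mono divide_right_mono) auto
    then show ?thesis by (simp add: norm_mult norm_divide norm_power q_def power_divide)
  qed
  have "?c sums f z"
    using holomorphic_power_series[OF holo(1), of z] z by (simp add: dist_norm norm_minus_commute)
  then have s: "(\<lambda>k. ?c (k + n)) sums (f z - (\<Sum>k<n. ?c k))" by (subst sums_iff_shift) simp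
  have "(\<lambda>k. M * q ^ n * q ^ k) sums (M * q ^ n * (1 / (1 - q)))"
    using q by (intro sums_mult geometric_sums) auto
  then have g: "summable (\<lambda>k. M * q ^ n * q ^ k)" "(\<Sum>k. M * q ^ n * q ^ k) = M * q ^ n / (1 - q)"
    by (auto simp only: sums_iff times_divide_eq_right mult_1_right)
  have "norm (?c (k + n)) \<le> M * q ^ n * q ^ k" for k
    using c_le[of "k + n"] unfolding power_add[of q] by (simp only: mult_ac)
  then have "norm (\<Sum>k. ?c (k + n)) \<le> (\<Sum>k. M * q ^ n * q ^ k)"
    by (rule norm_suminf_le[OF _ g(1)])
  then show ?thesis unfolding g(2) sums_unique[OF s, symmetric] unfolding q_def .
qed

text \<open>The coefficient \<open>a\<^sub>k(x)\<close> is the limit, uniform in \<open>x\<close>, of the divided Taylor remainders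
  \<open>(F(B, x) - \<Sum>j<k. a\<^sub>j(x) (B - t)\<^sup>j) / (B - t)\<^sup>k\<close> as \<open>B \<rightarrow> t\<close>.\<close>

lemma taylor_coeff_holomorphic:
  assumes F1: "\<And>x. x \<in> T \<Longrightarrow> (\<lambda>B. F B x) holomorphic_on S"
    and F2: "\<And>B. B \<in> S \<Longrightarrow> F B holomorphic_on T"
    and M: "\<And>B x. B \<in> S \<Longrightarrow> x \<in> T \<Longrightarrow> norm (F B x) \<le> M"
    and R: "cball t R \<subseteq> S" "0 < R" and T: "open T"
  shows "(\<lambda>x. (deriv ^^ k) (\<lambda>B. F B x) t / fact k) holomorphic_on T"
proof (induction k rule: less_induct)
  case (less k)
  define a where "a = (\<lambda>k x. (deriv ^^ k) (\<lambda>B. F B x) t / fact k)"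
  have IH: "a j holomorphic_on T" if "j < k" for j using less.IH[OF that] by (simp add: a_def)
  \<comment> \<open>The summand 2 keeps every point within R/2 of the centre. The ratio of the
    remainder bound is then 1/(m + 2), and its geometric factor turns this into 1/(m + 1).\<close>
  define B where "B = (\<lambda>m. t + of_real (R / (real m + 2)))"
  have nB: "norm (B m - t) = R / (real m + 2)" for m
    unfolding B_def add_diff_cancel_left' norm_of_real using R(2) by simp
  have nB_less: "norm (B m - t) < R" for m
    using divide_strict_left_mono[of 1 "real m + 2" R] R(2) by (simp add: nB)
  have BS: "B m \<in> S" for m
    using nB_less[of m] R(1) by (auto simp: dist_norm norm_minus_commute)
  have Bne: "B m - t \<noteq> 0" for m using nB[of m] R(2) by auto
  define h where "h = (\<lambda>m x. (F (B m) x - (\<Sum>j<k. a j x * (B m - t) ^ j)) / (B m - t) ^ k)"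
  have h: "h m holomorphic_on T" for m
    unfolding h_def using Bne[of m] IH
    by (intro holomorphic_intros F2[OF BS]) auto
  have close: "norm (h m x - a k x) \<le> M / R ^ k / (real m + 1)" if x: "x \<in> T" for m x
  proof -
    have "h m x - a k x = (F (B m) x - (\<Sum>j<Suc k. a j x * (B m - t) ^ j)) / (B m - t) ^ k"
      using Bne[of m] by (simp add: h_def field_simps)
    also have "norm \<dots> \<le> (M * (norm (B m - t) / R) ^ Suc k / (1 - norm (B m - t) / R))
        / norm (B m - t) ^ k"
      unfolding norm_divide norm_power a_def
      by (intro divide_right_mono taylor_remainder_bound[OF F1[OF x] R] M x nB_less) auto
    also have "\<dots> = M / R ^ k * ((1 / (real m + 2)) / (1 - 1 / (real m + 2)))"
    proof -
      have "norm (B m - t) = R / y" "y \<noteq> 0" if "y = real m + 2" for y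
        using that by (auto simp: nB)
      then show ?thesis
        using R(2) by (simp add: power_divide)
    qed
    also have "(1 / (real m + 2)) / (1 - 1 / (real m + 2)) = 1 / (real m + 1)"
      by (simp add: field_simps)
    also have "M / R ^ k * (1 / (real m + 1)) = M / R ^ k / (real m + 1)" by simp
    finally show ?thesis .
  qed
  have unif: "uniform_limit T h (a k) sequentially"
  proof (rule uniform_limitI)
    fix e :: real assume "e > 0"
    have "(\<lambda>m. M / R ^ k * inverse (real (Suc m))) \<longlonglongrightarrow> 0"
      by (intro tendsto_mult_right_zero LIMSEQ_inverse_real_of_nat)
    then have "(\<lambda>m. M / R ^ k / (real m + 1)) \<longlonglongrightarrow> 0"
      by (simp add: divide_inverse add.commute)
    then have "\<forall>\<^sub>F m in sequentially. M / R ^ k / (real m + 1) < e"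
      using \<open>e > 0\<close> by (rule order_tendstoD)
    then show "\<forall>\<^sub>F m in sequentially. \<forall>x\<in>T. dist (h m x) (a k x) < e"
    proof eventually_elim
      case (elim m)
      then show ?case using close[of _ m] by (auto simp: dist_norm intro: le_less_trans)
    qed
  qed
  have "a k holomorphic_on T"
  proof (rule holomorphic_uniform_sequence[OF T h])
    fix x assume "x \<in> T"
    then obtain d where "0 < d" "cball x d \<subseteq> T" using T open_contains_cball by blast
    then show "\<exists>d>0. cball x d \<subseteq> T \<and> uniform_limit (cball x d) h (a k) sequentially"
      using uniform_limit_on_subset[OF unif] by blast
  qed
  then show ?case by (simp add: a_def)
qed

section \<open>Holomorphic dependence of integrals on a parameter\<close>

text \<open>Differentiation under the integral without joint continuity: the second-order Taylor
  remainder is bounded by the common M, so the difference quotients in the parameter converge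
  uniformly in the integration variable.\<close>

lemma holomorphic_integral:
  fixes F :: "complex \<Rightarrow> real \<Rightarrow> complex"
  assumes F1: "\<And>u. u \<in> {a..b} \<Longrightarrow> (\<lambda>B. F B u) holomorphic_on S"
    and F2: "\<And>B. B \<in> S \<Longrightarrow> continuous_on {a..b} (F B)"
    and M: "\<And>B u. B \<in> S \<Longrightarrow> u \<in> {a..b} \<Longrightarrow> norm (F B u) \<le> M"
    and S: "open S" and ab: "a \<le> b"
  shows "(\<lambda>B. integral {a..b} (F B)) holomorphic_on S"
  unfolding holomorphic_on_open[OF S]
proof
  fix t assume t: "t \<in> S"
  obtain R where R: "0 < R" "cball t R \<subseteq> S" using S t open_contains_cball by blast
  define D where "D = (\<lambda>u. deriv (\<lambda>B. F B u) t)"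
  define h where "h = (\<lambda>z u. (F (t + z) u - F t u) / z)"
  have hD: "norm (h z u - D u) \<le> (2 * M / R\<^sup>2) * norm z"
    if u: "u \<in> {a..b}" and z: "z \<noteq> 0" "norm z \<le> R / 2" for z u
  proof -
    have "0 \<le> M" using M[OF t u] norm_ge_zero order_trans by blast
    have "norm (F (t + z) u - (\<Sum>k<2. (deriv ^^ k) (\<lambda>B. F B u) t / fact k * ((t + z) - t) ^ k))
        \<le> M * (norm ((t + z) - t) / R) ^ 2 / (1 - norm ((t + z) - t) / R)"
      using z R by (intro taylor_remainder_bound[OF F1[OF u] R(2,1)] M u) auto
    then have "norm (F (t + z) u - F t u - D u * z) \<le> M * (norm z / R)\<^sup>2 / (1 - norm z / R)"
      by (simp add: numeral_2_eq_2 D_def algebra_simps)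
    \<comment> \<open>For |z| at most R/2 the denominator 1 - |z| / R is at least 1/2.\<close>
    also have "\<dots> \<le> M * (norm z / R)\<^sup>2 / (1 / 2)"
      using z R \<open>0 \<le> M\<close> by (intro divide_left_mono) (auto simp: field_simps)
    finally have *: "norm (F (t + z) u - F t u - D u * z) \<le> 2 * M / R\<^sup>2 * (norm z)\<^sup>2"
      by (simp add: power_divide mult_ac)
    have "h z u - D u = (F (t + z) u - F t u - D u * z) / z"
      using z by (simp add: h_def field_simps)
    then have "norm (h z u - D u) = norm (F (t + z) u - F t u - D u * z) / norm z"
      by (simp add: norm_divide)
    also have "\<dots> \<le> 2 * M / R\<^sup>2 * (norm z)\<^sup>2 / norm z" by (intro divide_right_mono *) auto
    finally show ?thesis using z by (simp add: power2_eq_square)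
  qed
  have hcont: "continuous_on {a..b} (h z)" if "norm z \<le> R" for z
  proof -
    have "t + z \<in> S" using that R by (auto simp: dist_norm)
    then show ?thesis unfolding h_def by (cases "z = 0") (auto intro!: continuous_intros F2 t)
  qed
  have Dint: "D integrable_on {a..b}"
    unfolding cbox_interval[symmetric]
  proof (rule integrable_uniform_limit)
    fix e :: real assume e: "e > 0"
    have "((\<lambda>z::complex. (2 * M / R\<^sup>2) * norm z) \<longlongrightarrow> 0) (at 0)"
      by (intro tendsto_mult_right_zero tendsto_norm_zero tendsto_ident_at)
    then have "\<forall>\<^sub>F z::complex in at 0. (2 * M / R\<^sup>2) * norm z < e"
      using e by (rule order_tendstoD)
    moreover have "\<forall>\<^sub>F z::complex in at 0. z \<noteq> 0 \<and> norm z < R / 2"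
      unfolding eventually_at using R by (intro exI[of _ "R / 2"]) auto
    ultimately have "\<forall>\<^sub>F z::complex in at 0. (2 * M / R\<^sup>2) * norm z < e \<and> z \<noteq> 0 \<and> norm z < R / 2"
      by (rule eventually_conj)
    then obtain z :: complex where z: "(2 * M / R\<^sup>2) * norm z < e" "z \<noteq> 0" "norm z < R / 2"
      using eventually_happens[of _ "at (0::complex)"] by auto
    have "norm (D u - h z u) \<le> e" if "u \<in> cbox a b" for u
      using hD[of u z] z that by (auto simp: norm_minus_commute)
    moreover have "h z integrable_on cbox a b"
      unfolding cbox_interval
      by (intro integrable_continuous_real hcont) (use z(3) R in linarith)
    ultimately show "\<exists>g. (\<forall>x\<in>cbox a b. norm (D x - g x) \<le> e) \<and> g integrable_on cbox a b"
      by blast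
  qed
  have "((\<lambda>z. (integral {a..b} (F (t + z)) - integral {a..b} (F t)) / z) \<longlongrightarrow> integral {a..b} D) (at 0)"
  proof (rule LIM_zero_cancel, rule Lim_null_comparison)
    show "((\<lambda>z::complex. (b - a) * (2 * M / R\<^sup>2) * norm z) \<longlongrightarrow> 0) (at 0)"
      by (intro tendsto_mult_right_zero tendsto_norm_zero tendsto_ident_at)
    have "\<forall>\<^sub>F z::complex in at 0. z \<noteq> 0 \<and> norm z < R / 2"
      unfolding eventually_at using R by (intro exI[of _ "R / 2"]) auto
    then show "\<forall>\<^sub>F z in at 0. norm ((integral {a..b} (F (t + z)) - integral {a..b} (F t)) / z
        - integral {a..b} D) \<le> (b - a) * (2 * M / R\<^sup>2) * norm z"
    proof eventually_elim
      case (elim z)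
      have tz: "t + z \<in> S" using elim R by (auto simp: dist_norm)
      have "integral {a..b} (h z) = (integral {a..b} (F (t + z)) - integral {a..b} (F t)) / z"
        unfolding h_def using F2[OF tz] F2[OF t]
        by (simp add: integral_diff integrable_continuous_real)
      then have "(integral {a..b} (F (t + z)) - integral {a..b} (F t)) / z - integral {a..b} D
          = integral {a..b} (\<lambda>u. h z u - D u)"
        using hcont[of z] elim R Dint by (simp add: integral_diff integrable_continuous_real)
      also have "norm \<dots> \<le> (2 * M / R\<^sup>2) * norm z * measure lborel (cbox a b)"
        unfolding cbox_interval[symmetric]
      proof (rule integrable_bound)
        show "0 \<le> 2 * M / R\<^sup>2 * norm z"
          using order_trans[OF norm_ge_zero hD[of a z]] elim ab by simp
        show "(\<lambda>u. h z u - D u) integrable_on cbox a b"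
          unfolding cbox_interval
          by (intro integrable_diff integrable_continuous_real hcont Dint) (use elim R in linarith)
      qed (use hD elim in auto)
      finally show ?case using ab by (simp add: mult_ac)
    qed
  qed
  then show "\<exists>f'. ((\<lambda>B. integral {a..b} (F B)) has_field_derivative f') (at t)"
    unfolding DERIV_def by blast
qed

section \<open>Restrictions to the real line of holomorphic functions on a strip\<close>

definition strip :: "real \<Rightarrow> complex set" where
  "strip \<eta> = {z. \<bar>Im z\<bar> < \<eta>}"

lemma open_strip: "open (strip \<eta>)"
proof -
  have "strip \<eta> = Im -` {-\<eta><..<\<eta>}" by (auto simp: strip_def)
  then show ?thesis by (auto intro!: open_vimage continuous_intros)
qed

lemma convex_strip: "convex (strip \<eta>)"
proof -
  have "strip \<eta> = {z. Im z < \<eta>} \<inter> {z. Im z > - \<eta>}" by (auto simp: strip_def)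
  then show ?thesis by (simp add: convex_Int convex_halfspace_Im_lt convex_halfspace_Im_gt)
qed

lemma of_real_in_strip: "0 < \<eta> \<Longrightarrow> of_real x \<in> strip \<eta>"
  by (simp add: strip_def)

lemma has_real_derivative_Re:
  assumes "(g has_field_derivative g') (at (of_real x))"
  shows "((\<lambda>x. Re (g (of_real x))) has_real_derivative Re g') (at x)"
  using bounded_linear.has_vector_derivative[OF bounded_linear_Re
      has_vector_derivative_real_field[OF assms]]
  by (simp add: has_real_derivative_iff_has_vector_derivative o_def)

text \<open>The summands are the Cauchy factors for discs of radius \<eta>/2, and their sum
  dominates each of them. The factor 2 leaves room for a subtracted constant, and k + 8 comes from
  \<open>smooth_little_hoelder\<close>.\<close>

definition strip_const :: "nat \<Rightarrow> real \<Rightarrow> real" where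
  "strip_const k \<eta> = (real k + 8) * (2 * (\<Sum>j\<le>Suc k. fact j / (\<eta> / 2) ^ j))"

text \<open>The discs of radius \<eta>/2 around real points stay in the strip, so Cauchy's
  inequality bounds every derivative on the real line by a multiple of \<open>K\<close>. The
  constant \<open>c\<close> is there for the mean value removed by \<open>P0\<close>; c = 0 treats
  the function itself.\<close>

lemma strip_little_hoelder:
  assumes g: "g holomorphic_on strip \<eta>" and \<eta>: "0 < \<eta>"
    and per: "\<And>z. z \<in> strip \<eta> \<Longrightarrow> g (z + 2 * pi) = g z"
    and K: "\<And>z. z \<in> strip \<eta> \<Longrightarrow> norm (g z) \<le> K"
    and \<alpha>: "0 < \<alpha>" "\<alpha> < 1" and c: "\<bar>c\<bar> \<le> K"
  defines "f \<equiv> \<lambda>x. Re (g (of_real x)) - c"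
  shows "f \<in> little_hoelder k \<alpha>" "hoelder_norm k \<alpha> f \<le> strip_const k \<eta> * K"
proof -
  have K0: "0 \<le> K" using c by linarith
  define S where "S = (\<Sum>j\<le>Suc k. fact j / (\<eta> / 2) ^ j)"
  have S1: "fact j / (\<eta> / 2) ^ j \<le> S" if "j \<le> Suc k" for j
    unfolding S_def using \<eta> that by (intro member_le_sum) auto
  have S0: "1 \<le> S" using S1[of 0] by simp
  have hol: "((deriv ^^ j) g has_field_derivative (deriv ^^ Suc j) g (of_real x)) (at (of_real x))"
    for j x
    using holomorphic_derivI[OF holomorphic_higher_deriv[OF g open_strip] open_strip
        of_real_in_strip[OF \<eta>]] by simp
  have der': "((\<lambda>x. Re ((deriv ^^ j) g (of_real x)) - (if j = 0 then c else 0))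
      has_real_derivative Re ((deriv ^^ Suc j) g (of_real x))) (at x)" for j x
    using DERIV_diff[OF has_real_derivative_Re[OF hol] DERIV_const] by simp
  have fj: "(deriv ^^ j) f = (\<lambda>x. Re ((deriv ^^ j) g (of_real x)) - (if j = 0 then c else 0))" for j
  proof (induction j)
    case (Suc j)
    have "deriv (\<lambda>x. Re ((deriv ^^ j) g (of_real x)) - (if j = 0 then c else 0))
        = (\<lambda>x. Re ((deriv ^^ Suc j) g (of_real x)))"
      using DERIV_imp_deriv[OF der'[of j]] by blast
    then show ?case by (simp add: Suc)
  qed (simp add: f_def)
  have circ: "circle_fun f"
    using per of_real_in_strip[OF \<eta>] by (simp add: circle_fun_def f_def)
  have der: "((deriv ^^ j) f has_real_derivative (deriv ^^ Suc j) f x) (at x)" for j x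
    using der'[of j x] unfolding fj by simp
  have bound: "\<bar>(deriv ^^ j) f x\<bar> \<le> 2 * S * K" if j: "j \<le> Suc k" for j x
  proof -
    have sub: "cball (of_real x) (\<eta> / 2) \<subseteq> strip \<eta>"
    proof
      fix z assume "z \<in> cball (complex_of_real x) (\<eta> / 2)"
      then have "norm (z - of_real x) \<le> \<eta> / 2" by (simp add: dist_norm norm_minus_commute)
      then show "z \<in> strip \<eta>" using abs_Im_le_cmod[of "z - of_real x"] \<eta> by (simp add: strip_def)
    qed
    have "norm ((deriv ^^ j) g (of_real x)) \<le> fact j * K / (\<eta> / 2) ^ j"
    proof (rule Cauchy_inequality)
      show "g holomorphic_on ball (of_real x) (\<eta> / 2)"
        using sub ball_subset_cball by (blast intro: holomorphic_on_subset[OF g])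
      show "continuous_on (cball (of_real x) (\<eta> / 2)) g"
        using sub by (intro holomorphic_on_imp_continuous_on holomorphic_on_subset[OF g])
      show "norm (g z) \<le> K" if "norm (of_real x - z) = \<eta> / 2" for z
        using that sub by (intro K) (auto simp: dist_norm)
    qed (use \<eta> in auto)
    also have "\<dots> \<le> S * K" using mult_right_mono[OF S1[OF j] K0] by (simp add: mult_ac)
    finally have 1: "\<bar>Re ((deriv ^^ j) g (of_real x))\<bar> \<le> S * K"
      using abs_Re_le_cmod order_trans by blast
    have "\<bar>(if j = 0 then c else 0)\<bar> \<le> S * K"
      using c mult_right_mono[OF S0 K0] by auto
    then show ?thesis unfolding fj using 1 by (auto split: if_splits)
  qed
  have C: "0 \<le> 2 * S * K" using S0 K0 by simp
  note * = smooth_little_hoelder[OF circ \<alpha> C der bound, of k]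
  show "f \<in> little_hoelder k \<alpha>" by (rule *)
  show "hoelder_norm k \<alpha> f \<le> strip_const k \<eta> * K"
    using *(2) by (simp add: strip_const_def S_def mult_ac)
qed

lemma continuous_strip_Re:
  assumes "g holomorphic_on strip \<eta>" "0 < \<eta>"
  shows "continuous_on S (\<lambda>x. Re (g (of_real x)))"
proof -
  have "continuous_on S (\<lambda>x::real. g (of_real x))"
    by (rule continuous_on_compose2[OF holomorphic_on_imp_continuous_on[OF assms(1)]])
      (use assms(2) in \<open>auto simp: of_real_in_strip intro: continuous_intros\<close>)
  then show ?thesis by (rule continuous_on_Re)
qed

lemma strip_little_hoelder0_even:
  assumes g: "g holomorphic_on strip \<eta>" and \<eta>: "0 < \<eta>"
    and per: "\<And>z. z \<in> strip \<eta> \<Longrightarrow> g (z + 2 * pi) = g z"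
    and even: "\<And>z. z \<in> strip \<eta> \<Longrightarrow> g (- z) = g z"
    and K: "\<And>z. z \<in> strip \<eta> \<Longrightarrow> norm (g z) \<le> K"
    and \<alpha>: "0 < \<alpha>" "\<alpha> < 1"
  defines "f \<equiv> \<lambda>x. Re (g (of_real x))"
  shows "f \<in> little_hoelder k \<alpha>" "P0 f \<in> little_hoelder0_even k \<alpha>"
    "0 \<le> hoelder_norm k \<alpha> (P0 f)" "hoelder_norm k \<alpha> (P0 f) \<le> strip_const k \<eta> * K"
proof -
  define c where "c = 1 / (2 * pi) * integral {-pi..pi} f"
  have K0: "0 \<le> K" using K[OF of_real_in_strip[OF \<eta>, of 0]] norm_ge_zero order_trans by blast
  have fK: "norm (f x) \<le> K" for x
    using abs_Re_le_cmod K[OF of_real_in_strip[OF \<eta>, of x]] order_trans by (auto simp: f_def)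
  have "norm (integral {-pi..pi} f) \<le> K * (pi - (- pi))"
    using continuous_strip_Re[OF g \<eta>] fK by (intro integral_bound) (auto simp: f_def)
  then have "\<bar>c\<bar> \<le> K" by (simp add: c_def abs_mult field_simps)
  note c = strip_little_hoelder[OF g \<eta> per K \<alpha> this, of k]
  note 0 = strip_little_hoelder[OF g \<eta> per K \<alpha>, of 0 k]
  show f: "f \<in> little_hoelder k \<alpha>" using 0(1) K0 by (simp add: f_def)
  have P: "P0 f = (\<lambda>x. Re (g (of_real x)) - c)" by (simp add: P0_def f_def c_def)
  show "hoelder_norm k \<alpha> (P0 f) \<le> strip_const k \<eta> * K" using c(2) by (simp add: P)
  have "P0 f \<in> hoelder_space k \<alpha>" using c(1) by (simp add: P little_hoelder_def)
  then show "0 \<le> hoelder_norm k \<alpha> (P0 f)"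
    using order_trans[OF abs_ge_zero higher_deriv_le_hoelder_norm[of _ k \<alpha> 0]] by blast
  have "P0 f (- x) = P0 f x" for x
    using even[OF of_real_in_strip[OF \<eta>, of x]] by (simp add: P)
  then show "P0 f \<in> little_hoelder0_even k \<alpha>"
    using f by (auto simp: little_hoelder0_even_def little_hoelder0_def)
qed

text \<open>Used to see that the Taylor remainder of a projected curve is the projection of the
  Taylor remainder.\<close>

lemma P0_linear_combination:
  fixes n :: nat
  assumes f: "continuous_on {-pi..pi} f" and g: "\<And>j. j < n \<Longrightarrow> continuous_on {-pi..pi} (g j)"
  shows "P0 (\<lambda>x. f x - (\<Sum>j<n. c j * g j x)) = (\<lambda>x. P0 f x - (\<Sum>j<n. c j * P0 (g j) x))"
proof -
  have "integral {-pi..pi} (\<lambda>x. f x - (\<Sum>j<n. c j * g j x))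
      = integral {-pi..pi} f - integral {-pi..pi} (\<lambda>x. \<Sum>j<n. c j * g j x)"
    using f g by (intro integral_diff integrable_continuous_real continuous_intros) auto
  also have "integral {-pi..pi} (\<lambda>x. \<Sum>j<n. c j * g j x) = (\<Sum>j<n. c j * integral {-pi..pi} (g j))"
    using g by (subst integral_sum)
      (auto intro!: integrable_continuous_real continuous_intros)
  finally have I: "integral {-pi..pi} (\<lambda>x. f x - (\<Sum>j<n. c j * g j x))
      = integral {-pi..pi} f - (\<Sum>j<n. c j * integral {-pi..pi} (g j))" .
  show ?thesis
    unfolding P0_def I
    by (simp add: fun_eq_iff algebra_simps sum_subtractf sum_distrib_left sum_divide_distrib
        diff_divide_distrib)
qed

section \<open>Analytic curves of functions from holomorphic families\<close>

text \<open>Holomorphy is demanded in each variable separately, with one bound on the product of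
  disc and strip. This suffices for \<open>taylor_coeff_holomorphic\<close>, and it is what can be
  checked for the unduloids.\<close>

locale analytic_family =
  fixes F :: "complex \<Rightarrow> complex \<Rightarrow> complex" and \<delta> \<eta> M \<alpha> :: real
  assumes \<delta>: "0 < \<delta>" and \<eta>: "0 < \<eta>" and \<alpha>: "0 < \<alpha>" "\<alpha> < 1"
    and holo_x: "\<And>B. norm B < \<delta> \<Longrightarrow> F B holomorphic_on strip \<eta>"
    and holo_B: "\<And>x. x \<in> strip \<eta> \<Longrightarrow> (\<lambda>B. F B x) holomorphic_on ball 0 \<delta>"
    and bound: "\<And>B x. norm B < \<delta> \<Longrightarrow> x \<in> strip \<eta> \<Longrightarrow> norm (F B x) \<le> M"
    and periodic: "\<And>B x. norm B < \<delta> \<Longrightarrow> x \<in> strip \<eta> \<Longrightarrow> F B (x + 2 * pi) = F B x"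
    and even: "\<And>B x. norm B < \<delta> \<Longrightarrow> x \<in> strip \<eta> \<Longrightarrow> F B (- x) = F B x"
begin

definition coeff :: "complex \<Rightarrow> nat \<Rightarrow> complex \<Rightarrow> complex" where
  "coeff t k x = (deriv ^^ k) (\<lambda>B. F B x) t / fact k"

definition rem :: "complex \<Rightarrow> nat \<Rightarrow> complex \<Rightarrow> complex \<Rightarrow> complex" where
  "rem t n B x = F B x - (\<Sum>k<n. coeff t k x * (B - t) ^ k)"

definition curve :: "real \<Rightarrow> real \<Rightarrow> real" where
  "curve s = P0 (\<lambda>x. Re (F (of_real s) (of_real x)))"

lemma strip_shift: "x \<in> strip \<eta> \<Longrightarrow> x + 2 * pi \<in> strip \<eta>" "x \<in> strip \<eta> \<Longrightarrow> - x \<in> strip \<eta>"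
  by (auto simp: strip_def)

lemma cball_subset:
  "norm t + R < \<delta> \<Longrightarrow> cball t R \<subseteq> ball (0::complex) \<delta>"
proof
  fix z assume "norm t + R < \<delta>" "z \<in> cball t R"
  then show "z \<in> ball 0 \<delta>"
    using dist_triangle[of 0 z t] by simp
qed

lemma rem_bound:
  assumes "norm t + R < \<delta>" "0 < R" "norm (B - t) < R" "x \<in> strip \<eta>"
  shows "norm (rem t n B x) \<le> M * (norm (B - t) / R) ^ n / (1 - norm (B - t) / R)"
  unfolding rem_def coeff_def
  using taylor_remainder_bound[OF holo_B[OF assms(4)] cball_subset[OF assms(1)] assms(2) _ assms(3)]
    bound assms(4) by simp

lemma coeff_holomorphic: "norm t < \<delta> \<Longrightarrow> coeff t k holomorphic_on strip \<eta>"
  unfolding coeff_def using bound holo_B holo_x cball_subset[of t "(\<delta> - norm t) / 2"]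
  by (intro taylor_coeff_holomorphic[where S = "ball 0 \<delta>" and R = "(\<delta> - norm t) / 2" and M = M]
      open_strip) (auto simp: field_simps)

text \<open>The functions of B at x + 2 pi and at x agree on the whole disc, hence so do all their
  derivatives at t.\<close>

lemma coeff_periodic: "norm t < \<delta> \<Longrightarrow> x \<in> strip \<eta> \<Longrightarrow> coeff t k (x + 2 * pi) = coeff t k x"
  unfolding coeff_def using periodic strip_shift
  by (subst higher_deriv_transform_within_open[of _ "ball 0 \<delta>" "\<lambda>B. F B x"]) (auto intro!: holo_B)

lemma coeff_even: "norm t < \<delta> \<Longrightarrow> x \<in> strip \<eta> \<Longrightarrow> coeff t k (- x) = coeff t k x"
  unfolding coeff_def using even strip_shift
  by (subst higher_deriv_transform_within_open[of _ "ball 0 \<delta>" "\<lambda>B. F B x"]) (auto intro!: holo_B)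

lemma coeff_bound:
  assumes "norm t + R < \<delta>" "0 < R" "x \<in> strip \<eta>"
  shows "norm (coeff t k x) \<le> M / R ^ k"
proof -
  note sub = cball_subset[OF assms(1)]
  have "norm ((deriv ^^ k) (\<lambda>B. F B x) t) \<le> fact k * M / R ^ k"
  proof (rule Cauchy_inequality)
    show "(\<lambda>B. F B x) holomorphic_on ball t R"
      using sub ball_subset_cball by (blast intro: holomorphic_on_subset[OF holo_B[OF assms(3)]])
    show "continuous_on (cball t R) (\<lambda>B. F B x)"
      using sub by (intro holomorphic_on_imp_continuous_on holomorphic_on_subset[OF holo_B[OF assms(3)]])
    show "norm (F B x) \<le> M" if "norm (t - B) = R" for B
    proof -
      have "B \<in> cball t R" using that by (simp add: dist_norm)
      then show ?thesis using sub assms(3) by (auto intro!: bound)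
    qed
  qed (use assms in auto)
  then show ?thesis by (simp add: coeff_def norm_divide field_simps)
qed

lemma rem_holomorphic:
  "norm t < \<delta> \<Longrightarrow> norm B < \<delta> \<Longrightarrow> rem t n B holomorphic_on strip \<eta>"
  unfolding rem_def by (intro holomorphic_intros holo_x coeff_holomorphic) auto

lemma coeff_in_little_hoelder0_even:
  assumes "norm t < \<delta>"
  shows "P0 (\<lambda>x. Re (coeff t j (of_real x))) \<in> little_hoelder0_even k \<alpha>"
proof (rule strip_little_hoelder0_even(2)[OF coeff_holomorphic[OF assms] \<eta> _ _ _ \<alpha>])
  show "norm (coeff t j z) \<le> M / ((\<delta> - norm t) / 2) ^ j" if "z \<in> strip \<eta>" for z
    using assms that by (intro coeff_bound) (auto simp: field_simps)
qed (use assms coeff_periodic coeff_even in auto)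

text \<open>For real s and t the powers of s - t are real, so real part and \<open>P0\<close>
  commute with the Taylor sum, and r is the projection of \<open>rem\<close>, a bounded holomorphic
  function on the strip. Nonnegativity of the norm is stated as well, because it rests on membership
  in the Hoelder space and gives the lower half of later squeezes.\<close>

lemma curve_remainder:
  fixes s t :: real and n :: nat
  assumes R: "\<bar>t\<bar> + R < \<delta>" "0 < R" and st: "\<bar>s - t\<bar> < R"
  defines "r \<equiv> (\<lambda>x. curve s x - (\<Sum>j<n. (s - t) ^ j * P0 (\<lambda>x. Re (coeff t j (of_real x))) x))"
  shows "0 \<le> hoelder_norm k \<alpha> r"
    "hoelder_norm k \<alpha> r \<le> strip_const k \<eta> * (M * (\<bar>s - t\<bar> / R) ^ n / (1 - \<bar>s - t\<bar> / R))"
proof -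
  have s: "\<bar>s\<bar> < \<delta>" and t: "\<bar>t\<bar> < \<delta>" using R st by linarith+
  have Re_rem: "Re (rem t n s (of_real x)) =
      Re (F s (of_real x)) - (\<Sum>j<n. (s - t) ^ j * Re (coeff t j (of_real x)))" for x
    unfolding rem_def by (simp add: mult.commute flip: of_real_diff of_real_power)
  have r: "r = P0 (\<lambda>x. Re (rem t n s (of_real x)))"
    unfolding Re_rem curve_def r_def using s t \<eta>
    by (intro P0_linear_combination[symmetric] continuous_strip_Re[OF holo_x]
        continuous_strip_Re[OF coeff_holomorphic]) auto
  have bd: "norm (rem t n s z) \<le> M * (\<bar>s - t\<bar> / R) ^ n / (1 - \<bar>s - t\<bar> / R)" if "z \<in> strip \<eta>" for z
    using rem_bound[of t R s z n] R st that by (simp flip: of_real_diff)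
  have "rem t n s (z + 2 * pi) = rem t n s z" "rem t n s (- z) = rem t n s z"
    if "z \<in> strip \<eta>" for z
    using s t that by (simp_all add: rem_def periodic even coeff_periodic coeff_even del: of_real_mult)
  note * = strip_little_hoelder0_even(3,4)[OF rem_holomorphic[of t s n] \<eta> this bd \<alpha>]
  show "0 \<le> hoelder_norm k \<alpha> r"
    "hoelder_norm k \<alpha> r \<le> strip_const k \<eta> * (M * (\<bar>s - t\<bar> / R) ^ n / (1 - \<bar>s - t\<bar> / R))"
    unfolding r using s t * by simp_all
qed

lemma curve_in_little_hoelder:
  assumes "\<bar>s\<bar> < \<delta>"
  shows "(\<lambda>x. Re (F (of_real s) (of_real x))) \<in> little_hoelder k \<alpha>"
    "curve s \<in> little_hoelder0_even k \<alpha>"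
  unfolding curve_def
  using strip_little_hoelder0_even(1,2)[OF holo_x \<eta> periodic even bound \<alpha>, of "of_real s"] assms
  by auto

lemma curve_analytic:
  fixes t :: real
  assumes t: "\<bar>t\<bar> < \<delta>"
  obtains R a where "0 < R" "\<And>n. a n \<in> little_hoelder0_even k \<alpha>"
    "\<And>s. \<bar>s - t\<bar> < R \<Longrightarrow>
       (\<lambda>n. hoelder_norm k \<alpha> (\<lambda>x. curve s x - (\<Sum>j<n. (s - t) ^ j * a j x))) \<longlonglongrightarrow> 0"
proof -
  define R where "R = (\<delta> - \<bar>t\<bar>) / 2"
  have R: "\<bar>t\<bar> + R < \<delta>" "0 < R" using t by (auto simp: R_def field_simps)
  define a where "a = (\<lambda>j. P0 (\<lambda>x. Re (coeff t j (of_real x))))"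
  have a: "a j \<in> little_hoelder0_even i \<alpha>" for i j
    unfolding a_def using t by (intro coeff_in_little_hoelder0_even) auto
  have lim: "(\<lambda>n. hoelder_norm k \<alpha> (\<lambda>x. curve s x - (\<Sum>j<n. (s - t) ^ j * a j x))) \<longlonglongrightarrow> 0"
    if s: "\<bar>s - t\<bar> < R" for s
  proof (rule tendsto_sandwich[where f = "\<lambda>_. 0"])
    define q where "q = \<bar>s - t\<bar> / R"
    have q: "0 \<le> q" "q < 1" using s R by (auto simp: q_def)
    then have "(\<lambda>n. strip_const k \<eta> * (M * q ^ n / (1 - q))) \<longlonglongrightarrow> strip_const k \<eta> * (M * 0 / (1 - q))"
      by (intro tendsto_intros LIMSEQ_realpow_zero) auto
    then show "(\<lambda>n. strip_const k \<eta> * (M * q ^ n / (1 - q))) \<longlonglongrightarrow> 0" by simp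
    show "\<forall>\<^sub>F n in sequentially. hoelder_norm k \<alpha>
        (\<lambda>x. curve s x - (\<Sum>j<n. (s - t) ^ j * a j x)) \<le> strip_const k \<eta> * (M * q ^ n / (1 - q))"
      using curve_remainder(2)[OF R s] by (simp add: a_def q_def)
    show "\<forall>\<^sub>F n in sequentially. 0 \<le> hoelder_norm k \<alpha>
        (\<lambda>x. curve s x - (\<Sum>j<n. (s - t) ^ j * a j x))"
      using curve_remainder(1)[OF R s] by (simp add: a_def)
  qed simp_all
  show ?thesis using that[of R a] R a lim by blast
qed

end

subsection \<open>Kenmotsu's parametrization of unduloids\<close>

text \<open>Both exponentials in the cosine have modulus at most e, which is at most 3, on the strip
  of half-width 1.\<close>

lemma norm_cos_strip:
  assumes "w \<in> strip 1"
  shows "norm (cos w) \<le> 3"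
proof -
  have *: "norm (exp (\<i> * w)) \<le> 3" "norm (exp (- (\<i> * w))) \<le> 3"
    using assms exp_le order_trans[OF _ exp_le] by (auto simp: strip_def)
  have "norm (exp (\<i> * w) + exp (- (\<i> * w))) \<le> 3 + 3"
    using * by (rule norm_triangle_mono)
  then show ?thesis by (simp add: cos_exp_eq norm_divide)
qed

text \<open>The difference p - 1 factors as (\<open>csqrt p\<close> - 1)(\<open>csqrt p\<close> +
  1), and the second factor has real part at least 1 since the principal root lies in the closed
  right half-plane.\<close>

lemma csqrt_near_1:
  assumes "Re p \<ge> 0"
  shows "norm (csqrt p - 1) \<le> norm (p - 1)"
proof -
  have "Re (csqrt p) \<ge> 0" using csqrt_principal[of p] by auto
  then have "1 \<le> Re (csqrt p + 1)" by simp
  then have 1: "1 \<le> norm (csqrt p + 1)" using complex_Re_le_cmod order_trans by blast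
  have "p - 1 = (csqrt p - 1) * (csqrt p + 1)"
    using power2_csqrt[of p] by (simp add: power2_eq_square algebra_simps)
  then have "norm (p - 1) = norm (csqrt p - 1) * norm (csqrt p + 1)" by (simp add: norm_mult)
  then show ?thesis using mult_left_mono[OF 1 norm_ge_zero[of "csqrt p - 1"]] by simp
qed

text \<open>Kenmotsu's parametrization: in units of the inverse mean curvature, the Delaunay unduloid with
  parameter \<open>B\<close> has radius \<open>sqrt (rad B w)\<close> at axial position \<open>axial B w\<close>, where \<open>w\<close> is a
  multiple of the arc length. The square roots are holomorphic and \<open>slope\<close> stays within \<open>1/60\<close> of
  \<open>1\<close> for \<open>B\<close> in \<open>small_disc\<close> and \<open>w\<close> in the strip of half-width \<open>1\<close>, which makes \<open>axial B\<close>
  a small perturbation of a linear map.\<close>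

definition rad :: "complex \<Rightarrow> complex \<Rightarrow> complex" where
  "rad B w = 1 + B\<^sup>2 + 2 * (B * cos w)"

definition slope :: "complex \<Rightarrow> complex \<Rightarrow> complex" where
  "slope B w = (1 + B * cos w) / csqrt (rad B w)"

definition axial :: "complex \<Rightarrow> complex \<Rightarrow> complex" where
  "axial B w = w * integral {0..1} (\<lambda>u. slope B (of_real u * w))"

text \<open>A complete elliptic integral: one full turn of the phase advances the axial position by
  2 pi times this number. An unduloid of mean curvature h therefore closes up on the circle after l
  turns exactly when h = l \<open>mean_slope\<close>.\<close>

definition mean_slope :: "complex \<Rightarrow> complex" where
  "mean_slope B = integral {0..1} (\<lambda>u. slope B (of_real u * of_real (2 * pi)))"

abbreviation small_disc :: "complex set" where
  "small_disc \<equiv> ball 0 (1 / 1000)"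

lemma norm_B_cos:
  assumes "B \<in> small_disc" "w \<in> strip 1"
  shows "norm (B * cos w) \<le> 3 / 1000"
proof -
  have "norm B * norm (cos w) \<le> (1 / 1000) * 3"
    using assms norm_cos_strip[OF assms(2)] by (intro mult_mono) auto
  then show ?thesis by (simp add: norm_mult)
qed

lemma norm_rad:
  assumes "B \<in> small_disc" "w \<in> strip 1"
  shows "norm (rad B w - 1) \<le> 7 / 1000"
proof -
  have "norm B * norm B \<le> (1 / 1000) * 1" using assms by (intro mult_mono) auto
  then have "norm (B\<^sup>2) \<le> 1 / 1000" by (simp add: norm_mult power2_eq_square)
  moreover have "norm (2 * (B * cos w)) \<le> 6 / 1000"
    using norm_B_cos[OF assms] by (simp add: norm_mult)
  ultimately have "norm (B\<^sup>2 + 2 * (B * cos w)) \<le> 1 / 1000 + 6 / 1000" by (rule norm_triangle_mono)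
  then show ?thesis by (simp add: rad_def)
qed

lemma Re_rad:
  assumes "B \<in> small_disc" "w \<in> strip 1"
  shows "0 < Re (rad B w)"
  using norm_rad[OF assms] abs_Re_le_cmod[of "rad B w - 1"] by simp

lemma norm_csqrt_rad:
  assumes "B \<in> small_disc" "w \<in> strip 1"
  shows "norm (csqrt (rad B w) - 1) \<le> 7 / 1000"
  using csqrt_near_1[of "rad B w"] Re_rad[OF assms] norm_rad[OF assms] by simp

text \<open>With c the square root, slope - 1 = (B cos w - (c - 1)) / c. The numerator is at most (3
  + 7)/1000, the denominator at least 993/1000, and 10/993 is below 1/60.\<close>

lemma slope_near_1:
  assumes "B \<in> small_disc" "w \<in> strip 1"
  shows "norm (slope B w - 1) \<le> 1 / 60"
proof -
  let ?c = "csqrt (rad B w)"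
  have c: "norm (?c - 1) \<le> 7 / 1000" by (rule norm_csqrt_rad[OF assms])
  have c_ge: "993 / 1000 \<le> norm ?c" using norm_triangle_ineq3[of ?c 1] c by simp
  then have "?c \<noteq> 0" by auto
  then have "slope B w - 1 = (B * cos w - (?c - 1)) / ?c"
    by (simp add: slope_def field_simps)
  moreover have "norm (B * cos w - (?c - 1)) \<le> 3 / 1000 + 7 / 1000"
    using norm_triangle_ineq4[of "B * cos w" "?c - 1"] norm_B_cos[OF assms] c by linarith
  then have "norm (B * cos w - (?c - 1)) / norm ?c \<le> (10 / 1000) / (993 / 1000)"
    using c_ge by (intro frac_le) auto
  ultimately have "norm (slope B w - 1) \<le> (10 / 1000) / (993 / 1000)"
    by (simp only: norm_divide)
  then show ?thesis by simp
qed

text \<open>Both arguments are arbitrary holomorphic functions of a single variable z. Holomorphy in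
  B and in w are the two special cases where the other argument is constant, here and in the lemmas
  of the same form below.\<close>

lemma rad_holomorphic:
  assumes "b holomorphic_on S" "w holomorphic_on S"
    and "\<And>z. z \<in> S \<Longrightarrow> b z \<in> small_disc" "\<And>z. z \<in> S \<Longrightarrow> w z \<in> strip 1"
  shows "(\<lambda>z. csqrt (rad (b z) (w z))) holomorphic_on S"
proof (rule holomorphic_on_csqrt')
  show "(\<lambda>z. rad (b z) (w z)) holomorphic_on S"
    unfolding rad_def by (intro holomorphic_intros assms)
  show "rad (b z) (w z) \<notin> \<real>\<^sub>\<le>\<^sub>0" if "z \<in> S" for z
    using Re_rad[OF assms(3)[OF that] assms(4)[OF that]] by (simp add: complex_nonpos_Reals_iff)
qed

lemma csqrt_rad_nonzero: "B \<in> small_disc \<Longrightarrow> w \<in> strip 1 \<Longrightarrow> csqrt (rad B w) \<noteq> 0"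
  using Re_rad[of B w] by auto

lemma slope_holomorphic:
  assumes "b holomorphic_on S" "w holomorphic_on S"
    and "\<And>z. z \<in> S \<Longrightarrow> b z \<in> small_disc" "\<And>z. z \<in> S \<Longrightarrow> w z \<in> strip 1"
  shows "(\<lambda>z. slope (b z) (w z)) holomorphic_on S"
  unfolding slope_def using assms csqrt_rad_nonzero
  by (intro holomorphic_intros rad_holomorphic) auto

lemma strip_scale: "w \<in> strip \<eta> \<Longrightarrow> u \<in> {0..1} \<Longrightarrow> of_real u * w \<in> strip \<eta>"
  using mult_left_le_one_le[of "\<bar>Im w\<bar>" u] by (auto simp: strip_def abs_mult)

lemma slope_continuous:
  assumes "B \<in> small_disc" "w \<in> strip 1"
  shows "continuous_on {0..1} (\<lambda>u. slope B (of_real u * w))"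
proof -
  have "slope B holomorphic_on strip 1"
    using slope_holomorphic[of "\<lambda>_. B" "strip 1" "\<lambda>w. w"] assms by simp
  from holomorphic_on_imp_continuous_on[OF this] show ?thesis
    by (rule continuous_on_compose2) (use strip_scale[OF assms(2)] in \<open>auto intro!: continuous_intros\<close>)
qed

lemma slope_bound:
  assumes "B \<in> small_disc" "w \<in> strip 1"
  shows "norm (slope B w) \<le> 2"
  using slope_near_1[OF assms] norm_triangle_ineq3[of "slope B w" 1] by simp

text \<open>The point w sits in the integrand and the interval is fixed, so one application of
  \<open>holomorphic_integral\<close> covers the dependence on B and on w.\<close>

lemma slope_integral_holomorphic:
  assumes "b holomorphic_on S" "w holomorphic_on S" "open S"
    and "\<And>z. z \<in> S \<Longrightarrow> b z \<in> small_disc" "\<And>z. z \<in> S \<Longrightarrow> w z \<in> strip 1"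
  shows "(\<lambda>z. integral {0..1} (\<lambda>u. slope (b z) (of_real u * w z))) holomorphic_on S"
proof (rule holomorphic_integral[where M = 2])
  show "(\<lambda>z. slope (b z) (of_real u * w z)) holomorphic_on S" if "u \<in> {0..1}" for u
    using assms strip_scale that by (intro slope_holomorphic holomorphic_intros) auto
  show "continuous_on {0..1} (\<lambda>u. slope (b z) (of_real u * w z))" if "z \<in> S" for z
    by (rule slope_continuous[OF assms(4,5)[OF that]])
  show "norm (slope (b z) (of_real u * w z)) \<le> 2" if "z \<in> S" "u \<in> {0..1}" for z u
    by (rule slope_bound[OF assms(4)[OF that(1)] strip_scale[OF assms(5)[OF that(1)] that(2)]])
qed (use assms in auto)

lemma axial_holomorphic:
  assumes "b holomorphic_on S" "w holomorphic_on S" "open S"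
    and "\<And>z. z \<in> S \<Longrightarrow> b z \<in> small_disc" "\<And>z. z \<in> S \<Longrightarrow> w z \<in> strip 1"
  shows "(\<lambda>z. axial (b z) (w z)) holomorphic_on S"
  unfolding axial_def using assms by (intro holomorphic_intros slope_integral_holomorphic)

lemma mean_slope_holomorphic:
  assumes "b holomorphic_on S" "open S" "\<And>z. z \<in> S \<Longrightarrow> b z \<in> small_disc"
  shows "(\<lambda>z. mean_slope (b z)) holomorphic_on S"
  unfolding mean_slope_def using assms
  by (intro slope_integral_holomorphic) (auto simp: strip_def)

lemma mean_slope_near_1:
  assumes "B \<in> small_disc"
  shows "norm (mean_slope B - 1) \<le> 1 / 60"
proof -
  have 2: "complex_of_real (2 * pi) \<in> strip 1" by (simp add: strip_def)
  have "mean_slope B - 1 = integral {0..1} (\<lambda>u. slope B (of_real u * of_real (2 * pi)) - 1)"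
    unfolding mean_slope_def
    using slope_continuous[OF assms 2] by (subst integral_diff) (auto intro!: integrable_continuous_real)
  moreover have "norm \<dots> \<le> 1 / 60 * (1 - 0)"
    using slope_near_1[OF assms strip_scale[OF 2]] slope_continuous[OF assms 2]
    by (intro integral_bound continuous_intros) auto
  ultimately show ?thesis by simp
qed

lemma mean_slope_bounds:
  assumes "B \<in> small_disc"
  shows "59 / 60 \<le> norm (mean_slope B)" "mean_slope B \<noteq> 0" "59 / 60 \<le> Re (mean_slope B)"
    "Re (mean_slope B) \<le> 61 / 60"
  using mean_slope_near_1[OF assms] norm_triangle_ineq3[of "mean_slope B" 1]
    abs_Re_le_cmod[of "mean_slope B - 1"] by auto

section \<open>Derivative and quasi-periodicity of the axial position\<close>

lemma axial_0: "axial B 0 = 0"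
  by (simp add: axial_def)

lemma axial_2pi: "axial B (of_real (2 * pi)) = of_real (2 * pi) * mean_slope B"
  by (simp add: axial_def mean_slope_def)

lemma axial_minus: "axial B (- w) = - axial B w"
  by (simp add: axial_def slope_def rad_def)

text \<open>On the convex strip \<open>slope B\<close> has a primitive g. Along the segment from 0
  to w the fundamental theorem of calculus identifies \<open>axial B w\<close> with g w - g
  0.\<close>

lemma axial_has_field_derivative:
  assumes B: "B \<in> small_disc" and w: "w \<in> strip 1"
  shows "(axial B has_field_derivative slope B w) (at w)"
proof -
  have "slope B holomorphic_on strip 1"
    using slope_holomorphic[of "\<lambda>_. B" "strip 1" "\<lambda>w. w"] B by simp
  then obtain g where g: "\<And>z. z \<in> strip 1 \<Longrightarrow> (g has_field_derivative slope B z) (at z within strip 1)"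
    using holomorphic_convex_primitive'[OF convex_strip open_strip] by blast
  then have g: "\<And>z. z \<in> strip 1 \<Longrightarrow> (g has_field_derivative slope B z) (at z)"
    using open_strip by (metis at_within_open)
  have axial_g: "axial B z = g z - g 0" if z: "z \<in> strip 1" for z
  proof -
    have "((\<lambda>u::real. g (of_real u * z)) has_vector_derivative z * slope B (of_real u * z)) (at u within {0..1})"
      if u: "u \<in> {0..1}" for u
    proof -
      have "((\<lambda>v. g (v * z)) has_field_derivative slope B (of_real u * z) * z) (at (of_real u))"
        by (rule DERIV_chain2[where f = g and g = "\<lambda>v. v * z", OF g[OF strip_scale[OF z u]]]) (auto intro!: derivative_eq_intros)
      from has_vector_derivative_real_field[OF this] show ?thesis by (simp add: mult.commute)
    qed
    then have "((\<lambda>u. z * slope B (of_real u * z)) has_integral g (of_real 1 * z) - g (of_real 0 * z)) {0..1}"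
      by (intro fundamental_theorem_of_calculus) auto
    then show ?thesis by (simp add: axial_def integral_unique flip: integral_mult_right)
  qed
  have "((\<lambda>z. g z - g 0) has_field_derivative slope B w) (at w)"
    using DERIV_diff[OF g[OF w] DERIV_const] by simp
  then show ?thesis
    by (rule has_field_derivative_transform_within_open[OF _ open_strip w]) (simp add: axial_g)
qed

text \<open>By periodicity of the slope, the increment over one period has derivative zero in w, so
  it equals its value at w = 0.\<close>

lemma axial_shift:
  assumes B: "B \<in> small_disc" and w: "w \<in> strip 1"
  shows "axial B (w + of_real (2 * pi)) = axial B w + of_real (2 * pi) * mean_slope B"
proof -
  have per: "slope B (z + of_real (2 * pi)) = slope B z" for z
    
  proof -
    have "cos (z + of_real (2 * pi)) = cos z"
      by (simp only: cos_add sin_of_real cos_of_real) simp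
    then show ?thesis by (simp add: slope_def rad_def del: of_real_mult)
  qed
  have "\<exists>c. \<forall>z\<in>strip 1. axial B (z + of_real (2 * pi)) - axial B z = c"
  proof (rule has_field_derivative_zero_constant[OF convex_strip])
    fix z assume z: "z \<in> strip 1"
    then have "z + of_real (2 * pi) \<in> strip 1" by (simp add: strip_def)
    note axial_has_field_derivative[OF B this]
    then have "((\<lambda>z. axial B (z + of_real (2 * pi))) has_field_derivative slope B z) (at z)"
      by (simp only: DERIV_shift per)
    then have "((\<lambda>z. axial B (z + of_real (2 * pi)) - axial B z) has_field_derivative slope B z - slope B z) (at z)"
      by (rule DERIV_diff[OF _ axial_has_field_derivative[OF B z]])
    then show "((\<lambda>z. axial B (z + of_real (2 * pi)) - axial B z) has_field_derivative 0) (at z within strip 1)"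
      by (simp add: has_field_derivative_at_within)
  qed
  then obtain c where c: "\<And>z. z \<in> strip 1 \<Longrightarrow> axial B (z + of_real (2 * pi)) - axial B z = c" by blast
  have "axial B (w + of_real (2 * pi)) - axial B w = axial B (0 + of_real (2 * pi)) - axial B 0"
    using c[OF w] c[of 0] by (simp add: strip_def)
  then show ?thesis using axial_2pi[of B] by (simp add: axial_0 algebra_simps del: of_real_mult)
qed

lemma axial_shift_int:
  fixes k :: int
  assumes B: "B \<in> small_disc" and w: "w \<in> strip 1"
  shows "axial B (w + of_real (2 * pi * of_int k)) = axial B w + of_real (2 * pi * of_int k) * mean_slope B"
proof -
  have nat: "axial B (w + of_real (2 * pi * real n)) = axial B w + of_real (2 * pi * real n) * mean_slope B"
    if "w \<in> strip 1" for w n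
  proof (induction n)
    case (Suc n)
    have "w + of_real (2 * pi * real n) \<in> strip 1" using that by (simp add: strip_def)
    from axial_shift[OF B this] Suc show ?case by (simp add: algebra_simps)
  qed simp
  show ?thesis
  proof (cases "k \<ge> 0")
    case True
    then show ?thesis using nat[OF w, of "nat k"] by simp
  next
    case False
    have "w + of_real (2 * pi * of_int k) \<in> strip 1" using w by (simp add: strip_def)
    from nat[OF this, of "nat (- k)"] False show ?thesis by (simp add: algebra_simps)
  qed
qed

section \<open>Inversion of the axial position by contraction\<close>

text \<open>After division by \<open>mean_slope B\<close> the axial position is the identity plus
  this 2 pi-periodic function. Solving for the phase thus becomes the fixed point equation w = y -
  \<open>axial_defect B w\<close>.\<close>

definition axial_defect :: "complex \<Rightarrow> complex \<Rightarrow> complex" where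
  "axial_defect B w = axial B w / mean_slope B - w"

text \<open>The derivative is slope / A - 1 with A the mean slope. Both numbers are within 1/60 of 1
  and |A| is at least 59/60, so it is at most 2/59 < 1/20.\<close>

lemma axial_defect_lipschitz:
  assumes B: "B \<in> small_disc" and "v \<in> strip 1" "w \<in> strip 1"
  shows "norm (axial_defect B v - axial_defect B w) \<le> 1 / 20 * norm (v - w)"
proof (rule field_differentiable_bound[OF convex_strip _ _ assms(2,3)])
  fix z assume z: "z \<in> strip 1"
  let ?A = "mean_slope B"
  show "(axial_defect B has_field_derivative slope B z / ?A - 1) (at z within strip 1)"
    using has_field_derivative_at_within[OF DERIV_diff[OF DERIV_cdivide[OF
          axial_has_field_derivative[OF B z]] DERIV_ident]]
    by (simp add: axial_defect_def[abs_def])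
  have "slope B z / ?A - 1 = ((slope B z - 1) - (?A - 1)) / ?A"
    using mean_slope_bounds(2)[OF B] by (simp add: field_simps)
  moreover have "norm ((slope B z - 1) - (?A - 1)) \<le> 1 / 60 + 1 / 60"
    using norm_triangle_ineq4[of "slope B z - 1" "?A - 1"] slope_near_1[OF B z] mean_slope_near_1[OF B]
    by linarith
  then have "norm ((slope B z - 1) - (?A - 1)) / norm ?A \<le> (1 / 60 + 1 / 60) / (59 / 60)"
    using mean_slope_bounds(1)[OF B] by (intro frac_le) auto
  ultimately have "norm (slope B z / ?A - 1) \<le> (1 / 60 + 1 / 60) / (59 / 60)"
    by (simp only: norm_divide)
  then show "norm (slope B z / ?A - 1) \<le> 1 / 20" by simp
qed

text \<open>By periodicity w may be moved to a point v with real part between 0 and 2 pi. Then |v|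
  is at most 2 pi + 1 < 9, and the Lipschitz bound from the zero at the origin gives 9/20. The value
  1/2 is what keeps the fixed point map inside the strip.\<close>

lemma axial_defect_bound:
  assumes B: "B \<in> small_disc" and w: "w \<in> strip 1"
  shows "norm (axial_defect B w) \<le> 1 / 2"
proof -
  define m where "m = \<lfloor>Re w / (2 * pi)\<rfloor>"
  define k where "k = - m"
  define v where "v = w + of_real (2 * pi * of_int k)"
  have "of_int m \<le> Re w / (2 * pi)" "Re w / (2 * pi) < of_int m + 1"
    unfolding m_def by linarith+
  then have "of_int m * (2 * pi) \<le> Re w" "Re w < (of_int m + 1) * (2 * pi)"
    by (simp_all add: pos_le_divide_eq pos_divide_less_eq)
  then have "\<bar>Re v\<bar> \<le> 2 * pi" by (simp add: v_def k_def algebra_simps)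
  moreover have v: "v \<in> strip 1" using w by (simp add: v_def strip_def)
  ultimately have "norm v \<le> 2 * pi + 1" using cmod_le[of v] by (simp add: strip_def)
  then have v9: "norm v \<le> 9" using pi_less_4 by linarith
  have "axial_defect B v = axial_defect B w"
    using axial_shift_int[OF B w, of k] mean_slope_bounds(2)[OF B]
    by (simp add: axial_defect_def v_def field_simps)
  moreover have "axial_defect B 0 = 0" by (simp add: axial_defect_def axial_0)
  ultimately have "norm (axial_defect B w) \<le> 1 / 20 * norm v"
    using axial_defect_lipschitz[OF B v, of 0] by (simp add: strip_def)
  then show ?thesis using v9 by simp
qed

lemma axial_inj:
  assumes B: "B \<in> small_disc" and vw: "v \<in> strip 1" "w \<in> strip 1" and eq: "axial B v = axial B w"
  shows "v = w"
proof -
  have "axial_defect B v - axial_defect B w = w - v" by (simp add: axial_defect_def eq)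
  then have "norm (v - w) \<le> 1 / 20 * norm (v - w)"
    using axial_defect_lipschitz[OF B vw] by (simp add: norm_minus_commute)
  then show ?thesis by simp
qed

text \<open>The phase of the unduloid at the point x of the circle. The factor
  \<open>of_nat l\<close> fits l periods into the circle; uniqueness of w comes from
  \<open>axial_inj\<close>, existence from \<open>fixpoint_exists\<close>.\<close>

definition angle :: "nat \<Rightarrow> complex \<Rightarrow> complex \<Rightarrow> complex" where
  "angle l B x = (THE w. w \<in> strip 1 \<and> axial B w = mean_slope B * (of_nat l * x))"

lemma axial_eq_iff_fixpoint:
  "B \<in> small_disc \<Longrightarrow> axial B w = mean_slope B * y \<longleftrightarrow> y - axial_defect B w = w"
  using mean_slope_bounds(2)[of B] by (auto simp: axial_defect_def field_simps)

lemma angle_eqI: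
  assumes B: "B \<in> small_disc" and "w \<in> strip 1" "axial B w = mean_slope B * (of_nat l * x)"
  shows "angle l B x = w"
  unfolding angle_def using assms axial_inj[OF B] by (intro the_equality) auto

lemma of_nat_strip:
  assumes "1 \<le> l" "x \<in> strip (1 / (2 * real l))"
  shows "of_nat l * x \<in> strip (1 / 2)"
  using assms by (simp add: strip_def abs_mult field_simps)

lemma fixpoint_map_strip:
  assumes "B \<in> small_disc" "y \<in> strip (1 / 2)" "w \<in> strip 1"
  shows "y - axial_defect B w \<in> strip 1"
  using axial_defect_bound[OF assms(1,3)] abs_Im_le_cmod[of "axial_defect B w"] assms(2)
  by (simp add: strip_def)

lemma fixpoint_exists:
  assumes B: "B \<in> small_disc" and y: "y \<in> strip (1 / 2)"
  shows "\<exists>w\<in>strip 1. y - axial_defect B w = w"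
proof -
  \<comment> \<open>Banach's theorem needs a complete set, and the strip is open. The defect is at
    most 1/2, so this closed strip is mapped into itself, and it lies in \<open>strip 1\<close>
    because |Im y| < 1/2.\<close>
  define S where "S = {w. \<bar>Im w\<bar> \<le> \<bar>Im y\<bar> + 1 / 2}"
  have S: "S \<subseteq> strip 1" using y by (auto simp: S_def strip_def)
  have "closed S"
    unfolding S_def by (intro closed_Collect_le continuous_intros)
  then have "complete S" by (simp add: complete_eq_closed)
  moreover have "y \<in> S" by (simp add: S_def)
  moreover have "(\<lambda>w. y - axial_defect B w) ` S \<subseteq> S"
  proof clarify
    fix w assume "w \<in> S"
    then have "norm (axial_defect B w) \<le> 1 / 2" using S by (intro axial_defect_bound[OF B]) auto
    then show "y - axial_defect B w \<in> S"
      using abs_Im_le_cmod[of "axial_defect B w"] by (simp add: S_def)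
  qed
  moreover have "dist (y - axial_defect B v) (y - axial_defect B w) \<le> 1 / 20 * dist v w"
    if "v \<in> S" "w \<in> S" for v w
    using axial_defect_lipschitz[OF B, of v w] that S by (auto simp: dist_norm norm_minus_commute)
  ultimately have "\<exists>!w. w \<in> S \<and> y - axial_defect B w = w"
    by (intro Banach_fix[where c = "1 / 20"]) auto
  then show ?thesis using S by blast
qed

lemma angle_spec:
  assumes B: "B \<in> small_disc" and l: "1 \<le> l" and x: "x \<in> strip (1 / (2 * real l))"
  shows "angle l B x \<in> strip 1" "axial B (angle l B x) = mean_slope B * (of_nat l * x)"
    "of_nat l * x - axial_defect B (angle l B x) = angle l B x"
proof -
  obtain w where w: "w \<in> strip 1" "of_nat l * x - axial_defect B w = w"
    using fixpoint_exists[OF B of_nat_strip[OF l x]] by blast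
  then have eq: "axial B w = mean_slope B * (of_nat l * x)"
    using axial_eq_iff_fixpoint[OF B] by blast
  have "angle l B x = w" by (rule angle_eqI[OF B w(1) eq])
  then show "angle l B x \<in> strip 1" "axial B (angle l B x) = mean_slope B * (of_nat l * x)"
    "of_nat l * x - axial_defect B (angle l B x) = angle l B x"
    using w eq by auto
qed

text \<open>Picard iterates for the fixed point. They make the holomorphic dependence of the fixed
  point on its parameters visible, which the existence theorem alone does not.\<close>

fun angle_approx :: "complex \<Rightarrow> complex \<Rightarrow> nat \<Rightarrow> complex" where
  "angle_approx B y 0 = y"
| "angle_approx B y (Suc n) = y - axial_defect B (angle_approx B y n)"

lemma angle_approx_strip:
  "B \<in> small_disc \<Longrightarrow> y \<in> strip (1 / 2) \<Longrightarrow> angle_approx B y n \<in> strip 1"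
proof (induction n)
  case 0
  then show ?case by (simp add: strip_def)
next
  case (Suc n)
  then show ?case using fixpoint_map_strip by simp
qed

lemma angle_approx_error:
  assumes B: "B \<in> small_disc" and l: "1 \<le> l" and x: "x \<in> strip (1 / (2 * real l))"
  shows "norm (angle_approx B (of_nat l * x) n - angle l B x) \<le> (1 / 20) ^ n"
proof (induction n)
  case 0
  have "of_nat l * x - angle l B x = axial_defect B (angle l B x)"
    using angle_spec(3)[OF assms] by (simp add: algebra_simps)
  then show ?case using axial_defect_bound[OF B angle_spec(1)[OF assms]] by simp
next
  case (Suc n)
  let ?a = "angle_approx B (of_nat l * x)"
  have "?a (Suc n) - angle l B x = axial_defect B (angle l B x) - axial_defect B (?a n)"
    using angle_spec(3)[OF assms] by (simp add: algebra_simps)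
  also have "norm \<dots> \<le> 1 / 20 * norm (angle l B x - ?a n)"
    by (intro axial_defect_lipschitz B angle_spec(1)[OF assms] angle_approx_strip of_nat_strip l x)
  also have "\<dots> \<le> 1 / 20 * (1 / 20) ^ n"
    using Suc by (intro mult_left_mono) (auto simp: norm_minus_commute)
  finally show ?case by simp
qed

lemma angle_approx_tendsto:
  assumes "B \<in> small_disc" "1 \<le> l" "x \<in> strip (1 / (2 * real l))"
  shows "angle_approx B (of_nat l * x) \<longlonglongrightarrow> angle l B x"
proof (rule LIM_zero_cancel, rule Lim_null_comparison)
  show "(\<lambda>n. (1 / 20 :: real) ^ n) \<longlonglongrightarrow> 0" by (rule LIMSEQ_realpow_zero) auto
qed (use angle_approx_error[OF assms] in auto)

text \<open>Each Picard iterate is holomorphic, and the error (1/20)^n does not depend on the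
  parameter, so the limit is locally uniform.\<close>

lemma angle_holomorphic:
  assumes b: "b holomorphic_on S" "\<And>z. z \<in> S \<Longrightarrow> b z \<in> small_disc"
    and X: "X holomorphic_on S" "\<And>z. z \<in> S \<Longrightarrow> X z \<in> strip (1 / (2 * real l))"
    and S: "open S" and l: "1 \<le> l"
  shows "(\<lambda>z. angle l (b z) (X z)) holomorphic_on S"
proof (rule holomorphic_uniform_sequence[OF S])
  let ?a = "\<lambda>n z. angle_approx (b z) (of_nat l * X z) n"
  have strip: "?a n z \<in> strip 1" if "z \<in> S" for n z
    using b X l that by (intro angle_approx_strip of_nat_strip) auto
  show "?a n holomorphic_on S" for n
  proof (induction n)
    case 0
    then show ?case using X by (auto intro!: holomorphic_intros)
  next
    case (Suc n)
    then show ?case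
      unfolding angle_approx.simps axial_defect_def
      using strip b X S mean_slope_bounds(2)
      by (intro holomorphic_on_diff holomorphic_on_mult holomorphic_on_const holomorphic_on_divide
          axial_holomorphic mean_slope_holomorphic) auto
  qed
  have unif: "uniform_limit S ?a (\<lambda>z. angle l (b z) (X z)) sequentially"
  proof (rule uniform_limitI)
    fix e :: real assume "e > 0"
    have "(\<lambda>n. (1 / 20 :: real) ^ n) \<longlonglongrightarrow> 0" by (rule LIMSEQ_realpow_zero) auto
    then have "\<forall>\<^sub>F n in sequentially. (1 / 20 :: real) ^ n < e"
      using \<open>e > 0\<close> by (rule order_tendstoD)
    then show "\<forall>\<^sub>F n in sequentially. \<forall>z\<in>S. dist (?a n z) (angle l (b z) (X z)) < e"
    proof eventually_elim
      case (elim n)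
      then show ?case
        using angle_approx_error[OF b(2) l X(2), of _ _ n] by (auto simp: dist_norm intro: le_less_trans)
    qed
  qed
  fix x assume "x \<in> S"
  then obtain d where "0 < d" "cball x d \<subseteq> S" using S open_contains_cball by blast
  then show "\<exists>d>0. cball x d \<subseteq> S \<and> uniform_limit (cball x d) ?a (\<lambda>z. angle l (b z) (X z)) sequentially"
    using uniform_limit_on_subset[OF unif] by blast
qed

lemma angle_minus:
  assumes "B \<in> small_disc" "1 \<le> l" "x \<in> strip (1 / (2 * real l))"
  shows "angle l B (- x) = - angle l B x"
  using angle_spec(1,2)[OF assms] assms(1)
  by (intro angle_eqI) (auto simp: axial_minus strip_def)

text \<open>One turn around the circle corresponds to l periods of the unduloid, hence to l full
  turns of the phase.\<close>

lemma angle_shift: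
  assumes "B \<in> small_disc" "1 \<le> l" "x \<in> strip (1 / (2 * real l))"
  shows "angle l B (x + of_real (2 * pi)) = angle l B x + of_real (2 * pi * of_int (int l))"
proof (rule angle_eqI[OF assms(1)])
  show "angle l B x + of_real (2 * pi * of_int (int l)) \<in> strip 1"
    using angle_spec(1)[OF assms] by (simp add: strip_def)
  show "axial B (angle l B x + of_real (2 * pi * of_int (int l))) =
      mean_slope B * (of_nat l * (x + of_real (2 * pi)))"
    unfolding axial_shift_int[OF assms(1) angle_spec(1)[OF assms]] angle_spec(2)[OF assms]
    by (simp add: algebra_simps)
qed

section \<open>The unduloids as a holomorphic family on the circle\<close>

text \<open>The denominator is the mean curvature for which the unduloid closes up after l periods;
  dividing by it returns from units of the inverse mean curvature to the circle of length 2
  pi.\<close>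

definition profile :: "nat \<Rightarrow> complex \<Rightarrow> complex \<Rightarrow> complex" where
  "profile l B x = csqrt (rad B (angle l B x)) / (of_nat l * mean_slope B)"

lemma profile_shift:
  assumes "B \<in> small_disc" "1 \<le> l" "x \<in> strip (1 / (2 * real l))"
  shows "profile l B (x + of_real (2 * pi)) = profile l B x"
proof -
  have cos: "cos (w + of_real (2 * pi * real n)) = cos w" for w :: complex and n
  proof (induction n)
    case (Suc n)
    have "cos (z + of_real (2 * pi)) = cos z" for z :: complex
      by (simp only: cos_add sin_of_real cos_of_real) simp
    from this[of "w + of_real (2 * pi * real n)"] Suc show ?case by (simp add: algebra_simps)
  qed simp
  show ?thesis
    using cos[of "angle l B x" l] angle_shift[OF assms] by (simp add: profile_def rad_def del: of_real_mult)
qed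

text \<open>The bound 4 comes from a numerator of modulus at most 2 and a denominator of modulus at
  least 1/2. The strip of half-width 1/(2l) is the one that multiplication by l takes to half-width
  1/2, where the fixed point map operates.\<close>

lemma analytic_family_profile:
  assumes "1 \<le> l" "0 < \<alpha>" "\<alpha> < 1"
  shows "analytic_family (profile l) (1 / 1000) (1 / (2 * real l)) 4 \<alpha>"
proof
  let ?S = "strip (1 / (2 * real l))"
  have nz: "of_nat l * mean_slope B \<noteq> 0" if "B \<in> small_disc" for B
    using assms(1) mean_slope_bounds(2)[OF that] by simp
  have holo: "(\<lambda>z. profile l (b z) (X z)) holomorphic_on S"
    if "b holomorphic_on S" "\<And>z. z \<in> S \<Longrightarrow> b z \<in> small_disc"
      "X holomorphic_on S" "\<And>z. z \<in> S \<Longrightarrow> X z \<in> ?S" "open S" for b X S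
    unfolding profile_def
    by (intro holomorphic_on_divide holomorphic_on_mult holomorphic_on_const rad_holomorphic
        mean_slope_holomorphic angle_holomorphic that assms(1) angle_spec(1) nz; assumption)
  show "profile l B holomorphic_on ?S" if "norm B < 1 / 1000" for B
    using holo[of "\<lambda>_. B" ?S "\<lambda>x. x"] that open_strip by auto
  show "(\<lambda>B. profile l B x) holomorphic_on small_disc" if "x \<in> ?S" for x
    using holo[of "\<lambda>B. B" small_disc "\<lambda>_. x"] that by auto
  fix B x :: complex assume Bx: "norm B < 1 / 1000" "x \<in> ?S"
  then have B: "B \<in> small_disc" by simp
  note ang = angle_spec[OF B assms(1) Bx(2)]
  show "profile l B (x + of_real (2 * pi)) = profile l B x"
    by (rule profile_shift[OF B assms(1) Bx(2)])
  show "profile l B (- x) = profile l B x"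
    using angle_minus[OF B assms(1) Bx(2)] by (simp add: profile_def rad_def)
  have "norm (csqrt (rad B (angle l B x))) \<le> 2"
    using norm_csqrt_rad[OF B ang(1)] norm_triangle_ineq3[of "csqrt (rad B (angle l B x))" 1] by simp
  moreover have "1 * (1 / 2) \<le> real l * norm (mean_slope B)"
    using assms(1) mean_slope_bounds(1)[OF B] by (intro mult_mono) auto
  ultimately have "norm (csqrt (rad B (angle l B x))) / (real l * norm (mean_slope B)) \<le> 2 / (1 / 2)"
    by (intro frac_le) auto
  then show "norm (profile l B x) \<le> 4" by (simp add: profile_def norm_divide norm_mult)
qed (use assms in auto)

section \<open>Real parameters: explicit profiles of constant mean curvature\<close>

context
  fixes s :: real
  assumes s: "\<bar>s\<bar> < 1 / 1000"
begin

lemma s_disc: "complex_of_real s \<in> small_disc"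
  using s by simp

lemma rad_of_real: "rad (of_real s) (of_real t) = of_real (1 + s\<^sup>2 + 2 * (s * cos t))"
  by (simp add: rad_def flip: cos_of_real)

lemma abs_s_cos: "\<bar>s * cos t\<bar> < 1 / 1000"
  using s mult_left_le[of "\<bar>cos t\<bar>" "\<bar>s\<bar>"] by (simp add: abs_mult)

lemma rad_real_pos: "0 < 1 + s\<^sup>2 + 2 * (s * cos t)"
proof -
  have "0 \<le> s\<^sup>2" by simp
  then show ?thesis using abs_s_cos[of t] unfolding abs_less_iff by linarith
qed

lemma slope_numerator_pos: "0 < 1 + s * cos t"
  using abs_s_cos[of t] by linarith

lemma slope_of_real:
  "slope (of_real s) (of_real t) = of_real ((1 + s * cos t) / sqrt (1 + s\<^sup>2 + 2 * (s * cos t)))"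
  unfolding slope_def rad_of_real using rad_real_pos[of t]
  by (simp add: csqrt_of_real_nonneg cos_of_real)

lemma slope_integral_real:
  "integral {0..1} (\<lambda>u. slope (of_real s) (of_real u * of_real t)) \<in> \<real>"
proof -
  let ?f = "\<lambda>u. (1 + s * cos (u * t)) / sqrt (1 + s\<^sup>2 + 2 * (s * cos (u * t)))"
  have "continuous_on {0..1} ?f"
    using rad_real_pos by (intro continuous_intros) (auto simp: less_imp_neq[symmetric])
  then have "(?f has_integral integral {0..1} ?f) {0..1}"
    by (intro integrable_integral integrable_continuous_real)
  then have "((\<lambda>u. complex_of_real (?f u)) has_integral of_real (integral {0..1} ?f)) {0..1}"
    by (rule has_integral_of_real)
  moreover have "slope (of_real s) (of_real u * of_real t) = of_real (?f u)" for u
    using slope_of_real[of "u * t"] by simp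
  ultimately show ?thesis by (simp only: integral_unique) simp
qed

lemma axial_real: "axial (of_real s) (of_real t) \<in> \<real>"
  unfolding axial_def by (intro Reals_mult slope_integral_real) simp

lemma mean_slope_real: "mean_slope (of_real s) = of_real (Re (mean_slope (of_real s)))"
  unfolding mean_slope_def by (rule of_real_Re[OF slope_integral_real, symmetric])

text \<open>The iteration preserves the real line; since the reals are closed, the limit
  \<open>angle\<close> is real as well.\<close>

lemma angle_approx_real: "angle_approx (of_real s) (of_real y) n \<in> \<real>"
proof (induction n)
  case (Suc n)
  then obtain t where t: "angle_approx (of_real s) (of_real y) n = of_real t" by (rule Reals_cases)
  show ?case
    unfolding angle_approx.simps t axial_defect_def
    using mean_slope_real axial_real[of t] by (metis Reals_diff Reals_divide Reals_of_real)
qed simp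

end

definition radius :: "nat \<Rightarrow> real \<Rightarrow> real \<Rightarrow> real" where
  "radius l s x = Re (profile l (of_real s) (of_real x))"

definition phase :: "nat \<Rightarrow> real \<Rightarrow> real \<Rightarrow> real" where
  "phase l s x = Re (angle l (of_real s) (of_real x))"

definition mean_curv :: "nat \<Rightarrow> real \<Rightarrow> real" where
  "mean_curv l s = real l * Re (mean_slope (of_real s))"

context
  fixes s :: real and l :: nat
  assumes s: "\<bar>s\<bar> < 1 / 1000" and l: "1 \<le> l"
begin

lemma real_strip: "complex_of_real x \<in> strip (1 / (2 * real l))"
  using l by (simp add: strip_def)

lemma mean_curv_pos: "0 < mean_curv l s"
  using l mean_slope_bounds(3)[OF s_disc[OF s]] by (auto simp: mean_curv_def)

lemma mean_curv_complex: "of_nat l * mean_slope (of_real s) = of_real (mean_curv l s)"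
  by (subst mean_slope_real[OF s]) (simp add: mean_curv_def)

lemma angle_real: "angle l (of_real s) (of_real x) = of_real (phase l s x)"
proof -
  have "angle l (of_real s) (of_real x) \<in> \<real>"
    using closed_sequentially[OF closed_complex_Reals _ angle_approx_tendsto[OF s_disc[OF s] l real_strip]]
      angle_approx_real[OF s, of "real l * x"] by simp
  then show ?thesis by (simp add: phase_def)
qed

lemma profile_real:
  "profile l (of_real s) (of_real x) =
     of_real (sqrt (1 + s\<^sup>2 + 2 * (s * cos (phase l s x))) / mean_curv l s)"
  unfolding profile_def angle_real mean_curv_complex rad_of_real[OF s]
  using rad_real_pos[OF s, of "phase l s x"] by (simp add: csqrt_of_real_nonneg)

lemma radius_eq: "radius l s x = sqrt (1 + s\<^sup>2 + 2 * (s * cos (phase l s x))) / mean_curv l s"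
  by (simp add: radius_def profile_real)

lemma radius_pos: "0 < radius l s x"
  using rad_real_pos[OF s] mean_curv_pos by (simp add: radius_eq)

text \<open>Injectivity of the axial position in recognizable form: any real t at the right axial
  position is the phase. This is how the phase of a given solution is later identified with that of
  the family.\<close>

lemma phaseI:
  assumes "axial (of_real s) (of_real t) = of_real (mean_curv l s * x)"
  shows "phase l s x = t"
proof -
  have "angle l (of_real s) (of_real x) = of_real t"
    using assms by (intro angle_eqI s_disc s)
      (simp_all add: strip_def mult_ac flip: mean_curv_complex)
  then show ?thesis by (simp add: phase_def)
qed

lemma phase_0: "phase l s 0 = 0"
  by (rule phaseI) (simp add: axial_0)

text \<open>At phases 0 and pi the squared radius in units of the inverse mean curvature is (1 +
  s)^2 and (1 - s)^2. Phase pi is attained where the axial position says so.\<close>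

lemma radius_nonconstant:
  assumes "s \<noteq> 0"
  shows "\<exists>x. radius l s x \<noteq> radius l s 0"
proof -
  obtain y where y: "axial (of_real s) (of_real pi) = of_real y"
    using axial_real[OF s] by (rule Reals_cases)
  have "phase l s (y / mean_curv l s) = pi"
    using mean_curv_pos by (intro phaseI) (simp add: y)
  then have "radius l s (y / mean_curv l s) = sqrt (1 + s\<^sup>2 + 2 * (s * cos pi)) / mean_curv l s"
    by (simp only: radius_eq)
  moreover have "radius l s 0 = sqrt (1 + s\<^sup>2 + 2 * (s * cos 0)) / mean_curv l s"
    by (simp only: radius_eq phase_0)
  ultimately show ?thesis
    using assms mean_curv_pos by (intro exI[of _ "y / mean_curv l s"]) simp
qed

abbreviation "scaled_radius x \<equiv> sqrt (1 + s\<^sup>2 + 2 * (s * cos (phase l s x)))"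
abbreviation "scaled_slope x \<equiv> 1 + s * cos (phase l s x)"

text \<open>Holomorphy of \<open>angle\<close> gives some derivative d. Differentiating the axial
  position of the angle by the chain rule, and as the linear function it equals, determines
  d.\<close>

lemma phase_has_derivative:
  "(phase l s has_real_derivative mean_curv l s * scaled_radius x / scaled_slope x) (at x)"
proof -
  let ?S = "strip (1 / (2 * real l))" and ?w = "angle l (of_real s)"
  have "?w holomorphic_on ?S"
    using angle_holomorphic[of "\<lambda>_. of_real s" ?S "\<lambda>x. x" l] s_disc[OF s] l open_strip by auto
  then obtain d where d: "(?w has_field_derivative d) (at (of_real x))"
    using real_strip open_strip unfolding holomorphic_on_open[OF open_strip] by blast
  have "((\<lambda>z. axial (of_real s) (?w z)) has_field_derivative
      slope (of_real s) (?w (of_real x)) * d) (at (of_real x))"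
    by (rule DERIV_chain2[OF axial_has_field_derivative[OF s_disc[OF s] angle_spec(1)[OF s_disc[OF s] l real_strip]] d])
  moreover have "((\<lambda>z. axial (of_real s) (?w z)) has_field_derivative of_real (mean_curv l s)) (at (of_real x))"
  proof (rule has_field_derivative_transform_within_open[OF _ open_strip real_strip])
    show "((\<lambda>z. of_real (mean_curv l s) * z) has_field_derivative of_real (mean_curv l s)) (at (of_real x))"
      by (auto intro!: derivative_eq_intros)
    show "of_real (mean_curv l s) * z = axial (of_real s) (?w z)" if "z \<in> ?S" for z
      using angle_spec(2)[OF s_disc[OF s] l that] by (simp flip: mean_curv_complex add: mult_ac)
  qed
  ultimately have *: "slope (of_real s) (?w (of_real x)) * d = of_real (mean_curv l s)"
    by (rule DERIV_unique)
  define q where "q = scaled_slope x / scaled_radius x"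
  have "complex_of_real q * d = of_real (mean_curv l s)"
    using * unfolding angle_real slope_of_real[OF s] q_def .
  moreover have "q \<noteq> 0"
    using rad_real_pos[OF s, of "phase l s x"] slope_numerator_pos[OF s, of "phase l s x"]
    unfolding q_def by simp
  ultimately have "d = of_real (mean_curv l s / q)" by (simp add: field_simps)
  then have "d = of_real (mean_curv l s * scaled_radius x / scaled_slope x)" by (simp add: q_def)
  with has_real_derivative_Re[OF d] show ?thesis by (simp add: phase_def[abs_def])
qed

lemma deriv_radius: "deriv (radius l s) = (\<lambda>x. - s * sin (phase l s x) / scaled_slope x)"
proof
  fix x
  note pos = rad_real_pos[OF s, of "phase l s x"] slope_numerator_pos[OF s, of "phase l s x"] mean_curv_pos
  have "((\<lambda>x. 1 + s\<^sup>2 + 2 * (s * cos (phase l s x))) has_real_derivative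
      2 * (s * (- sin (phase l s x) * (mean_curv l s * scaled_radius x / scaled_slope x)))) (at x)"
    by (auto intro!: derivative_eq_intros phase_has_derivative)
  from DERIV_cdivide[OF DERIV_chain2[OF DERIV_real_sqrt[OF pos(1)] this], of "mean_curv l s"]
  have "((\<lambda>x. scaled_radius x / mean_curv l s) has_real_derivative
      inverse (scaled_radius x) / 2 * (2 * (s * (- sin (phase l s x) * (mean_curv l s * scaled_radius x / scaled_slope x)))) / mean_curv l s) (at x)" .
  also have "inverse (scaled_radius x) / 2 * (2 * (s * (- sin (phase l s x) * (mean_curv l s * scaled_radius x / scaled_slope x)))) / mean_curv l s
      = - s * sin (phase l s x) / scaled_slope x"
    using pos by simp
  finally have "((\<lambda>x. scaled_radius x / mean_curv l s) has_real_derivative - s * sin (phase l s x) / scaled_slope x) (at x)" .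
  then show "deriv (radius l s) x = - s * sin (phase l s x) / scaled_slope x"
    by (intro DERIV_imp_deriv) (simp add: radius_eq[abs_def])
qed

lemma deriv_deriv_radius:
  "deriv (deriv (radius l s)) x = - mean_curv l s * scaled_radius x * (s * cos (phase l s x) + s\<^sup>2) / scaled_slope x ^ 3"
proof -
  let ?p = "phase l s x" and ?h = "mean_curv l s"
  have c: "scaled_slope x \<noteq> 0" using slope_numerator_pos[OF s, of ?p] by simp
  have sc: "sin ?p * sin ?p = 1 - cos ?p * cos ?p"
    using sin_cos_squared_add[of ?p] by (simp add: power2_eq_square)
  define k where "k = ?h * scaled_radius x / scaled_slope x"
  have ph: "(phase l s has_real_derivative k) (at x)" unfolding k_def by (rule phase_has_derivative)
  have "((\<lambda>x. - s * sin (phase l s x) / scaled_slope x) has_real_derivative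
     ((- s * (cos ?p * k)) * scaled_slope x - (- s * sin ?p) * (s * (- sin ?p * k))) / (scaled_slope x * scaled_slope x)) (at x)"
    using c by (intro DERIV_divide) (auto intro!: derivative_eq_intros ph)
  moreover have "(- s * (cos ?p * k)) * scaled_slope x - (- s * sin ?p) * (s * (- sin ?p * k))
      = - k * (s * cos ?p + s\<^sup>2 * (cos ?p * cos ?p + sin ?p * sin ?p))"
    by algebra
  ultimately have "((\<lambda>x. - s * sin (phase l s x) / scaled_slope x) has_real_derivative
     - (?h * scaled_radius x / scaled_slope x) * (s * cos ?p + s\<^sup>2) / (scaled_slope x * scaled_slope x)) (at x)"
    by (simp only: sc k_def) simp
  then show ?thesis
    unfolding deriv_radius by (intro DERIV_imp_deriv) (simp add: power3_eq_cube mult_ac)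
qed

text \<open>Everything rests on (1 + s cos)^2 + (s sin)^2 = 1 + s^2 + 2 s cos: it turns sqrt(1 +
  r'^2) into \<open>scaled_radius x / scaled_slope x\<close>. The numerators of the two curvature
  terms, 1 + s cos and s cos + s^2, then add up to the squared scaled radius, which cancels.\<close>

lemma curvature_radius: "curvature (radius l s) = (\<lambda>_. mean_curv l s)"
proof
  fix x
  let ?p = "phase l s x" and ?h = "mean_curv l s"
  note pos = rad_real_pos[OF s, of ?p] slope_numerator_pos[OF s, of ?p] mean_curv_pos
  have R2: "scaled_radius x * scaled_radius x = 1 + s\<^sup>2 + 2 * (s * cos ?p)" using pos by simp
  have "(scaled_slope x)\<^sup>2 + (s * sin ?p)\<^sup>2 = 1 + s\<^sup>2 + 2 * (s * cos ?p)"
    unfolding power_mult_distrib sin_squared_eq by (simp add: power2_eq_square algebra_simps)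
  then have "(scaled_slope x)\<^sup>2 + (s * sin ?p)\<^sup>2 = (scaled_radius x)\<^sup>2" using R2 by (simp add: power2_eq_square)
  then have S: "1 + (deriv (radius l s) x)\<^sup>2 = (scaled_radius x / scaled_slope x)\<^sup>2"
    using pos unfolding deriv_radius by (simp add: power_divide field_simps)
  have Rc: "0 < scaled_radius x / scaled_slope x" using pos by simp
  have "((scaled_radius x / scaled_slope x)\<^sup>2) powr (3 / 2) = (scaled_radius x / scaled_slope x) powr 3"
    using Rc by (simp add: powr_powr flip: powr_numeral)
  then have P: "((scaled_radius x / scaled_slope x)\<^sup>2) powr (3 / 2) = (scaled_radius x / scaled_slope x) ^ 3"
    using Rc by simp
  have sq: "sqrt ((scaled_radius x / scaled_slope x)\<^sup>2) = scaled_radius x / scaled_slope x" using Rc by (simp only: real_sqrt_abs abs_of_pos)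
  have "curvature (radius l s) x = 1 / (scaled_radius x / ?h * (scaled_radius x / scaled_slope x))
      - (- ?h * scaled_radius x * (s * cos ?p + s\<^sup>2) / scaled_slope x ^ 3) / (scaled_radius x / scaled_slope x) ^ 3"
    unfolding curvature_def S deriv_deriv_radius P sq by (simp only: radius_eq)
  also have "1 / (scaled_radius x / ?h * (scaled_radius x / scaled_slope x)) = ?h * scaled_slope x / (scaled_radius x * scaled_radius x)" using pos by simp
  also have "(- ?h * scaled_radius x * (s * cos ?p + s\<^sup>2) / scaled_slope x ^ 3) / (scaled_radius x / scaled_slope x) ^ 3
      = - ?h * (s * cos ?p + s\<^sup>2) / (scaled_radius x * scaled_radius x)"
    using pos(1,2) by (simp add: power_divide power3_eq_cube del: real_sqrt_mult_self)
  also have "?h * scaled_slope x / (scaled_radius x * scaled_radius x) - - ?h * (s * cos ?p + s\<^sup>2) / (scaled_radius x * scaled_radius x)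
      = ?h * (1 + s\<^sup>2 + 2 * (s * cos ?p)) / (scaled_radius x * scaled_radius x)"
    by (simp add: algebra_simps flip: add_divide_distrib)
  also have "\<dots> = ?h" unfolding R2 using pos by simp
  finally show "curvature (radius l s) x = mean_curv l s" .
qed

lemma G_radius: "G (radius l s) = (\<lambda>_. 0)"
  by (simp add: G_def curvature_radius)

end

subsection \<open>Constant mean curvature profiles\<close>

lemma has_real_derivative_sqrt_1_square:
  assumes "(p has_real_derivative q) (at x)"
  shows "((\<lambda>x. sqrt (1 + (p x)\<^sup>2)) has_real_derivative p x * q / sqrt (1 + (p x)\<^sup>2)) (at x)"
proof -
  have pos: "0 < 1 + (p x)\<^sup>2" by (simp add: add_pos_nonneg)
  have "((\<lambda>x. 1 + (p x)\<^sup>2) has_real_derivative 2 * p x * q) (at x)"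
    using assms by (auto intro!: derivative_eq_intros)
  from DERIV_chain2[OF DERIV_real_sqrt[OF pos] this] show ?thesis
    by (simp add: field_simps)
qed

lemma monotone_periodic_False:
  fixes f :: "real \<Rightarrow> real"
  assumes "\<And>x. (f has_real_derivative f' x) (at x)" "\<And>x. 0 < f' x" "f (2 * pi) = f 0"
  shows False
proof -
  have "f 0 < f (2 * pi)"
    by (rule DERIV_pos_imp_increasing) (use assms in auto)
  then show False using assms(3) by simp
qed

text \<open>Multiplying f by k makes its derivative k^2 g positive whatever the sign of a nonzero k,
  which contradicts equal values at 0 and 2 pi.\<close>

lemma deriv_sign_const_periodic:
  fixes f :: "real \<Rightarrow> real"
  assumes f: "\<And>x. (f has_real_derivative k * g x) (at x)" and g: "\<And>x. 0 < g x"
    and per: "f (2 * pi) = f 0"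
  shows "k = 0"
proof (rule ccontr)
  assume "k \<noteq> 0"
  have 1: "((\<lambda>x. k * f x) has_real_derivative k * (k * g x)) (at x)" for x
    using DERIV_cmult[OF f] .
  have 2: "0 < k * (k * g x)" for x
  proof -
    have "k * (k * g x) = k\<^sup>2 * g x" by (simp add: power2_eq_square)
    moreover have "0 < k\<^sup>2 * g x" using g[of x] \<open>k \<noteq> 0\<close> by simp
    ultimately show ?thesis by linarith
  qed
  show False by (rule monotone_periodic_False[OF 1 2]) (simp add: per)
qed

lemma constant_of_zero_derivative:
  fixes f :: "real \<Rightarrow> real"
  assumes "\<And>x. (f has_real_derivative 0) (at x)"
  shows "f x = f 0"
  using DERIV_isconst_all[of f x 0] assms by blast

text \<open>Both integration constants of \<open>G r = const\<close> vanish because a periodic function has no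
  derivative of constant sign.\<close>

lemma curvature_constant:
  assumes per: "circle_fun r" and pos: "\<And>x. 0 < r x"
    and diff: "\<And>j x. j < 4 \<Longrightarrow> (deriv ^^ j) r differentiable (at x)"
    and P0G: "P0 (G r) = (\<lambda>_. 0)"
  shows "\<exists>h. \<forall>x. curvature r x = h"
proof -
  define p where "p = deriv r"
  define q where "q = deriv p"
  define S where "S = (\<lambda>x. sqrt (1 + (p x)\<^sup>2))"
  have r: "(r has_real_derivative p x) (at x)" for x
    using diff[of 0 x] by (simp add: p_def DERIV_deriv_iff_real_differentiable)
  have p: "(p has_real_derivative q x) (at x)" for x
    using diff[of 1 x] by (simp add: p_def q_def DERIV_deriv_iff_real_differentiable)
  have q: "(q has_real_derivative deriv q x) (at x)" for x
    using diff[of 2 x] by (simp add: p_def q_def DERIV_deriv_iff_real_differentiable numeral_2_eq_2)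
  have q': "(deriv q has_real_derivative deriv (deriv q) x) (at x)" for x
    using diff[of 3 x] by (simp add: p_def q_def DERIV_deriv_iff_real_differentiable numeral_3_eq_3)
  have S: "(S has_real_derivative p x * q x / S x) (at x)" for x
    unfolding S_def using has_real_derivative_sqrt_1_square[OF p] .
  have Spos: "0 < S x" for x by (simp add: S_def add_pos_nonneg)
  have S3: "(1 + (p x)\<^sup>2) powr (3 / 2) = S x ^ 3" for x
  proof -
    have "0 < 1 + (p x)\<^sup>2" by (simp add: add_pos_nonneg)
    then have "S x ^ 3 = ((1 + (p x)\<^sup>2) powr (1 / 2)) powr 3"
      by (simp add: S_def powr_half_sqrt)
    then show ?thesis by (simp add: powr_powr)
  qed
  have curv: "curvature r = (\<lambda>x. 1 / (r x * S x) - q x / S x ^ 3)"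
    unfolding curvature_def p_def[symmetric] q_def[symmetric] S3 by (simp add: S_def)
  define K where "K = (\<lambda>x. - (p x * S x + r x * (p x * q x / S x)) / (r x * S x)\<^sup>2
      - (deriv q x * S x ^ 3 - q x * (3 * S x ^ 2 * (p x * q x / S x))) / (S x ^ 3)\<^sup>2)"
  have K: "(curvature r has_real_derivative K x) (at x)" for x
    unfolding curv K_def using pos[of x] Spos[of x]
    by (auto intro!: derivative_eq_intros r p q S simp: power2_eq_square mult_ac)
  then have dcurv: "deriv (curvature r) = K" using DERIV_imp_deriv by blast
  \<comment> \<open>The flux inside the outer derivative of \<open>G\<close>: since G = \<Phi>' / r,
    vanishing of the mean-free part of G says that \<Phi>' is a constant multiple of the positive
    function r.\<close>
  define \<Phi> where "\<Phi> = (\<lambda>y. r y / S y * K y)"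
  have "\<Phi> differentiable (at x)" for x
  proof -
    have d: "r differentiable (at x)" "p differentiable (at x)" "q differentiable (at x)"
      "S differentiable (at x)" "deriv q differentiable (at x)"
      using r p q q' S unfolding real_differentiable_def by blast+
    show ?thesis
      unfolding \<Phi>_def K_def using pos[of x] Spos[of x] by (auto intro!: derivative_intros d)
  qed
  then have \<Phi>: "(\<Phi> has_real_derivative deriv \<Phi> x) (at x)" for x
    by (simp add: DERIV_deriv_iff_real_differentiable)
  have G: "G r x = 1 / r x * deriv \<Phi> x" for x
    unfolding G_def dcurv \<Phi>_def by (simp add: S_def p_def)
  define c where "c = 1 / (2 * pi) * integral {-pi..pi} (G r)"
  have "G r x = c" for x using fun_cong[OF P0G, of x] by (simp add: P0_def c_def)
  then have \<Phi>c: "deriv \<Phi> x = c * r x" for x using G[of x] pos[of x] by (simp add: field_simps)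
  have perp: "circle_fun p" "circle_fun q" "circle_fun (deriv q)"
    using per by (auto simp: p_def q_def intro!: circle_fun_deriv)
  have circ0: "f (2 * pi) = f 0" if "circle_fun f" for f
    using that unfolding circle_fun_def by (metis add_0)
  have perK: "K (2 * pi) = K 0" "S (2 * pi) = S 0" "curvature r (2 * pi) = curvature r 0"
    unfolding K_def S_def curv using perp per by (simp_all add: circ0)
  have "c = 0"
  proof (rule deriv_sign_const_periodic[of \<Phi> _ r, OF _ pos])
    show "(\<Phi> has_real_derivative c * r x) (at x)" for x using \<Phi>[of x] by (simp add: \<Phi>c)
    show "\<Phi> (2 * pi) = \<Phi> 0" unfolding \<Phi>_def using perK per by (simp add: circ0)
  qed
  then have "(\<Phi> has_real_derivative 0) (at x)" for x using \<Phi>[of x] \<Phi>c[of x] by simp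
  then have \<Phi>0: "\<Phi> x = \<Phi> 0" for x by (rule constant_of_zero_derivative)
  \<comment> \<open>With the flux constant, the derivative of the curvature is that constant times
    the positive function S / r, so the sign argument applies a second time.\<close>
  have K\<Phi>: "K x = \<Phi> 0 * (S x / r x)" for x
  proof -
    have "r x / S x * K x = \<Phi> 0" unfolding \<Phi>0[of x, symmetric] by (simp add: \<Phi>_def)
    then show ?thesis using pos[of x] Spos[of x] by (simp add: field_simps)
  qed
  have "\<Phi> 0 = 0"
  proof (rule deriv_sign_const_periodic[of "curvature r" _ "\<lambda>x. S x / r x"])
    show "(curvature r has_real_derivative \<Phi> 0 * (S x / r x)) (at x)" for x
      using K[of x] unfolding K\<Phi>[of x] .
  qed (use pos Spos perK in auto)
  then have "(curvature r has_real_derivative 0) (at x)" for x using K[of x] by (simp add: K\<Phi>)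
  then have "curvature r x = curvature r 0" for x by (rule constant_of_zero_derivative)
  then show ?thesis by blast
qed

lemma global_antiderivative:
  fixes f :: "real \<Rightarrow> real"
  assumes "continuous_on UNIV f"
  obtains F where "\<And>x. (F has_real_derivative f x) (at x)" "F 0 = 0"
proof -
  have "\<exists>F. \<forall>x::real. -\<infinity> < ereal x \<longrightarrow> ereal x < \<infinity> \<longrightarrow> (F has_vector_derivative f x) (at x)"
    using assms by (intro einterval_antiderivative) (auto simp: continuous_on_eq_continuous_at)
  then obtain F where F: "\<And>x. (F has_real_derivative f x) (at x)"
    by (auto simp: has_real_derivative_iff_has_vector_derivative)
  have "((\<lambda>x. F x - F 0) has_real_derivative f x) (at x)" for x
    using DERIV_diff[OF F DERIV_const] by simp
  then show ?thesis using that[of "\<lambda>x. F x - F 0"] by simp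
qed

text \<open>With the phase \<open>\<tau>\<close> equal to \<open>h\<close> times the arc length, the vector
  \<open>(u, z) = (h r / S - 1, - h r r' / S)\<close>, \<open>S = sqrt (1 + r'\<^sup>2)\<close>, solves the linear system
  \<open>u' = - \<tau>' z\<close>, \<open>z' = \<tau>' u\<close>; hence it rotates by the angle \<open>\<tau>\<close>.\<close>

lemma cmc_phase:
  assumes pos: "\<And>x. 0 < r x" and r0: "deriv r 0 = 0"
    and r: "\<And>x. (r has_real_derivative deriv r x) (at x)"
    and p: "\<And>x. (deriv r has_real_derivative deriv (deriv r) x) (at x)"
    and curv: "\<And>x. curvature r x = h"
  defines "S \<equiv> \<lambda>x. sqrt (1 + (deriv r x)\<^sup>2)" and "s \<equiv> h * r 0 - 1"
  obtains \<tau> where "\<And>x. (\<tau> has_real_derivative h * S x) (at x)" "\<tau> 0 = 0"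
    "\<And>x. h * r x / S x = 1 + s * cos (\<tau> x)" "\<And>x. h * r x * deriv r x / S x = - s * sin (\<tau> x)"
proof -
  define p where "p = deriv r"
  define q where "q = deriv p"
  have r: "(r has_real_derivative p x) (at x)" for x using r by (simp add: p_def)
  have p: "(p has_real_derivative q x) (at x)" for x using p by (simp add: p_def q_def)
  have S: "(S has_real_derivative p x * q x / S x) (at x)" for x
    unfolding S_def p_def[symmetric] using has_real_derivative_sqrt_1_square[OF p] .
  have Spos: "0 < S x" for x by (simp add: S_def add_pos_nonneg)
  have S2: "S x ^ 2 = 1 + (p x)\<^sup>2" for x by (simp add: S_def p_def)
  have S3: "(1 + (p x)\<^sup>2) powr (3 / 2) = S x ^ 3" for x
  proof -
    have "0 < 1 + (p x)\<^sup>2" by (simp add: add_pos_nonneg)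
    then have "S x ^ 3 = ((1 + (p x)\<^sup>2) powr (1 / 2)) powr 3"
      by (simp add: S_def p_def powr_half_sqrt)
    then show ?thesis by (simp add: powr_powr)
  qed
  \<comment> \<open>The curvature equation solved for r''. Inserting it is what closes the system
    for u and z.\<close>
  have q: "q x = S x ^ 2 / r x - h * S x ^ 3" for x
  proof -
    have "1 / (r x * S x) - q x / S x ^ 3 = h"
      using curv[of x] unfolding curvature_def p_def[symmetric] q_def[symmetric] S3
      by (simp add: S_def p_def)
    then have "(1 / (r x * S x) - q x / S x ^ 3) * S x ^ 3 = h * S x ^ 3" by simp
    then show ?thesis using pos[of x] Spos[of x]
      by (simp add: left_diff_distrib power3_eq_cube power2_eq_square)
  qed
  have "continuous_on UNIV (\<lambda>x. h * S x)"
    using DERIV_isCont[OF S] by (intro continuous_at_imp_continuous_on ballI continuous_intros)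
  then obtain \<tau> where \<tau>: "\<And>x. (\<tau> has_real_derivative h * S x) (at x)" and \<tau>0: "\<tau> 0 = 0"
    using global_antiderivative by blast
  define u where "u = (\<lambda>x. h * r x / S x - 1)"
  define z where "z = (\<lambda>x. - (h * r x * p x / S x))"
  have u: "(u has_real_derivative - (h * S x) * z x) (at x)" for x
  proof -
    have "(u has_real_derivative (h * p x * S x - h * r x * (p x * q x / S x)) / (S x * S x)) (at x)"
      unfolding u_def using Spos[of x] by (auto intro!: derivative_eq_intros r S)
    moreover have "(h * p x * S x - h * r x * (p x * q x / S x)) / (S x * S x) = - (h * S x) * z x"
      unfolding q z_def using Spos[of x] pos[of x]
      by (simp add: field_simps power2_eq_square power3_eq_cube)
    ultimately show ?thesis by simp
  qed
  have z: "(z has_real_derivative h * S x * u x) (at x)" for x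
  proof -
    have "(z has_real_derivative
        - (((h * p x * p x + h * r x * q x) * S x - h * r x * p x * (p x * q x / S x)) / (S x * S x))) (at x)"
      unfolding z_def using Spos[of x]
      by (auto intro!: derivative_eq_intros r p S simp: algebra_simps)
    moreover have "(h * p x * p x + h * r x * q x) * S x - h * r x * p x * (p x * q x / S x)
        = h * ((p x)\<^sup>2 * S x ^ 2 + r x * q x * (S x ^ 2 - (p x)\<^sup>2)) / S x"
      using Spos[of x] by (simp add: field_simps power2_eq_square)
    moreover have "r x * q x = S x ^ 2 - h * r x * S x ^ 3"
      unfolding q using pos[of x] by (simp add: field_simps)
    moreover have "S x ^ 2 - (p x)\<^sup>2 = 1" "(p x)\<^sup>2 = S x ^ 2 - 1" using S2[of x] by auto
    moreover have "- (h * ((S x ^ 2 - 1) * S x ^ 2 + (S x ^ 2 - h * r x * S x ^ 3) * 1) / S x / (S x * S x))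
        = h * S x * u x"
      unfolding u_def using Spos[of x] by (simp add: field_simps power2_eq_square power3_eq_cube)
    ultimately show ?thesis by simp
  qed
  \<comment> \<open>The vector (u, z) turned back by the angle \<tau>; both components are constant.
    Their values at 0 are s and 0, because r'(0) = 0.\<close>
  define v where "v = (\<lambda>x. u x * cos (\<tau> x) + z x * sin (\<tau> x))"
  define w where "w = (\<lambda>x. z x * cos (\<tau> x) - u x * sin (\<tau> x))"
  have "(v has_real_derivative 0) (at x)" for x
    unfolding v_def by (auto intro!: derivative_eq_intros u z \<tau> simp: algebra_simps)
  then have "v x = v 0" for x by (rule constant_of_zero_derivative)
  moreover have "S 0 = 1" using r0 by (simp add: S_def)
  ultimately have v: "u x * cos (\<tau> x) + z x * sin (\<tau> x) = s" for x
    by (simp add: v_def u_def z_def \<tau>0 s_def p_def r0)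
  have "(w has_real_derivative 0) (at x)" for x
    unfolding w_def by (auto intro!: derivative_eq_intros u z \<tau> simp: algebra_simps)
  then have "w x = w 0" for x by (rule constant_of_zero_derivative)
  then have w: "z x * cos (\<tau> x) - u x * sin (\<tau> x) = 0" for x
    by (simp add: w_def z_def \<tau>0 p_def r0)
  have sc: "cos t * cos t + sin t * sin t = 1" for t :: real
    using sin_cos_squared_add[of t] by (simp add: power2_eq_square)
  have us: "u x = s * cos (\<tau> x)" for x
  proof -
    have "s * cos (\<tau> x) - 0 * sin (\<tau> x) = u x * (cos (\<tau> x) * cos (\<tau> x) + sin (\<tau> x) * sin (\<tau> x))"
      unfolding v[of x, symmetric] w[of x, symmetric] by algebra
    then show ?thesis by (simp add: sc)
  qed
  have zs: "z x = s * sin (\<tau> x)" for x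
  proof -
    have "s * sin (\<tau> x) + 0 * cos (\<tau> x) = z x * (cos (\<tau> x) * cos (\<tau> x) + sin (\<tau> x) * sin (\<tau> x))"
      unfolding v[of x, symmetric] w[of x, symmetric] by algebra
    then show ?thesis by (simp add: sc)
  qed
  have "h * r x / S x = 1 + s * cos (\<tau> x)" for x
    using us[of x] by (simp add: u_def)
  moreover have "h * r x * deriv r x / S x = - s * sin (\<tau> x)" for x
    using zs[of x] unfolding z_def p_def by linarith
  ultimately show ?thesis by (rule that[OF \<tau> \<tau>0])
qed

text \<open>The phase \<tau> of the solution satisfies the same relation between axial position and
  phase as the explicit family, so periodicity in x becomes a condition on \<tau> at 2 pi that makes
  h an integer multiple of the mean slope. For s = 0 the radius is constant.\<close>

lemma cmc_is_delaunay:
  assumes per: "circle_fun r" and pos: "\<And>x. 0 < r x" and r0: "deriv r 0 = 0"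
    and r: "\<And>x. (r has_real_derivative deriv r x) (at x)"
    and p: "\<And>x. (deriv r has_real_derivative deriv (deriv r) x) (at x)"
    and curv: "\<And>x. curvature r x = h" and h: "0 < h"
  defines "s \<equiv> h * r 0 - 1"
  assumes s: "\<bar>s\<bar> < 1 / 1000"
  shows "(\<forall>x. r x = r 0) \<or> (\<exists>l\<ge>1. s \<noteq> 0 \<and> h = mean_curv l s \<and> r = radius l s)"
proof -
  define S where "S = (\<lambda>x. sqrt (1 + (deriv r x)\<^sup>2))"
  obtain \<tau> where \<tau>: "\<And>x. (\<tau> has_real_derivative h * S x) (at x)" and \<tau>0: "\<tau> 0 = 0"
    and c: "\<And>x. h * r x / S x = 1 + s * cos (\<tau> x)"
    and sn: "\<And>x. h * r x * deriv r x / S x = - s * sin (\<tau> x)"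
    using cmc_phase[OF pos r0 r p curv] unfolding S_def s_def by blast
  have Spos: "0 < S x" for x by (simp add: S_def add_pos_nonneg)
  have S2: "S x ^ 2 = 1 + (deriv r x)\<^sup>2" for x by (simp add: S_def)
  have rad2: "(h * r x)\<^sup>2 = 1 + s\<^sup>2 + 2 * (s * cos (\<tau> x))" for x
  proof -
    have "(h * r x / S x)\<^sup>2 + (h * r x * deriv r x / S x)\<^sup>2 = (h * r x)\<^sup>2 * S x ^ 2 / S x ^ 2"
      unfolding S2[of x] by (simp add: power_divide power_mult_distrib algebra_simps S2 flip: add_divide_distrib)
    also have "\<dots> = (h * r x)\<^sup>2" using Spos[of x] by simp
    finally have "(h * r x)\<^sup>2 = (1 + s * cos (\<tau> x))\<^sup>2 + (- s * sin (\<tau> x))\<^sup>2"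
      unfolding c sn by simp
    also have "\<dots> = 1 + s\<^sup>2 + 2 * (s * cos (\<tau> x))"
      unfolding power_mult_distrib sin_squared_eq by (simp add: power2_eq_square algebra_simps)
    finally show ?thesis .
  qed
  have hr: "h * r x = sqrt (1 + s\<^sup>2 + 2 * (s * cos (\<tau> x)))" for x
    using rad2[of x] h pos[of x] by (intro real_sqrt_unique[symmetric]) auto
  show ?thesis
  proof (cases "s = 0")
    case True
    have "r x = 1 / h" for x using hr[of x] True h by (simp add: field_simps)
    then show ?thesis by simp
  next
    case False
    \<comment> \<open>Along the solution the slope equals 1 / S while \<tau>' = h S, so the axial
      position of the phase grows at the constant rate h.\<close>
    have "((\<lambda>x. axial (of_real s) (of_real (\<tau> x)) - of_real (h * x)) has_vector_derivative 0) (at x)" for x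
    proof -
      note pos' = slope_numerator_pos[OF s, of "\<tau> x"]
      have slope: "slope (of_real s) (of_real (\<tau> x)) = of_real (1 / S x)"
      proof -
        have "(1 + s * cos (\<tau> x)) / sqrt (1 + s\<^sup>2 + 2 * (s * cos (\<tau> x))) = 1 / S x"
          unfolding c[symmetric] hr[symmetric] using h pos[of x] by simp
        then show ?thesis unfolding slope_of_real[OF s] by simp
      qed
      have "((\<lambda>x. complex_of_real (\<tau> x)) has_vector_derivative of_real (h * S x)) (at x)"
        using \<tau>[of x] by (intro has_vector_derivative_of_real) (simp add: has_real_derivative_iff_has_vector_derivative)
      moreover have "(axial (of_real s) has_field_derivative of_real (1 / S x)) (at (of_real (\<tau> x)))"
        using axial_has_field_derivative[OF s_disc[OF s], of "of_real (\<tau> x)"]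
        by (simp add: slope strip_def)
      ultimately have "(axial (of_real s) \<circ> (\<lambda>x. of_real (\<tau> x)) has_vector_derivative
          of_real (h * S x) * of_real (1 / S x)) (at x)"
        by (intro field_vector_diff_chain_at)
      moreover have "complex_of_real (h * S x) * of_real (1 / S x) = of_real h"
      proof -
        have "h * S x * (1 / S x) = h" using Spos[of x] by simp
        then show ?thesis by (metis of_real_mult)
      qed
      moreover have "((\<lambda>x. complex_of_real (h * x)) has_vector_derivative of_real h) (at x)"
        by (intro has_vector_derivative_of_real)
          (auto simp flip: has_real_derivative_iff_has_vector_derivative intro!: derivative_eq_intros)
      ultimately show ?thesis
        using has_vector_derivative_diff[of "\<lambda>x. axial (of_real s) (of_real (\<tau> x))" "of_real h" "at x"
          "\<lambda>x. of_real (h * x)" "of_real h"] by (simp add: o_def)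
    qed
    then obtain k where k: "\<And>x. axial (of_real s) (of_real (\<tau> x)) - of_real (h * x) = k"
      using has_vector_derivative_zero_constant[of UNIV
          "\<lambda>x. axial (of_real s) (of_real (\<tau> x)) - of_real (h * x)"] by auto
    have "k = 0" using k[of 0] by (simp add: \<tau>0 axial_0)
    then have axial: "axial (of_real s) (of_real (\<tau> x)) = of_real (h * x)" for x
      using k[of x] by simp
    have "r (2 * pi) = r 0" using per unfolding circle_fun_def by (metis add_0)
    then have "s * cos (\<tau> (2 * pi)) = s"
      using rad2[of "2 * pi"] rad2[of 0] by (simp add: \<tau>0)
    then have "cos (\<tau> (2 * pi)) = 1" using False by simp
    then obtain m :: int where m: "\<tau> (2 * pi) = 2 * pi * of_int m"
      using cos_one_2pi_int by (auto simp: mult_ac)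
    have "of_real (h * (2 * pi)) = of_real (2 * pi * of_int m) * mean_slope (of_real s)"
      using axial[of "2 * pi"] axial_shift_int[OF s_disc[OF s], of 0 m] unfolding m
      by (simp add: strip_def axial_0)
    then have "h * (2 * pi) = 2 * pi * of_int m * Re (mean_slope (of_real s))"
      by (subst (asm) mean_slope_real[OF s]) (simp only: of_real_mult[symmetric] of_real_eq_iff)
    then have hm: "h = of_int m * Re (mean_slope (of_real s))" by simp
    have "0 < Re (mean_slope (of_real s))" using mean_slope_bounds(3)[OF s_disc[OF s]] by simp
    then have "0 < m" using hm h by (simp add: zero_less_mult_iff)
    define l where "l = nat m"
    have l: "1 \<le> l" "of_int m = real l" using \<open>0 < m\<close> by (auto simp: l_def)
    have hl: "h = mean_curv l s" using hm l by (simp add: mean_curv_def)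
    have "phase l s x = \<tau> x" for x using axial[of x] by (intro phaseI s l) (simp add: hl)
    then have "r x = radius l s x" for x
      using hr[of x] h unfolding radius_eq[OF s l(1)] hl[symmetric] by (simp add: field_simps)
    then show ?thesis using l hl False by blast
  qed
qed

subsection \<open>Solutions near the trivial branch\<close>

lemma deriv_add_const: "deriv (\<lambda>x. f x + c) = deriv f"
  for f :: "real \<Rightarrow> real"
proof -
  have "((\<lambda>x. f x + c) has_real_derivative D) (at x) \<longleftrightarrow> (f has_real_derivative D) (at x)" for D x
    using DERIV_add[OF _ DERIV_const, of f D x UNIV c] DERIV_add[OF _ DERIV_const, of "\<lambda>x. f x + c" D x UNIV "- c"]
    by auto
  then show ?thesis by (simp add: deriv_def fun_eq_iff)
qed

lemma higher_deriv_add_const: "(deriv ^^ Suc j) (\<lambda>x. f x + c) = (deriv ^^ Suc j) f"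
  for f :: "real \<Rightarrow> real"
  by (simp only: funpow_Suc_right o_apply deriv_add_const)

lemma hoelder_space_add_const:
  assumes "f \<in> hoelder_space (Suc k) \<alpha>"
  shows "(\<lambda>x. f x + c) \<in> hoelder_space (Suc k) \<alpha>"
  unfolding hoelder_space_def
proof (intro CollectI conjI allI impI)
  show "circle_fun (\<lambda>x. f x + c)" using assms by (simp add: hoelder_space_def circle_fun_def)
  show "(deriv ^^ j) (\<lambda>x. f x + c) differentiable (at x)" if "j < Suc k" for j x
  proof -
    have "(deriv ^^ j) f differentiable (at x)" using assms that by (simp add: hoelder_space_def)
    then show ?thesis
      using higher_deriv_add_const[of "j - 1" f c] by (cases j) (auto intro: derivative_intros)
  qed
qed (use assms higher_deriv_add_const[of k f c] in \<open>auto simp: hoelder_space_def\<close>)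

lemma P0_const: "P0 (\<lambda>_. k) = (\<lambda>_. 0)"
  by (simp add: P0_def fun_eq_iff)

lemma P0_eq_0_imp_const: "P0 f = (\<lambda>_. 0) \<Longrightarrow> f x = f y"
  by (simp add: P0_def fun_eq_iff)

lemma little_hoelder0_even_hoelder_space:
  assumes "\<rho> \<in> little_hoelder0_even (Suc k) \<alpha>"
  shows "\<rho> \<in> hoelder_space (Suc k) \<alpha>"
proof -
  obtain f where f: "f \<in> hoelder_space (Suc k) \<alpha>" "\<rho> = P0 f"
    using assms by (auto simp: little_hoelder0_even_def little_hoelder0_def little_hoelder_def)
  have "\<rho> = (\<lambda>x. f x + (- (1 / (2 * pi) * integral {-pi..pi} f)))"
    using f(2) by (simp add: P0_def)
  then show ?thesis using hoelder_space_add_const[OF f(1)] by metis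
qed

text \<open>The volume constraint, the integral of r^2 being 2 pi / lam^2, solved for lam.\<close>

definition family_lambda :: "nat \<Rightarrow> real \<Rightarrow> real" where
  "family_lambda l s = sqrt (2 * pi / integral {-pi..pi} (\<lambda>x. (radius l s x)\<^sup>2))"

lemma is_liftingD:
  assumes "is_lifting \<alpha> U V \<psi>" "0 < lam" "\<rho> \<in> U lam"
  shows "\<rho> \<in> little_hoelder0 0 \<alpha>" "\<psi> lam \<rho> \<in> little_hoelder 0 \<alpha>" "P0 (\<psi> lam \<rho>) = \<rho>"
    "F_star lam (\<psi> lam \<rho>) = F_star lam (\<lambda>_. 0)" "\<And>x. \<psi> lam \<rho> x > - (1 / lam)"
proof -
  have "U lam \<subseteq> little_hoelder0 0 \<alpha>" and V: "V lam \<subseteq> little_hoelder 0 \<alpha>"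
    using assms(1,2) by (simp_all add: is_lifting_def)
  then show "\<rho> \<in> little_hoelder0 0 \<alpha>" using assms(3) by blast
  have *: "\<psi> lam \<rho> \<in> V lam \<and> P0 (\<psi> lam \<rho>) = \<rho> \<and> F_star lam (\<psi> lam \<rho>) = F_star lam (\<lambda>_. 0) \<and>
      (\<forall>x. \<psi> lam \<rho> x > - (1 / lam))"
    using assms by (simp add: is_lifting_def)
  then show "\<psi> lam \<rho> \<in> little_hoelder 0 \<alpha>" using V by (intro subsetD[OF V]) simp
  show "P0 (\<psi> lam \<rho>) = \<rho>" "F_star lam (\<psi> lam \<rho>) = F_star lam (\<lambda>_. 0)"
    "\<And>x. \<psi> lam \<rho> x > - (1 / lam)"
    using * by simp_all
qed

text \<open>A solution close to \<open>(0, lam)\<close> is the mean-zero part of a positive even function \<open>r\<close> with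
  constant mean curvature, and \<open>r(0)\<close> is close to \<open>1 / lam\<close>.\<close>

lemma solution_lift:
  assumes lift: "is_lifting \<alpha> U V \<psi>" and sol: "(\<rho>, lam) \<in> solutions \<alpha> U \<psi>"
    and small: "hoelder_norm 4 \<alpha> \<rho> \<le> e"
  obtains r h where "circle_fun r" "\<And>x. 0 < r x" "deriv r 0 = 0"
    "\<And>x. (r has_real_derivative deriv r x) (at x)"
    "\<And>x. (deriv r has_real_derivative deriv (deriv r) x) (at x)"
    "\<And>x. curvature r x = h" "P0 r = \<rho>" "integral {-pi..pi} (\<lambda>x. (r x)\<^sup>2) = 2 * pi * (1 / lam)\<^sup>2"
    "\<bar>r 0 - 1 / lam\<bar> \<le> 2 * e" "\<bar>deriv (deriv r) 0\<bar> \<le> e" "h = 1 / r 0 - deriv (deriv r) 0"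
proof -
  have lam: "0 < lam" and \<rho>: "\<rho> \<in> little_hoelder0_even 4 \<alpha>" "\<rho> \<in> U lam"
    and G: "P0 (G (\<lambda>x. \<psi> lam \<rho> x + 1 / lam)) = (\<lambda>_. 0)"
    using sol by (auto simp: solutions_def G_bar_def)
  note \<psi> = is_liftingD[OF lift lam \<rho>(2)]
  define m where "m = 1 / (2 * pi) * integral {-pi..pi} (\<psi> lam \<rho>)"
  define c where "c = m + 1 / lam"
  define r where "r = (\<lambda>x. \<psi> lam \<rho> x + 1 / lam)"
  have \<psi>m: "\<psi> lam \<rho> = (\<lambda>x. \<rho> x + m)"
  proof
    fix x show "\<psi> lam \<rho> x = \<rho> x + m" using fun_cong[OF \<psi>(3), of x] by (simp add: P0_def m_def)
  qed
  have r\<rho>: "r = (\<lambda>x. \<rho> x + c)" by (simp add: r_def \<psi>m c_def add.assoc)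
  have \<rho>4: "\<rho> \<in> hoelder_space 4 \<alpha>"
    using little_hoelder0_even_hoelder_space[of \<rho> 3 \<alpha>] \<rho>(1) by simp
  then have r4: "r \<in> hoelder_space 4 \<alpha>"
    using hoelder_space_add_const[of \<rho> 3 \<alpha> c] by (simp add: r\<rho>)
  have \<rho>D: "\<bar>(deriv ^^ j) \<rho> x\<bar> \<le> e" if "j \<le> 4" for j x
    using higher_deriv_le_hoelder_norm[OF \<rho>4 that, of x] small by linarith
  have \<rho>e: "\<bar>\<rho> x\<bar> \<le> e" for x using \<rho>D[of 0 x] by simp
  have diff: "(deriv ^^ j) r differentiable (at x)" if "j < 4" for j x
    using r4 that by (simp add: hoelder_space_def)
  have rpos: "0 < r x" for x using \<psi>(5)[of x] by (simp add: r_def)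
  have circ: "circle_fun r" using r4 by (simp add: hoelder_space_def)
  have r_deriv: "(r has_real_derivative deriv r x) (at x)" for x
    using diff[of 0 x] by (simp add: DERIV_deriv_iff_real_differentiable)
  have p_deriv: "(deriv r has_real_derivative deriv (deriv r) x) (at x)" for x
    using diff[of 1 x] by (simp add: DERIV_deriv_iff_real_differentiable)
  have r0: "deriv r 0 = 0"
    using \<rho>(1) diff[of 0 0] by (intro even_deriv_0) (auto simp: r\<rho> little_hoelder0_even_def)
  obtain h where h: "\<And>x. curvature r x = h"
    using curvature_constant[OF circ rpos diff G[folded r_def]] by blast
  have q: "deriv (deriv r) 0 = (deriv ^^ 2) \<rho> 0"
    unfolding r\<rho> deriv_add_const by (simp add: numeral_2_eq_2)
  \<comment> \<open>At 0, where r' vanishes, the curvature takes its simplest form. Smallness of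
    r''(0), which the Hoelder norm controls, therefore keeps h near 1 / r(0).\<close>
  have h0: "h = 1 / r 0 - deriv (deriv r) 0"
    using h[of 0] by (simp add: curvature_def r0)
  have P0r: "P0 r = \<rho>"
    unfolding r_def using P0_add_const[OF \<psi>(2)] \<psi>(3) by simp
  have r2: "integral {-pi..pi} (\<lambda>x. (r x)\<^sup>2) = 2 * pi * (1 / lam)\<^sup>2"
    using \<psi>(4) unfolding F_star_0 by (simp add: F_star_def r_def)
  note \<rho>0 = little_hoelder0D[of \<rho> \<alpha>]
  note \<rho>in = \<psi>(1)
  have cont: "continuous_on {-pi..pi} \<rho>" by (rule little_hoelder_continuous[OF \<rho>0(1)[OF \<rho>in]])
  \<comment> \<open>With c the mean of r, the constraint reads 1 / lam^2 = c^2 + mean of \<rho>^2.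
    As |\<rho>| is at most e, it pins c between 1 / lam - e and 1 / lam; the other e in the bound on
    r(0) is the size of \<rho> at 0.\<close>
  have "F_star lam (\<psi> lam \<rho>) = integral {-pi..pi} (\<lambda>x. (\<rho> x)\<^sup>2) + 2 * pi * c\<^sup>2"
    unfolding \<psi>m F_star_add_const[OF \<rho>0(1)[OF \<rho>in]] by (simp add: \<rho>0(2)[OF \<rho>in] c_def)
  then have c_eq: "2 * pi * (1 / lam)\<^sup>2 = integral {-pi..pi} (\<lambda>x. (\<rho> x)\<^sup>2) + 2 * pi * c\<^sup>2"
    using \<psi>(4) by (simp add: F_star_0)
  have "0 \<le> integral {-pi..pi} (\<lambda>x. (\<rho> x)\<^sup>2)"
    by (intro integral_nonneg integrable_continuous_real continuous_intros cont) auto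
  then have "2 * pi * c\<^sup>2 \<le> 2 * pi * (1 / lam)\<^sup>2" using c_eq by linarith
  then have c_sq: "c\<^sup>2 \<le> (1 / lam)\<^sup>2" by simp
  have "integral {-pi..pi} (\<lambda>x. (\<rho> x)\<^sup>2) \<le> integral {-pi..pi} (\<lambda>x. e\<^sup>2)"
    using order_trans[OF \<rho>e abs_ge_self]
    by (intro integral_le integrable_continuous_real continuous_intros cont)
      (simp add: abs_le_square_iff[symmetric])
  then have "2 * pi * (1 / lam)\<^sup>2 \<le> 2 * pi * e\<^sup>2 + 2 * pi * c\<^sup>2" using c_eq by simp
  then have "2 * pi * (1 / lam)\<^sup>2 \<le> 2 * pi * (e\<^sup>2 + c\<^sup>2)" by (simp add: distrib_left)
  then have sq: "(1 / lam)\<^sup>2 \<le> e\<^sup>2 + c\<^sup>2" by (subst (asm) mult_le_cancel_left_pos) auto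
  have "0 \<le> integral {-pi..pi} r"
    using rpos by (intro integral_nonneg integrable_continuous_real continuous_at_imp_continuous_on)
      (auto intro: DERIV_isCont r_deriv less_imp_le)
  also have "integral {-pi..pi} r = 2 * pi * c"
    unfolding r\<rho> using integral_add_circle_const[OF integrable_continuous_real[OF cont]] \<rho>0(2)[OF \<rho>in]
    by simp
  finally have c0: "0 \<le> c" using pi_gt_zero by (simp add: zero_le_mult_iff not_le)
  have "0 \<le> e" using \<rho>e[of 0] by linarith
  have c1: "c \<le> 1 / lam" using c_sq lam by (intro power2_le_imp_le[of c]) auto
  have "(1 / lam - c)\<^sup>2 \<le> e\<^sup>2"
  proof -
    have "(1 / lam - c)\<^sup>2 = (1 / lam)\<^sup>2 - c\<^sup>2 - 2 * (c * (1 / lam - c))"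
      by (simp add: power2_eq_square algebra_simps)
    moreover have "0 \<le> c * (1 / lam - c)" using c0 c1 by simp
    ultimately show ?thesis using sq by linarith
  qed
  then have "1 / lam - c \<le> e" using \<open>0 \<le> e\<close> by (rule power2_le_imp_le)
  then have "\<bar>r 0 - 1 / lam\<bar> \<le> 2 * e" using c1 \<rho>e[of 0] by (simp add: r\<rho>)
  moreover have "\<bar>deriv (deriv r) 0\<bar> \<le> e" unfolding q by (intro \<rho>D) simp
  ultimately show ?thesis using that[OF circ rpos r0 r_deriv p_deriv h P0r r2] h0 by blast
qed

lemma mean_slope_0: "mean_slope 0 = 1"
  by (simp add: mean_slope_def slope_def rad_def)

lemma isCont_mean_slope: "isCont (\<lambda>s. Re (mean_slope (of_real s))) 0"
proof -
  have "mean_slope holomorphic_on small_disc"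
    using mean_slope_holomorphic[of "\<lambda>B. B" small_disc] by simp
  then have "isCont mean_slope (of_real 0)"
    using holomorphic_on_imp_continuous_on continuous_on_eq_continuous_at[OF open_ball]
    by (metis centre_in_ball of_real_0 zero_less_divide_1_iff zero_less_numeral)
  then have "isCont (\<lambda>s::real. mean_slope (of_real s)) 0"
    by (rule isCont_o2[rotated]) (intro continuous_intros)
  then show ?thesis by (rule isCont_Re)
qed

text \<open>Here a stands for r(0), q for r''(0), 1/a - q for the mean curvature h and h a - 1 for
  the parameter s. All are continuous in (lam, a - 1/lam, q) at (lam0, 0, 0), where h = lam0, s = 0
  and the mean slope is 1.\<close>

lemma eventually_close_parameters:
  fixes lam0 :: real
  assumes lam0: "0 < lam0" and d: "0 < d"
  shows "\<exists>e>0. \<forall>lam a q. \<bar>lam - lam0\<bar> < e \<longrightarrow> \<bar>a - 1 / lam\<bar> \<le> 2 * e \<longrightarrow> \<bar>q\<bar> \<le> e \<longrightarrow>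
     0 < 1 / a - q \<and> \<bar>(1 / a - q) * a - 1\<bar> < d \<and>
     \<bar>(1 / a - q) / Re (mean_slope (of_real ((1 / a - q) * a - 1))) - lam0\<bar> < d"
proof -
  let ?h = "\<lambda>(lam, b, q). 1 / (1 / lam + b) - q"
  let ?s = "\<lambda>(lam, b, q). (1 / (1 / lam + b) - q) * (1 / lam + b) - 1"
  let ?F = "nhds (lam0, 0::real, 0::real)"
  have fst: "((\<lambda>(lam, b, q). lam) \<longlongrightarrow> lam0) ?F" "((\<lambda>(lam, b, q). b) \<longlongrightarrow> 0) ?F"
    "((\<lambda>(lam, b, q). q) \<longlongrightarrow> 0) ?F"
  proof -
    have id: "((\<lambda>y. y) \<longlongrightarrow> (lam0, 0, 0)) ?F" by (rule filterlim_ident)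
    show "((\<lambda>(lam, b, q). lam) \<longlongrightarrow> lam0) ?F" "((\<lambda>(lam, b, q). b) \<longlongrightarrow> 0) ?F"
      "((\<lambda>(lam, b, q). q) \<longlongrightarrow> 0) ?F"
      unfolding case_prod_beta
      using tendsto_fst[OF id] tendsto_fst[OF tendsto_snd[OF id]] tendsto_snd[OF tendsto_snd[OF id]]
      by simp_all
  qed
  have a: "((\<lambda>(lam, b, q). 1 / lam + b) \<longlongrightarrow> 1 / lam0) ?F"
    unfolding case_prod_beta
    using tendsto_add[OF tendsto_divide[OF tendsto_const[of 1] fst(1)] fst(2)] lam0 unfolding case_prod_beta by simp
  have h: "(?h \<longlongrightarrow> lam0) ?F"
    unfolding case_prod_beta
    using tendsto_diff[OF tendsto_divide[OF tendsto_const[of 1] a] fst(3)] lam0 unfolding case_prod_beta by simp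
  have s: "(?s \<longlongrightarrow> 0) ?F"
    unfolding case_prod_beta
    using tendsto_diff[OF tendsto_mult[OF h a] tendsto_const[of 1]] lam0 unfolding case_prod_beta by simp
  have "((\<lambda>y. Re (mean_slope (of_real (?s y)))) \<longlongrightarrow> Re (mean_slope (of_real 0))) ?F"
    by (rule isCont_tendsto_compose[OF isCont_mean_slope s])
  then have A: "((\<lambda>y. Re (mean_slope (of_real (?s y)))) \<longlongrightarrow> 1) ?F" by (simp add: mean_slope_0)
  have l: "((\<lambda>y. ?h y / Re (mean_slope (of_real (?s y)))) \<longlongrightarrow> lam0) ?F"
    using tendsto_divide[OF h A] by simp
  have "\<forall>\<^sub>F y in ?F. 0 < ?h y" using h lam0 by (rule order_tendstoD)
  moreover have "\<forall>\<^sub>F y in ?F. dist (?s y) 0 < d" using s d by (rule tendstoD)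
  moreover have "\<forall>\<^sub>F y in ?F. dist (?h y / Re (mean_slope (of_real (?s y)))) lam0 < d"
    using l d by (rule tendstoD)
  ultimately have "\<forall>\<^sub>F y in ?F. 0 < ?h y \<and> dist (?s y) 0 < d \<and>
      dist (?h y / Re (mean_slope (of_real (?s y)))) lam0 < d"
    by eventually_elim auto
  then obtain \<epsilon> where \<epsilon>: "0 < \<epsilon>" "\<And>y. dist y (lam0, 0, 0) < \<epsilon> \<Longrightarrow> 0 < ?h y \<and> dist (?s y) 0 < d \<and>
      dist (?h y / Re (mean_slope (of_real (?s y)))) lam0 < d"
    unfolding eventually_nhds_metric by blast
  show ?thesis
  \<comment> \<open>With e one fifth of the radius, the three coordinates contribute at most e, 2 e
    and e, which stays below 5 e.\<close>
  proof (intro exI[of _ "\<epsilon> / 5"] conjI allI impI)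
    show "0 < \<epsilon> / 5" using \<epsilon> by simp
    fix lam a q
    assume 1: "\<bar>lam - lam0\<bar> < \<epsilon> / 5" "\<bar>a - 1 / lam\<bar> \<le> 2 * (\<epsilon> / 5)" "\<bar>q\<bar> \<le> \<epsilon> / 5"
    have "dist (lam, a - 1 / lam, q) (lam0, 0, 0) \<le> \<bar>lam - lam0\<bar> + (\<bar>a - 1 / lam\<bar> + \<bar>q\<bar>)"
      unfolding dist_prod_def fst_conv snd_conv dist_real_def
      by (rule order_trans[OF sqrt_sum_squares_le_sum_abs])
        (simp add: order_trans[OF sqrt_sum_squares_le_sum_abs])
    also have "\<dots> < \<epsilon>" using 1 \<epsilon>(1) by linarith
    finally show "0 < 1 / a - q" "\<bar>(1 / a - q) * a - 1\<bar> < d"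
      "\<bar>(1 / a - q) / Re (mean_slope (of_real ((1 / a - q) * a - 1))) - lam0\<bar> < d"
      using \<epsilon>(2)[of "(lam, a - 1 / lam, q)"] by (auto simp: dist_real_def)
  qed
qed

text \<open>Serves both halves of the theorem: near an integer it leaves one branch once d is at
  most 1, and near a non-integer it leaves none once d is below the distance to the natural
  numbers.\<close>

lemma solutions_near:
  assumes lift: "is_lifting \<alpha> U V \<psi>" and lam0: "0 < lam0" and d: "0 < d"
  shows "\<exists>e>0. \<forall>(\<rho>, lam)\<in>solutions \<alpha> U \<psi>. hoelder_norm 4 \<alpha> \<rho> < e \<and> \<bar>lam - lam0\<bar> < e \<longrightarrow>
     \<rho> = (\<lambda>_. 0) \<or> (\<exists>l\<ge>1. \<exists>s. \<bar>s\<bar> < d \<and> \<bar>real l - lam0\<bar> < d \<and>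
        \<rho> = P0 (radius l s) \<and> lam = family_lambda l s)"
proof -
  obtain e where e: "0 < e" "\<And>lam a q. \<bar>lam - lam0\<bar> < e \<Longrightarrow> \<bar>a - 1 / lam\<bar> \<le> 2 * e \<Longrightarrow> \<bar>q\<bar> \<le> e \<Longrightarrow>
     0 < 1 / a - q \<and> \<bar>(1 / a - q) * a - 1\<bar> < min d (1 / 1000) \<and>
     \<bar>(1 / a - q) / Re (mean_slope (of_real ((1 / a - q) * a - 1))) - lam0\<bar> < min d (1 / 1000)"
    using eventually_close_parameters[OF lam0, of "min d (1 / 1000)"] d by auto
  have "\<rho> = (\<lambda>_. 0) \<or> (\<exists>l\<ge>1. \<exists>s. \<bar>s\<bar> < d \<and> \<bar>real l - lam0\<bar> < d \<and>
        \<rho> = P0 (radius l s) \<and> lam = family_lambda l s)"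
    if sol: "(\<rho>, lam) \<in> solutions \<alpha> U \<psi>" and small: "hoelder_norm 4 \<alpha> \<rho> < e" "\<bar>lam - lam0\<bar> < e" for \<rho> lam
  proof -
    have lam: "0 < lam" using sol by (simp add: solutions_def)
    obtain r h where r: "circle_fun r" "\<And>x. 0 < r x" "deriv r 0 = 0"
      "\<And>x. (r has_real_derivative deriv r x) (at x)"
      "\<And>x. (deriv r has_real_derivative deriv (deriv r) x) (at x)"
      "\<And>x. curvature r x = h" and P0r: "P0 r = \<rho>"
      and r2: "integral {-pi..pi} (\<lambda>x. (r x)\<^sup>2) = 2 * pi * (1 / lam)\<^sup>2"
      and close: "\<bar>r 0 - 1 / lam\<bar> \<le> 2 * e" "\<bar>deriv (deriv r) 0\<bar> \<le> e"
      and h: "h = 1 / r 0 - deriv (deriv r) 0"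
      using solution_lift[OF lift sol less_imp_le[OF small(1)]] by blast
    note E = e(2)[OF small(2) close, folded h]
    from E have "0 < h" "\<bar>h * r 0 - 1\<bar> < 1 / 1000" by auto
    from cmc_is_delaunay[OF r this] show ?thesis
    proof (elim disjE exE conjE)
      assume "\<forall>x. r x = r 0"
      then have "r = (\<lambda>_. r 0)" by (simp add: fun_eq_iff)
      then have "P0 r = (\<lambda>_. 0)" using P0_const by metis
      then show ?thesis using P0r by simp
    next
      fix l assume l: "1 \<le> l" "h = mean_curv l (h * r 0 - 1)" "r = radius l (h * r 0 - 1)"
      define s where "s = h * r 0 - 1"
      have hl: "h = mean_curv l s" and rl: "r = radius l s" using l(2,3) by (simp_all add: s_def)
      have s: "\<bar>s\<bar> < d" "\<bar>s\<bar> < 1 / 1000" using E by (auto simp: s_def)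
      have "0 < Re (mean_slope (of_real s))" using mean_slope_bounds(3)[OF s_disc[OF s(2)]] by simp
      \<comment> \<open>The quotient that was made close to lam0 is an integer; this selects
        l.\<close>
      then have "h / Re (mean_slope (of_real s)) = real l" using hl by (simp add: mean_curv_def)
      then have "\<bar>real l - lam0\<bar> < d" using E by (simp add: s_def)
      moreover have "family_lambda l s = lam"
      proof -
        have "2 * pi / integral {-pi..pi} (\<lambda>x. (radius l s x)\<^sup>2) = lam\<^sup>2"
          using r2 lam unfolding rl by (simp add: power_divide)
        then show ?thesis using lam by (simp add: family_lambda_def)
      qed
      ultimately show ?thesis using l(1) s(1) P0r rl by blast
    qed
  qed
  then show ?thesis using e(1) by blast
qed

subsection \<open>The bifurcating branch\<close>

text \<open>The remainder of order n = 1 at t = 0: the only Taylor term is \<open>curve 0\<close>,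
  which vanishes, and the remainder bound is linear in |s| near 0.\<close>

lemma (in analytic_family) curve_norm_tendsto_0:
  assumes "curve 0 = (\<lambda>_. 0)"
  shows "((\<lambda>s. hoelder_norm k \<alpha> (curve s)) \<longlongrightarrow> 0) (at 0)"
proof -
  define R where "R = \<delta> / 2"
  have R: "\<bar>0\<bar> + R < \<delta>" "0 < R" using \<delta> by (auto simp: R_def)
  have c0: "P0 (\<lambda>x. Re (coeff (of_real 0) 0 (of_real x))) = (\<lambda>_. 0)"
    using assms by (simp add: coeff_def curve_def)
  have rem: "0 \<le> hoelder_norm k \<alpha> (curve s)"
    "hoelder_norm k \<alpha> (curve s) \<le> strip_const k \<eta> * (M * (\<bar>s\<bar> / R) / (1 - \<bar>s\<bar> / R))"
    if "\<bar>s\<bar> < R" for s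
    using curve_remainder[OF R, of s k 1] that c0 by simp_all
  have ev: "\<forall>\<^sub>F s in at 0. \<bar>s::real\<bar> < R"
    unfolding eventually_at using R by (intro exI[of _ R]) auto
  show ?thesis
  proof (rule tendsto_sandwich[where f = "\<lambda>_. 0"])
    show "\<forall>\<^sub>F s in at 0. 0 \<le> hoelder_norm k \<alpha> (curve s)"
      using ev by eventually_elim (rule rem)
    show "\<forall>\<^sub>F s in at 0. hoelder_norm k \<alpha> (curve s) \<le> strip_const k \<eta> * (M * (\<bar>s\<bar> / R) / (1 - \<bar>s\<bar> / R))"
      using ev by eventually_elim (rule rem)
    show "((\<lambda>s. strip_const k \<eta> * (M * (\<bar>s\<bar> / R) / (1 - \<bar>s\<bar> / R))) \<longlongrightarrow> 0) (at 0)"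
      using R by (auto intro!: tendsto_eq_intros)
  qed simp
qed

lemma analytic_curve_onI:
  assumes X: "\<And>t. t \<in> S \<Longrightarrow> \<rho> t \<in> X"
    and \<rho>: "\<And>t. t \<in> S \<Longrightarrow> \<exists>R>0. \<exists>a. (\<forall>n. a n \<in> X) \<and>
      (\<forall>s. \<bar>s - t\<bar> < R \<longrightarrow> (\<lambda>n. N (\<lambda>x. \<rho> s x - (\<Sum>k<n. (s - t) ^ k * a k x))) \<longlonglongrightarrow> 0)"
    and lam: "\<And>t. t \<in> S \<Longrightarrow> \<exists>R>0. \<exists>b. \<forall>s. \<bar>s - t\<bar> < R \<longrightarrow> (\<lambda>k. (s - t) ^ k * b k) sums lam s"
  shows "analytic_curve_on X N S (\<lambda>s. (\<rho> s, lam s))"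
  unfolding analytic_curve_on_def fst_conv snd_conv
proof (intro conjI ballI)
  fix t assume t: "t \<in> S"
  show "\<rho> t \<in> X" by (rule X[OF t])
  obtain R a where R: "0 < R" "\<forall>n. a n \<in> X"
    "\<forall>s. \<bar>s - t\<bar> < R \<longrightarrow> (\<lambda>n. N (\<lambda>x. \<rho> s x - (\<Sum>k<n. (s - t) ^ k * a k x))) \<longlonglongrightarrow> 0"
    using \<rho>[OF t] by blast
  obtain R' b where R': "0 < R'" "\<forall>s. \<bar>s - t\<bar> < R' \<longrightarrow> (\<lambda>k. (s - t) ^ k * b k) sums lam s"
    using lam[OF t] by blast
  show "\<exists>\<epsilon>>0. \<exists>a b. (\<forall>n. a n \<in> X) \<and> (\<forall>s\<in>S. \<bar>s - t\<bar> < \<epsilon> \<longrightarrow>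
      (\<lambda>n. N (\<lambda>x. \<rho> s x - (\<Sum>k<n. (s - t) ^ k * a k x))) \<longlonglongrightarrow> 0 \<and> (\<lambda>k. (s - t) ^ k * b k) sums lam s)"
    using R R' by (intro exI[of _ "min R R'"] conjI exI[of _ a] exI[of _ b]) auto
qed

section \<open>The bifurcation parameter along the branch\<close>

text \<open>The integral of r^2 continued to complex B. The square is taken without a modulus, so
  that the result is holomorphic in B.\<close>

definition area :: "nat \<Rightarrow> complex \<Rightarrow> complex" where
  "area l B = integral {-pi..pi} (\<lambda>x. (profile l B (of_real x))\<^sup>2)"

context
  fixes l :: nat and \<alpha> :: real
  assumes l: "1 \<le> l" and \<alpha>: "0 < \<alpha>" "\<alpha> < 1"
begin

interpretation analytic_family "profile l" "1 / 1000" "1 / (2 * real l)" 4 \<alpha>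
  by (rule analytic_family_profile[OF l \<alpha>])

lemma curve_eq: "curve s = P0 (radius l s)"
  by (simp add: curve_def radius_def[abs_def])

lemma radius_little_hoelder: "\<bar>s\<bar> < 1 / 1000 \<Longrightarrow> radius l s \<in> little_hoelder k \<alpha>"
  using curve_in_little_hoelder(1)[of s k] by (simp add: radius_def[abs_def])

lemma P0_radius_little_hoelder0_even:
  "\<bar>s\<bar> < 1 / 1000 \<Longrightarrow> P0 (radius l s) \<in> little_hoelder0_even k \<alpha>"
  using curve_in_little_hoelder(2)[of s k] by (simp add: curve_eq)

lemma P0_radius_analytic:
  assumes "\<bar>t\<bar> < 1 / 1000"
  shows "\<exists>R>0. \<exists>a. (\<forall>n. a n \<in> little_hoelder0_even k \<alpha>) \<and> (\<forall>s. \<bar>s - t\<bar> < R \<longrightarrow>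
    (\<lambda>n. hoelder_norm k \<alpha> (\<lambda>x. P0 (radius l s) x - (\<Sum>j<n. (s - t) ^ j * a j x))) \<longlonglongrightarrow> 0)"
  by (rule curve_analytic[OF assms, of k]) (auto simp: curve_eq)

lemma mean_curv_0: "mean_curv l 0 = real l"
  by (simp add: mean_curv_def mean_slope_0)

lemma radius_0: "radius l 0 = (\<lambda>_. 1 / real l)"
  using radius_eq[of 0 l] l by (simp add: fun_eq_iff mean_curv_0)

lemma P0_radius_tendsto_0: "((\<lambda>s. hoelder_norm k \<alpha> (P0 (radius l s))) \<longlongrightarrow> 0) (at 0)"
  using curve_norm_tendsto_0[of k] by (simp add: curve_eq radius_0 P0_const)

lemma P0_radius_nonzero:
  assumes "\<bar>s\<bar> < 1 / 1000" "s \<noteq> 0"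
  shows "P0 (radius l s) \<noteq> (\<lambda>_. 0)"
  using radius_nonconstant[OF assms(1) l assms(2)] P0_eq_0_imp_const by metis

lemma area_holomorphic: "area l holomorphic_on small_disc"
  unfolding area_def
proof (rule holomorphic_integral[where M = "4\<^sup>2"])
  have strip: "complex_of_real u \<in> strip (1 / (2 * real l))" for u
    using l by (simp add: strip_def)
  show "(\<lambda>B. (profile l B (of_real u))\<^sup>2) holomorphic_on small_disc" for u
    by (intro holomorphic_intros holo_B strip)
  show "continuous_on {- pi..pi} (\<lambda>x. (profile l B (of_real x))\<^sup>2)" if "B \<in> small_disc" for B
  proof -
    have "continuous_on (strip (1 / (2 * real l))) (profile l B)"
      using that by (intro holomorphic_on_imp_continuous_on holo_x) simp
    then have "continuous_on {- pi..pi} (\<lambda>x. profile l B (of_real x))"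
      by (rule continuous_on_compose2) (use strip in \<open>auto intro!: continuous_intros\<close>)
    then show ?thesis by (intro continuous_intros)
  qed
  show "norm ((profile l B (of_real u))\<^sup>2) \<le> 4\<^sup>2" if "B \<in> small_disc" for B u
    unfolding norm_power using that by (intro power_mono bound strip) auto
qed auto

lemma radius_square_integral:
  assumes s: "\<bar>s\<bar> < 1 / 1000"
  shows "area l (of_real s) = of_real (integral {-pi..pi} (\<lambda>x. (radius l s x)\<^sup>2))"
proof -
  have "continuous_on {-pi..pi} (radius l s)"
    by (rule little_hoelder_continuous[OF radius_little_hoelder[OF s]])
  then have "((\<lambda>x. (radius l s x)\<^sup>2) has_integral integral {-pi..pi} (\<lambda>x. (radius l s x)\<^sup>2)) {-pi..pi}"
    by (intro integrable_integral integrable_continuous_real continuous_intros)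
  note I = has_integral_of_real[OF this, where 'b = complex]
  have "complex_of_real ((radius l s x)\<^sup>2) = (profile l (of_real s) (of_real x))\<^sup>2" for x
    unfolding radius_def using profile_real[OF s l, of x] by simp
  then show "area l (of_real s) = of_real (integral {-pi..pi} (\<lambda>x. (radius l s x)\<^sup>2))"
    using I unfolding area_def by (simp add: integral_unique)
qed

lemma area_0: "area l 0 = of_real (2 * pi * (1 / real l)\<^sup>2)"
  using radius_square_integral[of 0] by (simp add: radius_0)

text \<open>The area has positive real part at B = 0 and hence on a small disc. There 2 pi / area
  stays in the right half-plane, away from the cut of \<open>csqrt\<close>, and its root continues
  \<open>family_lambda\<close> holomorphically.\<close>

lemma family_lambda_holomorphic:
  obtains d L where "0 < d" "d < 1 / 1000" "L holomorphic_on ball 0 d"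
    "\<And>s. \<bar>s\<bar> < d \<Longrightarrow> family_lambda l s = Re (L (of_real s))"
    "\<And>s. \<bar>s\<bar> < d \<Longrightarrow> 0 < integral {-pi..pi} (\<lambda>x. (radius l s x)\<^sup>2)"
proof -
  have "isCont (area l) 0"
    using area_holomorphic holomorphic_on_imp_continuous_on continuous_on_eq_continuous_at[OF open_ball]
    by (metis centre_in_ball zero_less_divide_1_iff zero_less_numeral)
  then have "((\<lambda>B. Re (area l B)) \<longlongrightarrow> Re (area l 0)) (at 0)"
    unfolding isCont_def by (rule tendsto_Re)
  moreover have A0: "0 < Re (area l 0)" using l by (simp add: area_0)
  ultimately have "\<forall>\<^sub>F B in at 0. 0 < Re (area l B)" by (rule order_tendstoD)
  then obtain d' where d': "0 < d'" "\<And>B. B \<noteq> 0 \<Longrightarrow> dist B 0 < d' \<Longrightarrow> 0 < Re (area l B)"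
    unfolding eventually_at by blast
  define d where "d = min d' (1 / 2000)"
  have d: "0 < d" "d < 1 / 1000" using d'(1) by (auto simp: d_def)
  have pos: "0 < Re (area l B)" if "B \<in> ball 0 d" for B
    using d'(2)[of B] A0 that by (cases "B = 0") (auto simp: d_def)
  define L where "L = (\<lambda>B. csqrt (of_real (2 * pi) / area l B))"
  have "L holomorphic_on ball 0 d"
    unfolding L_def
  proof (intro holomorphic_on_csqrt' holomorphic_on_divide holomorphic_on_const)
    show "area l holomorphic_on ball 0 d"
      using d by (intro holomorphic_on_subset[OF area_holomorphic]) auto
    fix B :: complex assume B: "B \<in> ball 0 d"
    show "area l B \<noteq> 0" using pos[OF B] by auto
    have "0 < Re (of_real (2 * pi) / area l B)"
      using pos[OF B] by (simp add: Re_divide sum_power2_gt_zero_iff add_pos_nonneg)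
    then show "of_real (2 * pi) / area l B \<notin> \<real>\<^sub>\<le>\<^sub>0" by (simp add: complex_nonpos_Reals_iff)
  qed
  moreover have I: "0 < integral {-pi..pi} (\<lambda>x. (radius l s x)\<^sup>2)" if "\<bar>s\<bar> < d" for s
    using pos[of "of_real s"] radius_square_integral[of s] that d by simp
  moreover have "family_lambda l s = Re (L (of_real s))" if "\<bar>s\<bar> < d" for s
    using radius_square_integral[of s] I[OF that] that d
    by (simp add: L_def family_lambda_def csqrt_of_real_nonneg flip: of_real_divide of_real_mult)
  ultimately show ?thesis using that[of d L] d by blast
qed

lemma family_lambda_analytic:
  obtains d where "0 < d" "d < 1 / 1000"
    "\<And>t. \<bar>t\<bar> < d \<Longrightarrow> \<exists>R>0. \<exists>b. \<forall>s. \<bar>s - t\<bar> < R \<longrightarrow> (\<lambda>k. (s - t) ^ k * b k) sums family_lambda l s"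
    "isCont (family_lambda l) 0"
    "\<And>s. \<bar>s\<bar> < d \<Longrightarrow> 0 < integral {-pi..pi} (\<lambda>x. (radius l s x)\<^sup>2)"
proof -
  obtain d L where d: "0 < d" "d < 1 / 1000" and L: "L holomorphic_on ball 0 d"
    and fL: "\<And>s. \<bar>s\<bar> < d \<Longrightarrow> family_lambda l s = Re (L (of_real s))"
    and I: "\<And>s. \<bar>s\<bar> < d \<Longrightarrow> 0 < integral {-pi..pi} (\<lambda>x. (radius l s x)\<^sup>2)"
    using family_lambda_holomorphic by blast
  have "\<exists>R>0. \<exists>b. \<forall>s. \<bar>s - t\<bar> < R \<longrightarrow> (\<lambda>k. (s - t) ^ k * b k) sums family_lambda l s"
    if t: "\<bar>t\<bar> < d" for t
  proof -
    define R where "R = d - \<bar>t\<bar>"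
    define b where "b = (\<lambda>k. Re ((deriv ^^ k) L (of_real t) / fact k))"
    have sub: "ball (complex_of_real t) R \<subseteq> ball 0 d"
    proof
      fix z assume "z \<in> ball (complex_of_real t) R"
      then have "norm (z - of_real t) < R" by (simp add: dist_norm norm_minus_commute)
      then show "z \<in> ball 0 d" using norm_triangle_sub[of z "of_real t"] by (simp add: R_def)
    qed
    have "(\<lambda>k. (s - t) ^ k * b k) sums family_lambda l s" if s: "\<bar>s - t\<bar> < R" for s
    proof -
      have "complex_of_real s \<in> ball (of_real t) R"
        using s by (simp add: dist_norm norm_minus_commute flip: of_real_diff)
      from holomorphic_power_series[OF holomorphic_on_subset[OF L sub] this]
      have "(\<lambda>k. Re ((deriv ^^ k) L (of_real t) / fact k * (of_real s - of_real t) ^ k)) sums Re (L (of_real s))"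
        by (rule sums_Re)
      moreover have "Re ((deriv ^^ k) L (of_real t) / fact k * (of_real s - of_real t) ^ k) = (s - t) ^ k * b k" for k
      proof -
        have "Re (w * of_real x) = x * Re w" for w x by simp
        then show ?thesis unfolding b_def of_real_diff[symmetric] of_real_power[symmetric] by blast
      qed
      moreover have "\<bar>s\<bar> < d" using s by (simp add: R_def)
      ultimately show ?thesis by (simp add: fL)
    qed
    then show ?thesis using t by (intro exI[of _ R]) (auto simp: R_def)
  qed
  moreover have "isCont (family_lambda l) 0"
  proof -
    have "isCont L (of_real 0)"
      using L d holomorphic_on_imp_continuous_on continuous_on_eq_continuous_at[OF open_ball]
      by (metis centre_in_ball of_real_0)
    then have "isCont (\<lambda>s::real. L (of_real s)) 0"
      by (rule isCont_o2[rotated]) (intro continuous_intros)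
    then have "isCont (\<lambda>s::real. Re (L (of_real s))) 0" by (rule isCont_Re)
    moreover have "\<forall>\<^sub>F s in nhds 0. Re (L (of_real s)) = family_lambda l s"
      unfolding eventually_nhds_metric using d fL by (intro exI[of _ d]) auto
    ultimately show ?thesis by (simp add: isCont_cong)
  qed
  ultimately show ?thesis using that[of d] d I by blast
qed

lemma family_lambda_0: "family_lambda l 0 = real l"
  using l by (simp add: family_lambda_def radius_0 power_divide)

text \<open>The lifting \<psi> is not given explicitly and the set V in which it is unique is
  arbitrary. Its value and \<open>radius l s\<close> - 1/lam both exceed -1/lam and satisfy the two
  lifting equations, so \<open>lifting_unique\<close> identifies them without reference to
  V.\<close>

lemma radius_solution:
  assumes lift: "is_lifting \<alpha> U V \<psi>" and s: "\<bar>s\<bar> < 1 / 1000"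
    and I: "0 < integral {-pi..pi} (\<lambda>x. (radius l s x)\<^sup>2)"
    and U: "P0 (radius l s) \<in> U (family_lambda l s)"
  shows "(P0 (radius l s), family_lambda l s) \<in> solutions \<alpha> U \<psi>"
proof -
  let ?\<rho> = "P0 (radius l s)" and ?lam = "family_lambda l s"
  have lam: "0 < ?lam" using I by (simp add: family_lambda_def)
  have lam2: "?lam\<^sup>2 = 2 * pi / integral {-pi..pi} (\<lambda>x. (radius l s x)\<^sup>2)"
    using I by (simp add: family_lambda_def)
  define v where "v = (\<lambda>x. radius l s x + - (1 / ?lam))"
  have v: "v \<in> little_hoelder 0 \<alpha>"
    unfolding v_def by (intro little_hoelder_add_const radius_little_hoelder s)
  note \<psi> = is_liftingD(2-)[OF lift lam U]
  have "\<psi> ?lam ?\<rho> = v"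
  proof (rule lifting_unique[OF \<psi>(1) v _ _ \<psi>(4)])
    show "P0 (\<psi> ?lam ?\<rho>) = P0 v"
      unfolding v_def P0_add_const[OF radius_little_hoelder[OF s]] by (rule \<psi>(2))
    have "F_star ?lam v = 2 * pi / ?lam\<^sup>2"
      unfolding lam2 using I by (simp add: F_star_def v_def)
    then show "F_star ?lam (\<psi> ?lam ?\<rho>) = F_star ?lam v"
      unfolding \<psi>(3) F_star_0 by (simp add: power_divide)
    show "- (1 / ?lam) < v x" for x using radius_pos[OF s l, of x] by (simp add: v_def)
  qed
  then have "(\<lambda>x. \<psi> ?lam ?\<rho> x + 1 / ?lam) = radius l s" by (simp add: v_def)
  then have "G_bar \<psi> ?\<rho> ?lam = (\<lambda>_. 0)"
    by (simp add: G_bar_def G_radius[OF s l] P0_const)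
  then show ?thesis
    using lam U P0_radius_little_hoelder0_even[OF s] by (simp add: solutions_def)
qed

end

section \<open>The bifurcation theorem\<close>

theorem theorem6p2:
  fixes \<alpha> :: real
    and U V :: "real \<Rightarrow> (real \<Rightarrow> real) set"
    and \<psi> :: "real \<Rightarrow> (real \<Rightarrow> real) \<Rightarrow> real \<Rightarrow> real"
  assumes "0 < \<alpha>" and "\<alpha> < 1"
    and "is_lifting \<alpha> U V \<psi>"
  shows "(\<forall>l::nat. l \<ge> 1 \<longrightarrow>
            bifurcation_point \<alpha> U \<psi> (real l) \<and>
            (\<exists>\<delta>>0. \<exists>\<rho> lam.
               analytic_curve_on (little_hoelder0_even 4 \<alpha>) (hoelder_norm 4 \<alpha>)
                 {-\<delta><..<\<delta>} (\<lambda>s. (\<rho> s, lam s)) \<and>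
               \<rho> 0 = (\<lambda>_. 0) \<and> lam 0 = real l \<and>
               (\<forall>s\<in>{-\<delta><..<\<delta>}. s \<noteq> 0 \<longrightarrow> \<rho> s \<noteq> (\<lambda>_. 0)) \<and>
               (\<forall>s\<in>{-\<delta><..<\<delta>}. (\<rho> s, lam s) \<in> solutions \<alpha> U \<psi>) \<and>
               (\<exists>\<epsilon>>0. \<forall>(\<rho>', lam')\<in>solutions \<alpha> U \<psi>.
                  hoelder_norm 4 \<alpha> \<rho>' < \<epsilon> \<and> \<bar>lam' - real l\<bar> < \<epsilon> \<longrightarrow>
                  \<rho>' = (\<lambda>_. 0) \<or> (\<exists>s\<in>{-\<delta><..<\<delta>}. (\<rho>', lam') = (\<rho> s, lam s))))) \<and>
         (\<forall>lam>0. lam \<notin> \<nat> \<longrightarrow> \<not> bifurcation_point \<alpha> U \<psi> lam)"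
proof (intro conjI allI impI)
  note \<alpha> = assms(1,2) and lift = assms(3)
  fix l :: nat assume l: "1 \<le> l"
  let ?\<rho> = "\<lambda>s. P0 (radius l s)" and ?lam = "family_lambda l"
  have lpos: "0 < real l" using l by simp
  obtain d where d: "0 < d" "d < 1 / 1000"
    and lam_an: "\<And>t. \<bar>t\<bar> < d \<Longrightarrow> \<exists>R>0. \<exists>b. \<forall>s. \<bar>s - t\<bar> < R \<longrightarrow> (\<lambda>k. (s - t) ^ k * b k) sums ?lam s"
    and lam_cont: "isCont ?lam 0"
    and I: "\<And>s. \<bar>s\<bar> < d \<Longrightarrow> 0 < integral {-pi..pi} (\<lambda>x. (radius l s x)\<^sup>2)"
    using family_lambda_analytic[OF l \<alpha>] by blast
  \<comment> \<open>Local uniformity of U in the parameter is essential here: lam moves along the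
    curve, and the same e must work for all of its values near l.\<close>
  obtain e where e: "0 < e" "\<And>\<mu>. 0 < \<mu> \<Longrightarrow> \<bar>\<mu> - real l\<bar> < e \<Longrightarrow>
      {\<rho> \<in> little_hoelder0 0 \<alpha>. hoelder_norm 0 \<alpha> \<rho> < e} \<subseteq> U \<mu>"
    using lift lpos unfolding is_lifting_def by meson
  have lam_lim: "(?lam \<longlongrightarrow> real l) (at 0)"
    using lam_cont unfolding isCont_def by (simp add: family_lambda_0[OF l \<alpha>])
  have near: "\<forall>\<^sub>F s in at 0. hoelder_norm k \<alpha> (?\<rho> s) < \<epsilon> \<and> \<bar>?lam s - real l\<bar> < \<epsilon>"
    if "0 < \<epsilon>" for k \<epsilon>
    using order_tendstoD(2)[OF P0_radius_tendsto_0[OF l \<alpha>] that, of k] tendstoD[OF lam_lim that]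
    by eventually_elim (simp add: dist_real_def)
  obtain d' where d': "0 < d'" "\<And>s. s \<noteq> 0 \<Longrightarrow> \<bar>s\<bar> < d' \<Longrightarrow>
      hoelder_norm 0 \<alpha> (?\<rho> s) < e \<and> \<bar>?lam s - real l\<bar> < e"
    using near[OF e(1), of 0] unfolding eventually_at by (auto simp: dist_real_def)
  define \<delta> where "\<delta> = min d d'"
  have \<delta>: "0 < \<delta>" using d d' by (simp add: \<delta>_def)
  have small: "\<bar>s\<bar> < d" "\<bar>s\<bar> < d'" "\<bar>s\<bar> < 1 / 1000" if "s \<in> {-\<delta><..<\<delta>}" for s
    using that d by (auto simp: \<delta>_def)
  have \<rho>0: "?\<rho> 0 = (\<lambda>_. 0)" by (simp add: radius_0[OF l \<alpha>] P0_const)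
  \<comment> \<open>The limits at 0 say nothing about s = 0 itself. The strip estimate with bound 0
    traps the norm of the zero function between 0 and 0.\<close>
  have norm0: "hoelder_norm 0 \<alpha> (\<lambda>_. 0) = 0"
    using strip_little_hoelder0_even(3,4)[of "\<lambda>_. 0" 1 0 \<alpha> 0] \<alpha> P0_const[of 0] by simp
  have sol: "(?\<rho> s, ?lam s) \<in> solutions \<alpha> U \<psi>" if s: "s \<in> {-\<delta><..<\<delta>}" for s
  proof (rule radius_solution[OF l \<alpha> lift small(3)[OF s] I[OF small(1)[OF s]]])
    have "0 < ?lam s" using I[OF small(1)[OF s]] by (simp add: family_lambda_def)
    moreover have "hoelder_norm 0 \<alpha> (?\<rho> s) < e \<and> \<bar>?lam s - real l\<bar> < e"
      using d'(2)[of s] small(2)[OF s] e(1) \<rho>0 norm0 family_lambda_0[OF l \<alpha>] by (cases "s = 0") auto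
    moreover have "?\<rho> s \<in> little_hoelder0 0 \<alpha>"
      using P0_radius_little_hoelder0_even[OF l \<alpha> small(3)[OF s], of 0]
      by (simp add: little_hoelder0_even_def)
    ultimately show "?\<rho> s \<in> U (?lam s)" using e(2) by blast
  qed
  have nz: "?\<rho> s \<noteq> (\<lambda>_. 0)" if "s \<in> {-\<delta><..<\<delta>}" "s \<noteq> 0" for s
    using P0_radius_nonzero[OF l \<alpha> small(3)] that by blast
  show "bifurcation_point \<alpha> U \<psi> (real l)"
    unfolding bifurcation_point_def
  proof (intro allI impI)
    fix \<epsilon> :: real assume "0 < \<epsilon>"
    have "\<forall>\<^sub>F s in at 0. s \<noteq> 0 \<and> s \<in> {-\<delta><..<\<delta>}"
      unfolding eventually_at using \<delta> by (intro exI[of _ \<delta>]) (auto simp: dist_real_def)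
    with near[OF \<open>0 < \<epsilon>\<close>, of 4] have "\<forall>\<^sub>F s in at 0. s \<noteq> 0 \<and> s \<in> {-\<delta><..<\<delta>} \<and>
        hoelder_norm 4 \<alpha> (?\<rho> s) < \<epsilon> \<and> \<bar>?lam s - real l\<bar> < \<epsilon>"
      by eventually_elim auto
    from eventually_happens'[OF at_neq_bot this]
    obtain s where "s \<noteq> 0" "s \<in> {-\<delta><..<\<delta>}" "hoelder_norm 4 \<alpha> (?\<rho> s) < \<epsilon>"
      "\<bar>?lam s - real l\<bar> < \<epsilon>"
      by blast
    then show "\<exists>(\<rho>, lam)\<in>solutions \<alpha> U \<psi>. hoelder_norm 4 \<alpha> \<rho> < \<epsilon> \<and> \<bar>lam - real l\<bar> < \<epsilon> \<and> \<rho> \<noteq> (\<lambda>_. 0)"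
      using sol nz by (intro bexI[of _ "(?\<rho> s, ?lam s)"]) auto
  qed
  have exhaust: "\<exists>\<epsilon>>0. \<forall>(\<rho>', lam')\<in>solutions \<alpha> U \<psi>. hoelder_norm 4 \<alpha> \<rho>' < \<epsilon> \<and> \<bar>lam' - real l\<bar> < \<epsilon> \<longrightarrow>
      \<rho>' = (\<lambda>_. 0) \<or> (\<exists>s\<in>{-\<delta><..<\<delta>}. (\<rho>', lam') = (?\<rho> s, ?lam s))"
  proof -
    \<comment> \<open>The bound 1 forces the integer l' to equal l, and \<delta> places s inside the
      parameter interval of the curve.\<close>
    have "min \<delta> 1 > 0" using \<delta> by simp
    then obtain \<epsilon> where \<epsilon>: "0 < \<epsilon>" "\<forall>(\<rho>, lam)\<in>solutions \<alpha> U \<psi>. hoelder_norm 4 \<alpha> \<rho> < \<epsilon> \<and> \<bar>lam - real l\<bar> < \<epsilon> \<longrightarrow>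
       \<rho> = (\<lambda>_. 0) \<or> (\<exists>l'\<ge>1. \<exists>s. \<bar>s\<bar> < min \<delta> 1 \<and> \<bar>real l' - real l\<bar> < min \<delta> 1 \<and>
          \<rho> = P0 (radius l' s) \<and> lam = family_lambda l' s)"
      using solutions_near[OF lift lpos] by blast
    have "l' = l" if "\<bar>real l' - real l\<bar> < min \<delta> 1" for l' using that by linarith
    then show ?thesis using \<epsilon> by (intro exI[of _ \<epsilon>]) (fastforce simp: abs_less_iff)
  qed
  have analytic: "analytic_curve_on (little_hoelder0_even 4 \<alpha>) (hoelder_norm 4 \<alpha>) {-\<delta><..<\<delta>}
      (\<lambda>s. (?\<rho> s, ?lam s))"
    by (intro analytic_curve_onI P0_radius_little_hoelder0_even[OF l \<alpha>] P0_radius_analytic[OF l \<alpha>] lam_an small)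
  show "\<exists>\<delta>>0. \<exists>\<rho> lam.
       analytic_curve_on (little_hoelder0_even 4 \<alpha>) (hoelder_norm 4 \<alpha>)
         {-\<delta><..<\<delta>} (\<lambda>s. (\<rho> s, lam s)) \<and>
       \<rho> 0 = (\<lambda>_. 0) \<and> lam 0 = real l \<and>
       (\<forall>s\<in>{-\<delta><..<\<delta>}. s \<noteq> 0 \<longrightarrow> \<rho> s \<noteq> (\<lambda>_. 0)) \<and>
       (\<forall>s\<in>{-\<delta><..<\<delta>}. (\<rho> s, lam s) \<in> solutions \<alpha> U \<psi>) \<and>
       (\<exists>\<epsilon>>0. \<forall>(\<rho>', lam')\<in>solutions \<alpha> U \<psi>.
          hoelder_norm 4 \<alpha> \<rho>' < \<epsilon> \<and> \<bar>lam' - real l\<bar> < \<epsilon> \<longrightarrow>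
          \<rho>' = (\<lambda>_. 0) \<or> (\<exists>s\<in>{-\<delta><..<\<delta>}. (\<rho>', lam') = (\<rho> s, lam s)))"
    by (rule exI[of _ \<delta>], rule conjI[OF \<delta>], rule exI[of _ ?\<rho>], rule exI[of _ ?lam])
      (intro conjI ballI impI analytic exhaust \<rho>0 family_lambda_0[OF l \<alpha>] nz sol)
next
  fix lam0 :: real assume lam0: "0 < lam0" "lam0 \<notin> \<nat>"
  define n where "n = nat \<lfloor>lam0\<rfloor>"
  have n: "real n \<le> lam0" "lam0 < real n + 1" using lam0 by (auto simp: n_def)
  have "lam0 \<noteq> real n" using lam0(2) by auto
  \<comment> \<open>The smaller distance from lam0 to the neighbouring integers n and n + 1, so no
    natural number lies within d and only the trivial alternative remains.\<close>
  define d where "d = min (lam0 - real n) (real n + 1 - lam0)"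
  have d: "0 < d" using n \<open>lam0 \<noteq> real n\<close> by (auto simp: d_def)
  have d_le: "d \<le> lam0 - real n" "d \<le> real n + 1 - lam0" by (simp_all add: d_def)
  have far: "\<not> \<bar>real l - lam0\<bar> < d" for l
  proof (cases "l \<le> n")
    case True
    then have "real l \<le> real n" by simp
    then show ?thesis using d_le by linarith
  next
    case False
    then have "real n + 1 \<le> real l" by linarith
    then show ?thesis using d_le by linarith
  qed
  obtain e where "0 < e" "\<forall>(\<rho>, lam)\<in>solutions \<alpha> U \<psi>. hoelder_norm 4 \<alpha> \<rho> < e \<and> \<bar>lam - lam0\<bar> < e \<longrightarrow>
     \<rho> = (\<lambda>_. 0) \<or> (\<exists>l\<ge>1. \<exists>s. \<bar>s\<bar> < d \<and> \<bar>real l - lam0\<bar> < d \<and>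
        \<rho> = P0 (radius l s) \<and> lam = family_lambda l s)"
    using solutions_near[OF assms(3) lam0(1) d] by blast
  then show "\<not> bifurcation_point \<alpha> U \<psi> lam0"
    using far unfolding bifurcation_point_def by fastforce
qed

end
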